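(* Let $\Gamma$ be a unitarisable group, i.e. every uniformly bounded representation of $\Gamma$ on a Hilbert space is similar (conjugate by a bounded invertible operator) to a unitary representation. Then every unitary representation of $\Gamma$ is strongly rigid.
   Context: For unitary representations $\pi,\omega:\Gamma\to U(\mathcal H)$ put $\|\pi-\omega\|=\sup_\gamma\|\pi(\gamma)-\omega(\gamma)\|$ (operator norm). $\pi$ is rigid if there is $\varepsilon>0$ such that every $\omega\in\mathrm{Hom}(\Gamma,U(\mathcal H))$ with $\|\pi-\omega\|\le\varepsilon$ is unitarily equivalent to $\pi$. $\pi$ is strongly rigid if it is rigid and the orbit map $U(\mathcal H)/Z(\pi)\to\mathrm{Hom}(\Gamma,U(\mathcal H))$, $U\mapsto U\pi U^{-1}$, is a homeomorphism onto its image, where $Z(\pi)=\{u\in U(\mathcal H):u\pi(\gamma)u^{-1}=\pi(\gamma)\ \forall\gamma\}$, $U(\mathcal H)$ carries the norm topology and $\mathrm{Hom}(\Gamma,U(\mathcal H))$ the topology of the uniform distance above. *)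

theory Defs
  imports "HOL-Analysis.Abstract_Topology" "HOL-Algebra.Group"
begin

record 'u chspace =
  hcarrier :: "'u set"
  hzero :: 'u
  hadd :: "'u \<Rightarrow> 'u \<Rightarrow> 'u"
  hscale :: "complex \<Rightarrow> 'u \<Rightarrow> 'u"
  hinner :: "'u \<Rightarrow> 'u \<Rightarrow> complex"

definition hsub :: "'u chspace \<Rightarrow> 'u \<Rightarrow> 'u \<Rightarrow> 'u" where
  "hsub S x y = hadd S x (hscale S (-1) y)"

definition hnorm :: "'u chspace \<Rightarrow> 'u \<Rightarrow> real" where
  "hnorm S x = sqrt (Re (hinner S x x))"

definition hilbert_space :: "'u chspace \<Rightarrow> bool" where
  "hilbert_space S \<longleftrightarrow>
     (let V = hcarrier S in
      hzero S \<in> V \<and>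
      (\<forall>x\<in>V. \<forall>y\<in>V. hadd S x y \<in> V) \<and>
      (\<forall>c. \<forall>x\<in>V. hscale S c x \<in> V) \<and>
      (\<forall>x\<in>V. \<forall>y\<in>V. \<forall>z\<in>V. hadd S (hadd S x y) z = hadd S x (hadd S y z)) \<and>
      (\<forall>x\<in>V. \<forall>y\<in>V. hadd S x y = hadd S y x) \<and>
      (\<forall>x\<in>V. hadd S x (hzero S) = x) \<and>
      (\<forall>x\<in>V. \<exists>y\<in>V. hadd S x y = hzero S) \<and>
      (\<forall>c. \<forall>x\<in>V. \<forall>y\<in>V. hscale S c (hadd S x y) = hadd S (hscale S c x) (hscale S c y)) \<and>
      (\<forall>c d. \<forall>x\<in>V. hscale S (c + d) x = hadd S (hscale S c x) (hscale S d x)) \<and>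
      (\<forall>c d. \<forall>x\<in>V. hscale S c (hscale S d x) = hscale S (c * d) x) \<and>
      (\<forall>x\<in>V. hscale S 1 x = x) \<and>
      (\<forall>x\<in>V. \<forall>y\<in>V. \<forall>z\<in>V. hinner S (hadd S x y) z = hinner S x z + hinner S y z) \<and>
      (\<forall>c. \<forall>x\<in>V. \<forall>y\<in>V. hinner S (hscale S c x) y = c * hinner S x y) \<and>
      (\<forall>x\<in>V. \<forall>y\<in>V. hinner S y x = cnj (hinner S x y)) \<and>
      (\<forall>x\<in>V. 0 \<le> Re (hinner S x x)) \<and>
      (\<forall>x\<in>V. hinner S x x = 0 \<longrightarrow> x = hzero S) \<and>
      \<comment> \<open>completeness\<close>
      (\<forall>f :: nat \<Rightarrow> 'u. (\<forall>n. f n \<in> V) \<and>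
          (\<forall>e>0. \<exists>N. \<forall>m\<ge>N. \<forall>n\<ge>N. hnorm S (hsub S (f m) (f n)) < e)
        \<longrightarrow> (\<exists>x\<in>V. (\<lambda>n. hnorm S (hsub S (f n) x)) \<longlonglongrightarrow> 0)))"

definition bounded_op :: "'u chspace \<Rightarrow> ('u \<Rightarrow> 'u) \<Rightarrow> bool" where
  "bounded_op S T \<longleftrightarrow>
     (\<forall>x\<in>hcarrier S. T x \<in> hcarrier S) \<and>
     (\<forall>x\<in>hcarrier S. \<forall>y\<in>hcarrier S. T (hadd S x y) = hadd S (T x) (T y)) \<and>
     (\<forall>c. \<forall>x\<in>hcarrier S. T (hscale S c x) = hscale S c (T x)) \<and>
     (\<exists>C. \<forall>x\<in>hcarrier S. hnorm S (T x) \<le> C * hnorm S x)"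

definition opnorm :: "'u chspace \<Rightarrow> ('u \<Rightarrow> 'u) \<Rightarrow> real" where
  "opnorm S T = Sup ((\<lambda>x. hnorm S (T x)) ` {x \<in> hcarrier S. hnorm S x \<le> 1})"

definition unitary_op :: "'u chspace \<Rightarrow> ('u \<Rightarrow> 'u) \<Rightarrow> bool" where
  "unitary_op S U \<longleftrightarrow> bounded_op S U \<and> U ` hcarrier S = hcarrier S \<and>
     (\<forall>x\<in>hcarrier S. \<forall>y\<in>hcarrier S. hinner S (U x) (U y) = hinner S x y)"

definition ub_rep :: "('g, 'b) monoid_scheme \<Rightarrow> 'u chspace \<Rightarrow> ('g \<Rightarrow> 'u \<Rightarrow> 'u) \<Rightarrow> bool" where
  "ub_rep G S \<rho> \<longleftrightarrow>
     (\<forall>g\<in>carrier G. bounded_op S (\<rho> g)) \<and>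
     (\<forall>g\<in>carrier G. \<forall>h\<in>carrier G. \<forall>x\<in>hcarrier S. \<rho> (g \<otimes>\<^bsub>G\<^esub> h) x = \<rho> g (\<rho> h x)) \<and>
     (\<forall>x\<in>hcarrier S. \<rho> \<one>\<^bsub>G\<^esub> x = x) \<and>
     (\<exists>C. \<forall>g\<in>carrier G. opnorm S (\<rho> g) \<le> C)"

definition unitary_rep :: "('g, 'b) monoid_scheme \<Rightarrow> 'u chspace \<Rightarrow> ('g \<Rightarrow> 'u \<Rightarrow> 'u) \<Rightarrow> bool" where
  "unitary_rep G S \<pi> \<longleftrightarrow>
     (\<forall>g\<in>carrier G. unitary_op S (\<pi> g)) \<and>
     (\<forall>g\<in>carrier G. \<forall>h\<in>carrier G. \<forall>x\<in>hcarrier S. \<pi> (g \<otimes>\<^bsub>G\<^esub> h) x = \<pi> g (\<pi> h x)) \<and>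
     (\<forall>x\<in>hcarrier S. \<pi> \<one>\<^bsub>G\<^esub> x = x)"

definition similar_to_unitary :: "('g, 'b) monoid_scheme \<Rightarrow> 'u chspace \<Rightarrow> ('g \<Rightarrow> 'u \<Rightarrow> 'u) \<Rightarrow> bool" where
  "similar_to_unitary G S \<rho> \<longleftrightarrow>
     (\<exists>T Ti. bounded_op S T \<and> bounded_op S Ti \<and>
        (\<forall>x\<in>hcarrier S. T (Ti x) = x \<and> Ti (T x) = x) \<and>
        (\<forall>g\<in>carrier G. unitary_op S (\<lambda>x. T (\<rho> g (Ti x)))))"

text \<open>Unitarisability, relative to all Hilbert spaces whose underlying set lives in type 'u.\<close>
definition unitarisable_on :: "('g, 'b) monoid_scheme \<Rightarrow> 'u itself \<Rightarrow> bool" where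
  "unitarisable_on G (_ :: 'u itself) \<longleftrightarrow>
     (\<forall>(S :: 'u chspace) \<rho>. hilbert_space S \<longrightarrow> ub_rep G S \<rho> \<longrightarrow> similar_to_unitary G S \<rho>)"

text \<open>Unitary group U(H), with operators normalised to be extensional on the carrier.\<close>
definition uset :: "'u chspace \<Rightarrow> ('u \<Rightarrow> 'u) set" where
  "uset S = {U. unitary_op S U \<and> U \<in> extensional (hcarrier S)}"

text \<open>Hom(\<Gamma>, U(H)), with functions normalised to be extensional.\<close>
definition homset :: "('g, 'b) monoid_scheme \<Rightarrow> 'u chspace \<Rightarrow> ('g \<Rightarrow> 'u \<Rightarrow> 'u) set" where
  "homset G S = {\<omega>. unitary_rep G S \<omega> \<and> \<omega> \<in> extensional (carrier G) \<and>
                     (\<forall>g\<in>carrier G. \<omega> g \<in> extensional (hcarrier S))}"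

definition op_dist :: "'u chspace \<Rightarrow> ('u \<Rightarrow> 'u) \<Rightarrow> ('u \<Rightarrow> 'u) \<Rightarrow> real" where
  "op_dist S A B = opnorm S (\<lambda>x. hsub S (A x) (B x))"

definition rep_dist :: "('g, 'b) monoid_scheme \<Rightarrow> 'u chspace \<Rightarrow> ('g \<Rightarrow> 'u \<Rightarrow> 'u) \<Rightarrow> ('g \<Rightarrow> 'u \<Rightarrow> 'u) \<Rightarrow> real" where
  "rep_dist G S \<pi> \<omega> = Sup ((\<lambda>g. op_dist S (\<pi> g) (\<omega> g)) ` carrier G)"

definition conj_op :: "'u chspace \<Rightarrow> ('u \<Rightarrow> 'u) \<Rightarrow> ('u \<Rightarrow> 'u) \<Rightarrow> ('u \<Rightarrow> 'u)" where
  "conj_op S U A = (\<lambda>x\<in>hcarrier S. U (A (inv_into (hcarrier S) U x)))"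

definition orbit_map :: "('g, 'b) monoid_scheme \<Rightarrow> 'u chspace \<Rightarrow> ('g \<Rightarrow> 'u \<Rightarrow> 'u) \<Rightarrow> ('u \<Rightarrow> 'u) \<Rightarrow> ('g \<Rightarrow> 'u \<Rightarrow> 'u)" where
  "orbit_map G S \<pi> U = (\<lambda>g\<in>carrier G. conj_op S U (\<pi> g))"

definition unitarily_equiv :: "('g, 'b) monoid_scheme \<Rightarrow> 'u chspace \<Rightarrow> ('g \<Rightarrow> 'u \<Rightarrow> 'u) \<Rightarrow> ('g \<Rightarrow> 'u \<Rightarrow> 'u) \<Rightarrow> bool" where
  "unitarily_equiv G S \<pi> \<omega> \<longleftrightarrow>
     (\<exists>U\<in>uset S. \<forall>g\<in>carrier G. \<forall>x\<in>hcarrier S. \<omega> g x = conj_op S U (\<pi> g) x)"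

definition rigid :: "('g, 'b) monoid_scheme \<Rightarrow> 'u chspace \<Rightarrow> ('g \<Rightarrow> 'u \<Rightarrow> 'u) \<Rightarrow> bool" where
  "rigid G S \<pi> \<longleftrightarrow>
     (\<exists>\<epsilon>>0. \<forall>\<omega>\<in>homset G S. rep_dist G S \<pi> \<omega> \<le> \<epsilon> \<longrightarrow> unitarily_equiv G S \<pi> \<omega>)"

definition commutant :: "('g, 'b) monoid_scheme \<Rightarrow> 'u chspace \<Rightarrow> ('g \<Rightarrow> 'u \<Rightarrow> 'u) \<Rightarrow> ('u \<Rightarrow> 'u) set" where
  "commutant G S \<pi> = {u \<in> uset S. \<forall>g\<in>carrier G. \<forall>x\<in>hcarrier S. conj_op S u (\<pi> g) x = \<pi> g x}"

definition zcoset :: "('g, 'b) monoid_scheme \<Rightarrow> 'u chspace \<Rightarrow> ('g \<Rightarrow> 'u \<Rightarrow> 'u) \<Rightarrow> ('u \<Rightarrow> 'u) \<Rightarrow> ('u \<Rightarrow> 'u) set" where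
  "zcoset G S \<pi> U = (\<lambda>z. compose (hcarrier S) U z) ` commutant G S \<pi>"

definition dist_topology :: "'a set \<Rightarrow> ('a \<Rightarrow> 'a \<Rightarrow> real) \<Rightarrow> 'a topology" where
  "dist_topology A d = topology (\<lambda>W. W \<subseteq> A \<and> (\<forall>x\<in>W. \<exists>e>0. \<forall>y\<in>A. d x y < e \<longrightarrow> y \<in> W))"

definition quotient_topology :: "'a topology \<Rightarrow> ('a \<Rightarrow> 'b) \<Rightarrow> 'b topology" where
  "quotient_topology X f = topology (\<lambda>W. W \<subseteq> f ` topspace X \<and> openin X {x \<in> topspace X. f x \<in> W})"

definition strongly_rigid :: "('g, 'b) monoid_scheme \<Rightarrow> 'u chspace \<Rightarrow> ('g \<Rightarrow> 'u \<Rightarrow> 'u) \<Rightarrow> bool" where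
  "strongly_rigid G S \<pi> \<longleftrightarrow> rigid G S \<pi> \<and>
     homeomorphic_map
       (quotient_topology (dist_topology (uset S) (op_dist S)) (zcoset G S \<pi>))
       (subtopology (dist_topology (homset G S) (rep_dist G S)) (orbit_map G S \<pi> ` uset S))
       (\<lambda>C. orbit_map G S \<pi> (SOME U. U \<in> C))"

end

theory Submission
  imports Defs "HOL-Analysis.Elementary_Normed_Spaces"
begin

text \<open>
  The idea is to apply unitarisability once to an infinite direct sum, so as to get uniform constants.
  If \<open>\<omega>\<^sub>n\<close> are unitary representations with \<open>\<parallel>\<pi> - \<omega>\<^sub>n\<parallel> \<le> 1 / c\<^sub>n\<close> and \<open>c\<^sub>n \<rightarrow> \<infinity>\<close>, the block matrices with rows
  \<open>(\<pi>, c\<^sub>n (\<pi> - \<omega>\<^sub>n))\<close> and \<open>(0, \<omega>\<^sub>n)\<close> form a uniformly bounded representation on the \<open>\<ell>\<^sup>2\<close>-sum of copies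
  of \<open>H \<oplus> H\<close>. An equivalent invariant inner product yields, in each summand, an invariant complement of
  \<open>H \<oplus> 0\<close>, that is, the graph of an operator \<open>T\<^sub>n\<close> with \<open>T\<^sub>n \<omega>\<^sub>n - \<pi> T\<^sub>n = c\<^sub>n (\<pi> - \<omega>\<^sub>n)\<close> and \<open>\<parallel>T\<^sub>n\<parallel> \<le> M\<close>.
  Then \<open>1 + T\<^sub>n / c\<^sub>n\<close> intertwines \<open>\<omega>\<^sub>n\<close> with \<open>\<pi>\<close> and is close to \<open>1\<close>, and so is the unitary part of its polar
  decomposition. Hence representations near \<open>\<pi>\<close> are conjugate to it by unitaries near \<open>1\<close>, which gives
  rigidity and the openness of the orbit map.
\<close>

section \<open>Geometry of a Hilbert space given by a carrier\<close>

text \<open>Unitarisability supplies a similarity for each representation separately, with no bound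
  on its size, while rigidity asks for one \<delta> valid for all nearby \<omega>. Hence the
  argument by contradiction with a whole sequence: a single similarity of the sum bounds all blocks
  at once. The factor \<open>c\<^sub>n\<close> is harmless because d = c (\<pi> - \<omega>)
  satisfies d(gh) = \<pi>(g) d(h) + d(g) \<omega>(h) for every scalar c, and it is what makes the
  correction \<open>T\<^sub>n / c\<^sub>n\<close> small.

  Two obstacles shape the rest. Unitarisability is assumed only for Hilbert spaces over the type
  \<open>('g \<times> 'h) set\<close>, so the sum must be coded into that type; this is a
  cardinality argument for infinite H, and the zero space is treated apart. And the unitary part of
  1 + T/c has to come with its intertwining relations; an iteration by polynomials in an operator
  and its adjoint preserves them and avoids square roots.\<close>

locale hilbert =
  fixes S :: "'u chspace"
  assumes hilbert_space: "hilbert_space S"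
begin

abbreviation vcarrier ("V") where "V \<equiv> hcarrier S"
abbreviation vadd (infixl "\<oplus>" 65) where "x \<oplus> y \<equiv> hadd S x y"
abbreviation vsub (infixl "\<ominus>" 65) where "x \<ominus> y \<equiv> hsub S x y"
abbreviation vscale (infixr "\<odot>" 75) where "c \<odot> x \<equiv> hscale S c x"
abbreviation ip where "ip x y \<equiv> hinner S x y"
abbreviation nrm where "nrm x \<equiv> hnorm S x"

lemma zero_closed [simp]: "hzero S \<in> V"
  and add_closed [simp]: "\<lbrakk>x \<in> V; y \<in> V\<rbrakk> \<Longrightarrow> x \<oplus> y \<in> V"
  and scale_closed [simp]: "x \<in> V \<Longrightarrow> c \<odot> x \<in> V"
  and add_zero: "x \<in> V \<Longrightarrow> x \<oplus> hzero S = x"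
  and ip_add_left [simp]: "\<lbrakk>x \<in> V; y \<in> V; z \<in> V\<rbrakk> \<Longrightarrow> ip (x \<oplus> y) z = ip x z + ip y z"
  and ip_scale_left [simp]: "\<lbrakk>x \<in> V; y \<in> V\<rbrakk> \<Longrightarrow> ip (c \<odot> x) y = c * ip x y"
  and ip_commute: "\<lbrakk>x \<in> V; y \<in> V\<rbrakk> \<Longrightarrow> ip y x = cnj (ip x y)"
  and ip_self_nonneg: "x \<in> V \<Longrightarrow> 0 \<le> Re (ip x x)"
  and ip_self_eq_0: "\<lbrakk>x \<in> V; ip x x = 0\<rbrakk> \<Longrightarrow> x = hzero S"
  and add_commute: "\<lbrakk>x \<in> V; y \<in> V\<rbrakk> \<Longrightarrow> x \<oplus> y = y \<oplus> x"
  and add_assoc: "\<lbrakk>x \<in> V; y \<in> V; z \<in> V\<rbrakk> \<Longrightarrow> x \<oplus> y \<oplus> z = x \<oplus> (y \<oplus> z)"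
  and scale_add_left: "x \<in> V \<Longrightarrow> (c + d) \<odot> x = c \<odot> x \<oplus> d \<odot> x"
  and scale_scale: "x \<in> V \<Longrightarrow> c \<odot> d \<odot> x = (c * d) \<odot> x"
  and scale_one: "x \<in> V \<Longrightarrow> 1 \<odot> x = x"
  by ((insert hilbert_space[unfolded hilbert_space_def Let_def], elim conjE, meson)+)

lemma complete:
  assumes "\<And>n. f n \<in> V"
    and "\<And>e. e > 0 \<Longrightarrow> \<exists>N::nat. \<forall>m\<ge>N. \<forall>n\<ge>N. nrm (f m \<ominus> f n) < e"
  shows "\<exists>x\<in>V. (\<lambda>n. nrm (f n \<ominus> x)) \<longlonglongrightarrow> 0"
  using hilbert_space assms unfolding hilbert_space_def Let_def by blast

lemma sub_closed [simp]: "\<lbrakk>x \<in> V; y \<in> V\<rbrakk> \<Longrightarrow> x \<ominus> y \<in> V"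
  by (simp add: hsub_def)

lemma ip_sub_left [simp]: "\<lbrakk>x \<in> V; y \<in> V; z \<in> V\<rbrakk> \<Longrightarrow> ip (x \<ominus> y) z = ip x z - ip y z"
  by (simp add: hsub_def)

lemma ip_add_right [simp]: "\<lbrakk>x \<in> V; y \<in> V; z \<in> V\<rbrakk> \<Longrightarrow> ip z (x \<oplus> y) = ip z x + ip z y"
  using ip_commute[of "x \<oplus> y" z] ip_commute[of x z] ip_commute[of y z] by simp

lemma ip_scale_right [simp]: "\<lbrakk>x \<in> V; y \<in> V\<rbrakk> \<Longrightarrow> ip y (c \<odot> x) = cnj c * ip y x"
  using ip_commute[of "c \<odot> x" y] ip_commute[of x y] by simp

lemma ip_sub_right [simp]: "\<lbrakk>x \<in> V; y \<in> V; z \<in> V\<rbrakk> \<Longrightarrow> ip z (x \<ominus> y) = ip z x - ip z y"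
  by (simp add: hsub_def)

lemma ip_zero_left [simp]: "x \<in> V \<Longrightarrow> ip (hzero S) x = 0"
  using ip_add_left[of "hzero S" "hzero S" x] by (simp add: add_zero)

lemma ip_zero_right [simp]: "x \<in> V \<Longrightarrow> ip x (hzero S) = 0"
  using ip_commute[of "hzero S" x] by simp

lemma ip_self: "x \<in> V \<Longrightarrow> ip x x = complex_of_real ((nrm x)\<^sup>2)"
  using ip_commute[of x x] ip_self_nonneg[of x]
  by (auto simp: hnorm_def complex_eq_iff)

lemma nrm_sq: "x \<in> V \<Longrightarrow> (nrm x)\<^sup>2 = Re (ip x x)"
  using ip_self[of x] by simp

lemma nrm_nonneg [simp]: "x \<in> V \<Longrightarrow> 0 \<le> nrm x"
  by (simp add: hnorm_def ip_self_nonneg)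

lemma nrm_eq_0: "x \<in> V \<Longrightarrow> nrm x = 0 \<Longrightarrow> x = hzero S"
  using ip_self[of x] ip_self_eq_0[of x] by simp

lemma eq_if_sub_eq_zero:
  assumes "x \<in> V" "y \<in> V" "x \<ominus> y = hzero S" shows "x = y"
proof -
  have 0: "0 \<odot> y = hzero S"
    using ip_self_eq_0[of "0 \<odot> y"] assms by simp
  have "y = hzero S \<oplus> y" using assms add_zero add_commute zero_closed by metis
  also have "\<dots> = (x \<oplus> (-1) \<odot> y) \<oplus> 1 \<odot> y" using assms by (simp add: hsub_def scale_one)
  also have "\<dots> = x \<oplus> ((-1) \<odot> y \<oplus> 1 \<odot> y)" using assms by (simp add: add_assoc)
  also have "(-1) \<odot> y \<oplus> 1 \<odot> y = hzero S"
    using scale_add_left[of y "-1" 1] assms 0 by simp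
  finally show ?thesis using add_zero assms by simp
qed

text \<open>The inner product is non-degenerate. This turns an identity between vectors into one
  between complex numbers, which is how most of the linear algebra below is carried out.\<close>

lemma ip_left_eqI:
  assumes "x \<in> V" "y \<in> V" "\<And>z. z \<in> V \<Longrightarrow> ip x z = ip y z" shows "x = y"
  by (rule eq_if_sub_eq_zero[OF _ _ ip_self_eq_0]) (simp_all add: assms)

lemma ip_right_eqI:
  assumes "x \<in> V" "y \<in> V" "\<And>z. z \<in> V \<Longrightarrow> ip z x = ip z y" shows "x = y"
  by (rule eq_if_sub_eq_zero[OF _ _ ip_self_eq_0]) (simp_all add: assms)

lemma nrm_scale [simp]: "x \<in> V \<Longrightarrow> nrm (c \<odot> x) = cmod c * nrm x"
proof -
  assume x: "x \<in> V"
  have "complex_of_real ((nrm (c \<odot> x))\<^sup>2) = c * cnj c * complex_of_real ((nrm x)\<^sup>2)"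
    using x ip_self[of "c \<odot> x"] ip_self[OF x] by (simp add: mult.assoc mult.left_commute)
  also have "\<dots> = complex_of_real ((cmod c * nrm x)\<^sup>2)"
    by (simp add: power_mult_distrib flip: complex_norm_square)
  finally have "(nrm (c \<odot> x))\<^sup>2 = (cmod c * nrm x)\<^sup>2" using of_real_eq_iff by blast
  thus ?thesis using x power2_eq_iff_nonneg[of "nrm (c \<odot> x)" "cmod c * nrm x"] by simp
qed

lemma nrm_zero [simp]: "nrm (hzero S) = 0"
  by (simp add: hnorm_def)

lemma Cauchy_Schwarz:
  assumes x: "x \<in> V" and y: "y \<in> V"
  shows "cmod (ip x y) \<le> nrm x * nrm y"
proof (cases "nrm y = 0")
  case True
  then have "y = hzero S" using nrm_eq_0 y by blast
  then show ?thesis using x by simp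
next
  case False
  define a where "a = ip x y"
  \<comment> \<open>The coefficient of the orthogonal projection of x onto the line through y, so
    that x - t y has the least possible norm.\<close>
  define t where "t = a / complex_of_real ((nrm y)\<^sup>2)"
  have yx: "ip y x = cnj a" using ip_commute[OF x y] by (simp add: a_def)
  have "0 \<le> Re (ip (x \<ominus> t \<odot> y) (x \<ominus> t \<odot> y))"
    using x y by (intro ip_self_nonneg) simp
  also have "ip (x \<ominus> t \<odot> y) (x \<ominus> t \<odot> y) = complex_of_real ((nrm x)\<^sup>2) - a * cnj a / complex_of_real ((nrm y)\<^sup>2)"
    using x y False by (simp add: ip_self[OF x] ip_self[OF y] yx a_def[symmetric] t_def field_simps)
  also have "a * cnj a = complex_of_real ((cmod a)\<^sup>2)"
    using complex_norm_square by metis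
  finally have "(cmod a)\<^sup>2 / (nrm y)\<^sup>2 \<le> (nrm x)\<^sup>2"
    by (simp flip: of_real_power of_real_divide of_real_diff)
  then have "(cmod a)\<^sup>2 \<le> (nrm x * nrm y)\<^sup>2"
    using False by (simp add: divide_le_eq power_mult_distrib)
  then have "cmod a \<le> nrm x * nrm y" by (rule power2_le_imp_le) (simp add: x y)
  then show ?thesis by (simp add: a_def)
qed

lemma nrm_add_sq:
  assumes "x \<in> V" "y \<in> V"
  shows "(nrm (x \<oplus> y))\<^sup>2 = (nrm x)\<^sup>2 + (nrm y)\<^sup>2 + 2 * Re (ip x y)"
proof -
  have "Re (ip y x) = Re (ip x y)" using ip_commute[OF assms] by simp
  then show ?thesis using assms by (simp add: nrm_sq)
qed

lemma nrm_sub_sq: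
  assumes "x \<in> V" "y \<in> V"
  shows "(nrm (x \<ominus> y))\<^sup>2 = (nrm x)\<^sup>2 + (nrm y)\<^sup>2 - 2 * Re (ip x y)"
proof -
  have "Re (ip y x) = Re (ip x y)" using ip_commute[OF assms] by simp
  then show ?thesis using assms by (simp add: nrm_sq)
qed

lemma nrm_triangle:
  assumes x: "x \<in> V" and y: "y \<in> V"
  shows "nrm (x \<oplus> y) \<le> nrm x + nrm y"
proof -
  have "Re (ip x y) \<le> nrm x * nrm y"
    using Cauchy_Schwarz[OF x y] complex_Re_le_cmod order_trans by blast
  then have "(nrm (x \<oplus> y))\<^sup>2 \<le> (nrm x + nrm y)\<^sup>2"
    using assms by (simp add: nrm_add_sq power2_sum)
  then show ?thesis by (rule power2_le_imp_le) (simp add: x y)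
qed

lemma nrm_sub_commute: "\<lbrakk>x \<in> V; y \<in> V\<rbrakk> \<Longrightarrow> nrm (x \<ominus> y) = nrm (y \<ominus> x)"
  unfolding hnorm_def by (simp add: algebra_simps)

lemma nrm_sub_triangle:
  assumes "x \<in> V" "y \<in> V" "z \<in> V"
  shows "nrm (x \<ominus> z) \<le> nrm (x \<ominus> y) + nrm (y \<ominus> z)"
proof -
  have "x \<ominus> z = (x \<ominus> y) \<oplus> (y \<ominus> z)" using assms by (intro ip_left_eqI) simp_all
  then show ?thesis using nrm_triangle[of "x \<ominus> y" "y \<ominus> z"] assms by simp
qed

lemma nrm_sub_le:
  assumes "x \<in> V" "y \<in> V" shows "nrm (x \<ominus> y) \<le> nrm x + nrm y"
  using nrm_triangle[of x "(-1) \<odot> y"] assms by (simp add: hsub_def)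

lemma nrm_le_sub:
  assumes "x \<in> V" "y \<in> V" shows "nrm x \<le> nrm (x \<ominus> y) + nrm y"
proof -
  have "x = (x \<ominus> y) \<oplus> y" using assms by (intro ip_left_eqI) simp_all
  then show ?thesis using nrm_triangle[of "x \<ominus> y" y] assms by simp
qed

section \<open>Norm convergence\<close>

definition vconv :: "(nat \<Rightarrow> 'u) \<Rightarrow> 'u \<Rightarrow> bool" where
  "vconv f x \<longleftrightarrow> (\<forall>n. f n \<in> V) \<and> x \<in> V \<and> (\<lambda>n. nrm (f n \<ominus> x)) \<longlonglongrightarrow> 0"

lemma vconv_const: "x \<in> V \<Longrightarrow> vconv (\<lambda>n. x) x"
  unfolding vconv_def by (simp add: hnorm_def)

lemma tendsto_nrm:
  assumes "vconv f x" shows "(\<lambda>n. nrm (f n)) \<longlonglongrightarrow> nrm x"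
proof (rule LIM_zero_cancel, rule Lim_null_comparison)
  show "(\<lambda>n. nrm (f n \<ominus> x)) \<longlonglongrightarrow> 0" using assms by (simp add: vconv_def)
  have "\<bar>nrm (f n) - nrm x\<bar> \<le> nrm (f n \<ominus> x)" for n
    using nrm_le_sub[of "f n" x] nrm_le_sub[of x "f n"] nrm_sub_commute[of x "f n"] assms
    by (simp add: vconv_def)
  then show "\<forall>\<^sub>F n in sequentially. norm (nrm (f n) - nrm x) \<le> nrm (f n \<ominus> x)" by simp
qed

lemma tendsto_ip:
  assumes f: "vconv f x" and g: "vconv g y"
  shows "(\<lambda>n. ip (f n) (g n)) \<longlonglongrightarrow> ip x y"
proof (rule LIM_zero_cancel, rule Lim_null_comparison)
  have "(\<lambda>n. nrm (f n \<ominus> x) * nrm (g n) + nrm x * nrm (g n \<ominus> y)) \<longlonglongrightarrow> 0 * nrm y + nrm x * 0"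
    using f g tendsto_nrm[OF g] by (intro tendsto_intros) (auto simp: vconv_def)
  then show "(\<lambda>n. nrm (f n \<ominus> x) * nrm (g n) + nrm x * nrm (g n \<ominus> y)) \<longlonglongrightarrow> 0" by simp
  have "cmod (ip (f n) (g n) - ip x y) \<le> nrm (f n \<ominus> x) * nrm (g n) + nrm x * nrm (g n \<ominus> y)" for n
  proof -
    have V: "f n \<in> V" "x \<in> V" "g n \<in> V" "y \<in> V" using f g by (auto simp: vconv_def)
    have "ip (f n) (g n) - ip x y = ip (f n \<ominus> x) (g n) + ip x (g n \<ominus> y)" using V by simp
    also have "cmod \<dots> \<le> cmod (ip (f n \<ominus> x) (g n)) + cmod (ip x (g n \<ominus> y))" by (rule norm_triangle_ineq)
    also have "\<dots> \<le> nrm (f n \<ominus> x) * nrm (g n) + nrm x * nrm (g n \<ominus> y)"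
      using V by (intro add_mono Cauchy_Schwarz) auto
    finally show ?thesis .
  qed
  then show "\<forall>\<^sub>F n in sequentially. norm (ip (f n) (g n) - ip x y)
      \<le> nrm (f n \<ominus> x) * nrm (g n) + nrm x * nrm (g n \<ominus> y)" by simp
qed

text \<open>Steps bounded by C / 2^n telescope, so the sequence is Cauchy and moves by at most 2 C
  in total. The Newton iteration below produces steps of this size.\<close>

lemma geometric_limit:
  assumes f: "\<And>n. f n \<in> V" and step: "\<And>n. nrm (f (Suc n) \<ominus> f n) \<le> C * (1/2)^n"
  shows "\<exists>x. vconv f x \<and> nrm (x \<ominus> f 0) \<le> 2 * C"
proof -
  have C: "0 \<le> C" using order_trans[OF nrm_nonneg step[of 0]] f by simp
  have tele: "nrm (f (n + k) \<ominus> f n) \<le> 2 * C * ((1/2)^n - (1/2)^(n+k))" for n k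
  proof (induction k)
    case 0
    then show ?case using f[of n] by (simp add: hnorm_def)
  next
    case (Suc k)
    have "nrm (f (n + Suc k) \<ominus> f n) \<le> nrm (f (Suc (n + k)) \<ominus> f (n + k)) + nrm (f (n + k) \<ominus> f n)"
      using nrm_sub_triangle[of "f (Suc (n+k))" "f (n + k)" "f n"] f by simp
    also have "\<dots> \<le> C * (1/2)^(n+k) + 2 * C * ((1/2)^n - (1/2)^(n+k))"
      using step[of "n+k"] Suc.IH by simp
    also have "\<dots> = 2 * C * ((1/2)^n - (1/2)^(n+Suc k))" by (simp add: field_simps)
    finally show ?case .
  qed
  have tele': "nrm (f m \<ominus> f n) \<le> 2 * C * (1/2)^N" if "m \<ge> N" "n \<ge> N" for m n N
  proof -
    have *: "nrm (f m \<ominus> f n) \<le> 2 * C * (1/2)^N" if "m \<ge> n" "n \<ge> N" for m n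
    proof -
      have "nrm (f m \<ominus> f n) \<le> 2 * C * ((1/2)^n - (1/2)^m)"
        using tele[of n "m - n"] that by simp
      also have "\<dots> \<le> 2 * C * (1/2)^N"
      proof (intro mult_left_mono)
        have "(1/2::real)^n \<le> (1/2)^N" using that by (intro power_decreasing) auto
        then show "(1/2::real)^n - (1/2)^m \<le> (1/2)^N"
          using zero_le_power[of "1/2::real" m] by linarith
      qed (use C in auto)
      finally show ?thesis .
    qed
    show ?thesis
      using *[of n m] *[of m n] that nrm_sub_commute[of "f m" "f n"] f by (cases "m \<ge> n") auto
  qed
  have "\<exists>x\<in>V. (\<lambda>n. nrm (f n \<ominus> x)) \<longlonglongrightarrow> 0"
  proof (rule complete)
    fix e :: real assume e: "e > 0"
    have "(\<lambda>N. 2 * C * (1/2)^N) \<longlonglongrightarrow> 2 * C * 0"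
      by (intro tendsto_intros) auto
    then have "\<forall>\<^sub>F N in sequentially. 2 * C * (1/2)^N < e"
      using e by (intro order_tendstoD) auto
    then obtain N where "2 * C * (1/2)^N < e" by (auto simp: eventually_sequentially)
    then show "\<exists>N. \<forall>m\<ge>N. \<forall>n\<ge>N. nrm (f m \<ominus> f n) < e"
      using tele' by (intro exI[of _ N]) (meson le_less_trans)
  qed (rule f)
  then obtain x where x: "x \<in> V" and lim: "(\<lambda>n. nrm (f n \<ominus> x)) \<longlonglongrightarrow> 0" by blast
  have "nrm (x \<ominus> f 0) \<le> nrm (f n \<ominus> x) + 2 * C" for n
    using nrm_sub_triangle[of x "f n" "f 0"] tele'[of 0 n 0] nrm_sub_commute[of x "f n"] f x by simp
  moreover have "(\<lambda>n. nrm (f n \<ominus> x) + 2 * C) \<longlonglongrightarrow> 0 + 2 * C"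
    by (intro tendsto_intros lim)
  ultimately have "nrm (x \<ominus> f 0) \<le> 2 * C"
    using LIMSEQ_le_const[of _ "2 * C" "nrm (x \<ominus> f 0)"] by auto
  then show ?thesis using x lim f by (auto simp: vconv_def)
qed

section \<open>Bounded operators, Riesz representation and adjoints\<close>

lemma op_closed: "\<lbrakk>bounded_op S T; x \<in> V\<rbrakk> \<Longrightarrow> T x \<in> V"
  and op_add: "\<lbrakk>bounded_op S T; x \<in> V; y \<in> V\<rbrakk> \<Longrightarrow> T (x \<oplus> y) = T x \<oplus> T y"
  and op_scale: "\<lbrakk>bounded_op S T; x \<in> V\<rbrakk> \<Longrightarrow> T (c \<odot> x) = c \<odot> T x"
  by (simp_all add: bounded_op_def)

lemma op_sub: "\<lbrakk>bounded_op S T; x \<in> V; y \<in> V\<rbrakk> \<Longrightarrow> T (x \<ominus> y) = T x \<ominus> T y"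
  by (simp add: hsub_def op_add op_scale)

lemma op_bound:
  assumes "bounded_op S T"
  obtains C where "C > 0" "\<And>x. x \<in> V \<Longrightarrow> nrm (T x) \<le> C * nrm x"
proof -
  obtain C where C: "\<forall>x\<in>V. nrm (T x) \<le> C * nrm x" using assms by (auto simp: bounded_op_def)
  have "nrm (T x) \<le> (\<bar>C\<bar> + 1) * nrm x" if "x \<in> V" for x
    using order_trans[OF C[rule_format, OF that] mult_right_mono[of C "\<bar>C\<bar> + 1" "nrm x"]] that by simp
  then show thesis using that[of "\<bar>C\<bar> + 1"] by simp
qed

lemma bounded_opI:
  assumes "\<And>x. x \<in> V \<Longrightarrow> T x \<in> V"
    and "\<And>x y. x \<in> V \<Longrightarrow> y \<in> V \<Longrightarrow> T (x \<oplus> y) = T x \<oplus> T y"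
    and "\<And>c x. x \<in> V \<Longrightarrow> T (c \<odot> x) = c \<odot> T x"
    and "\<And>x. x \<in> V \<Longrightarrow> nrm (T x) \<le> C * nrm x"
  shows "bounded_op S T"
  using assms unfolding bounded_op_def by blast

text \<open>A variational proof: if v represents \<phi>, then |x|^2 - 2 Re \<phi>(x) = |x - v|^2 -
  |v|^2, so v must minimise the left-hand side over the whole space. Working with this functional
  avoids kernels and orthogonal complements of subspaces.\<close>

lemma riesz:
  assumes add: "\<And>x y. x \<in> V \<Longrightarrow> y \<in> V \<Longrightarrow> \<phi> (x \<oplus> y) = \<phi> x + \<phi> y"
    and scale: "\<And>c x. x \<in> V \<Longrightarrow> \<phi> (c \<odot> x) = c * \<phi> x"
    and bound: "\<And>x. x \<in> V \<Longrightarrow> cmod (\<phi> x) \<le> D * nrm x"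
  shows "\<exists>v\<in>V. \<forall>x\<in>V. \<phi> x = ip x v"
proof -
  define Q where "Q x = (nrm x)\<^sup>2 - 2 * Re (\<phi> x)" for x
  have low: "- D\<^sup>2 \<le> Q x" if "x \<in> V" for x
  proof -
    have "Re (\<phi> x) \<le> D * nrm x" using bound[OF that] complex_Re_le_cmod order_trans by blast
    moreover have "0 \<le> (nrm x - D)\<^sup>2" by simp
    ultimately show ?thesis by (simp add: Q_def power2_diff mult.commute)
  qed
  define m where "m = Inf (Q ` V)"
  have bdd: "bdd_below (Q ` V)" using low by (intro bdd_belowI2)
  have m: "m \<le> Q x" if "x \<in> V" for x unfolding m_def using bdd that by (intro cInf_lower) auto
  have "\<exists>x\<in>V. Q x < m + 1 / Suc n" for n
  proof -
    have "Inf (Q ` V) < m + 1 / Suc n" by (simp add: m_def)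
    then show ?thesis using cInf_lessD[of "Q ` V" "m + 1 / Suc n"] zero_closed by blast
  qed
  then obtain f where f: "\<And>n. f n \<in> V" and Qf: "\<And>n. Q (f n) < m + 1 / Suc n" by metis
  \<comment> \<open>Parallelogram law, in which the linear terms cancel. As the midpoint has value
    at least m, two points with values below m + e^2/4 are at distance less than e.\<close>
  have par: "(nrm (x \<ominus> y))\<^sup>2 = 2 * Q x + 2 * Q y - 4 * Q ((1/2) \<odot> (x \<oplus> y))" if "x \<in> V" "y \<in> V" for x y
    using that by (simp add: Q_def nrm_sub_sq nrm_add_sq add scale power_mult_distrib power_divide) (simp add: field_simps)
  have "\<exists>x\<in>V. (\<lambda>n. nrm (f n \<ominus> x)) \<longlonglongrightarrow> 0"
  proof (rule complete)
    fix e :: real assume e: "e > 0"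
    then obtain N where N: "inverse (Suc N) < e\<^sup>2 / 4" using reals_Archimedean[of "e\<^sup>2/4"] by auto
    have "nrm (f k \<ominus> f n) < e" if "k \<ge> N" "n \<ge> N" for k n
    proof -
      have "1 / Suc k \<le> 1 / Suc N" "1 / Suc n \<le> 1 / Suc N" using that by (auto simp: field_simps)
      then have "Q (f k) < m + e\<^sup>2/4" "Q (f n) < m + e\<^sup>2/4"
        using N Qf[of k] Qf[of n] by (auto simp: inverse_eq_divide)
      then have "(nrm (f k \<ominus> f n))\<^sup>2 < e\<^sup>2"
        using par[OF f[of k] f[of n]] m[of "(1/2) \<odot> (f k \<oplus> f n)"] f by simp
      then show ?thesis by (rule power2_less_imp_less) (use e in simp)
    qed
    then show "\<exists>N. \<forall>m\<ge>N. \<forall>n\<ge>N. nrm (f m \<ominus> f n) < e" by blast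
  qed (rule f)
  then obtain v where v: "v \<in> V" and lim: "(\<lambda>n. nrm (f n \<ominus> v)) \<longlonglongrightarrow> 0" by blast
  have \<phi>_sub: "\<phi> (x \<ominus> y) = \<phi> x - \<phi> y" if "x \<in> V" "y \<in> V" for x y
    using that by (simp add: hsub_def add scale)
  have "(\<lambda>n. \<phi> (f n)) \<longlonglongrightarrow> \<phi> v"
  proof (rule LIM_zero_cancel, rule Lim_null_comparison)
    show "\<forall>\<^sub>F n in sequentially. norm (\<phi> (f n) - \<phi> v) \<le> D * nrm (f n \<ominus> v)"
      using bound[of "f _ \<ominus> v"] f v by (simp add: \<phi>_sub)
    show "(\<lambda>n. D * nrm (f n \<ominus> v)) \<longlonglongrightarrow> 0" using tendsto_mult[OF tendsto_const lim] by simp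
  qed
  moreover have "(\<lambda>n. nrm (f n)) \<longlonglongrightarrow> nrm v"
    using tendsto_nrm f v lim by (simp add: vconv_def)
  ultimately have "(\<lambda>n. Q (f n)) \<longlonglongrightarrow> Q v" unfolding Q_def by (intro tendsto_intros)
  moreover have "(\<lambda>n. m + 1 / Suc n) \<longlonglongrightarrow> m + 0"
    using LIMSEQ_inverse_real_of_nat by (intro tendsto_intros) (simp add: inverse_eq_divide)
  ultimately have "Q v \<le> m + 0" using Qf by (intro LIMSEQ_le[of _ "Q v"]) (auto intro: less_imp_le)
  then have Qv: "Q v \<le> Q x" if "x \<in> V" for x using m[OF that] by simp
  have "\<phi> x = ip x v" if x: "x \<in> V" for x
  proof (rule ccontr)
    define z where "z = ip x v - \<phi> x"
    assume "\<phi> x \<noteq> ip x v"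
    then have z: "cmod z > 0" by (simp add: z_def)
    \<comment> \<open>For a step t x from v, the linear change of Q is 2 Re (t z) and the quadratic
      one is |t x|^2. The phase of t makes the linear one equal to -2 s |z|^2, and s |x|^2 < 1 keeps
      the quadratic one smaller, which contradicts minimality.\<close>
    define s where "s = 1 / ((nrm x)\<^sup>2 + 1)"
    have s: "s > 0" "s * (nrm x)\<^sup>2 < 1" by (auto simp: s_def field_simps add_pos_nonneg)
    define t where "t = - complex_of_real s * cnj z"
    have ipv: "ip v x = cnj (ip x v)" using ip_commute[OF x v] .
    have "Q (v \<oplus> t \<odot> x) = Q v + (cmod t * nrm x)\<^sup>2 + 2 * Re (t * z)"
      using x v ipv by (simp add: Q_def nrm_add_sq add scale z_def algebra_simps)
    moreover have "t * z = - complex_of_real (s * (cmod z)\<^sup>2)"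
      unfolding t_def using complex_norm_square[of z] by (simp add: mult.commute)
    moreover have "cmod t = s * cmod z" using s by (simp add: t_def norm_mult)
    ultimately have "0 \<le> (s * cmod z * nrm x)\<^sup>2 - 2 * (s * (cmod z)\<^sup>2)"
      using Qv[of "v \<oplus> t \<odot> x"] x v by simp
    also have "\<dots> = s * (cmod z)\<^sup>2 * (s * (nrm x)\<^sup>2 - 2)" by (simp add: power2_eq_square algebra_simps)
    also have "\<dots> < 0" using s z by (intro mult_pos_neg) auto
    finally show False by simp
  qed
  then show ?thesis using v by blast
qed

lemma adjoint_exists:
  assumes A: "bounded_op S A"
  shows "\<exists>A'. bounded_op S A' \<and> (\<forall>x\<in>V. \<forall>y\<in>V. ip (A x) y = ip x (A' y))"
proof -
  obtain C where C: "C > 0" "\<And>x. x \<in> V \<Longrightarrow> nrm (A x) \<le> C * nrm x" using op_bound[OF A] by blast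
  have "\<exists>v\<in>V. \<forall>x\<in>V. ip (A x) y = ip x v" if y: "y \<in> V" for y
  proof (rule riesz)
    fix x assume x: "x \<in> V"
    have "cmod (ip (A x) y) \<le> nrm (A x) * nrm y" using x y A by (intro Cauchy_Schwarz) (auto simp: op_closed)
    also have "\<dots> \<le> (C * nrm x) * nrm y" using C x y by (intro mult_right_mono) auto
    finally show "cmod (ip (A x) y) \<le> (C * nrm y) * nrm x" by (simp add: ac_simps)
  qed (use y A in \<open>auto simp: op_add op_scale op_closed\<close>)
  then obtain A' where A': "\<And>y. y \<in> V \<Longrightarrow> A' y \<in> V" and
    adj: "\<And>x y. x \<in> V \<Longrightarrow> y \<in> V \<Longrightarrow> ip (A x) y = ip x (A' y)" by metis
  have "bounded_op S A'"
  proof (rule bounded_opI)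
    fix y assume y: "y \<in> V"
    have "(nrm (A' y))\<^sup>2 = Re (ip (A (A' y)) y)" using y A' adj[of "A' y" y] by (simp add: nrm_sq)
    also have "\<dots> \<le> nrm (A (A' y)) * nrm y"
      using Cauchy_Schwarz[of "A (A' y)" y] complex_Re_le_cmod y A' A op_closed order_trans by blast
    also have "\<dots> \<le> (C * nrm (A' y)) * nrm y" using C y A' by (intro mult_right_mono) auto
    finally have "nrm (A' y) * nrm (A' y) \<le> nrm (A' y) * (C * nrm y)"
      by (simp add: power2_eq_square ac_simps)
    then show "nrm (A' y) \<le> C * nrm y"
      using y A' C by (cases "nrm (A' y) = 0") (auto simp: mult_le_cancel_left zero_less_iff_neq_zero order_less_le)
  next
    fix x y assume "x \<in> V" "y \<in> V"
    then show "A' (x \<oplus> y) = A' x \<oplus> A' y"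
      using op_closed[OF A] by (intro ip_right_eqI) (auto simp: A' simp flip: adj)
  next
    fix c x assume "x \<in> V"
    then show "A' (c \<odot> x) = c \<odot> A' x"
      using op_closed[OF A] by (intro ip_right_eqI) (auto simp: A' simp flip: adj)
  qed (rule A')
  then show ?thesis using adj by blast
qed

end

section \<open>The unitary factor of an operator close to a unitary\<close>

context hilbert
begin

lemma bounded_op_compose:
  assumes A: "bounded_op S A" and B: "bounded_op S B"
  shows "bounded_op S (\<lambda>x. A (B x))"
proof -
  obtain C where C: "C > 0" "\<And>x. x \<in> V \<Longrightarrow> nrm (A x) \<le> C * nrm x" using op_bound[OF A] by blast
  obtain D where D: "D > 0" "\<And>x. x \<in> V \<Longrightarrow> nrm (B x) \<le> D * nrm x" using op_bound[OF B] by blast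
  show ?thesis
  proof (rule bounded_opI)
    fix x assume x: "x \<in> V"
    have "nrm (A (B x)) \<le> C * nrm (B x)" using C B x by (simp add: op_closed)
    also have "\<dots> \<le> C * (D * nrm x)" using C D x by (intro mult_left_mono) auto
    finally show "nrm (A (B x)) \<le> (C * D) * nrm x" by (simp add: mult.assoc)
  qed (use A B in \<open>auto simp: op_closed op_add op_scale\<close>)
qed

lemma bounded_op_scale:
  assumes A: "bounded_op S A"
  shows "bounded_op S (\<lambda>x. c \<odot> A x)"
proof -
  obtain C where C: "C > 0" "\<And>x. x \<in> V \<Longrightarrow> nrm (A x) \<le> C * nrm x" using op_bound[OF A] by blast
  show ?thesis
  proof (rule bounded_opI)
    fix x assume x: "x \<in> V"
    then show "nrm (c \<odot> A x) \<le> (cmod c * C) * nrm x"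
      using C(2)[OF x] by (simp add: A op_closed mult.assoc mult_left_mono)
  next
    fix x y assume "x \<in> V" "y \<in> V"
    then show "c \<odot> A (x \<oplus> y) = c \<odot> A x \<oplus> c \<odot> A y"
      using A by (intro ip_left_eqI) (simp_all add: op_closed op_add algebra_simps)
  next
    fix d x assume "x \<in> V"
    then show "c \<odot> A (d \<odot> x) = d \<odot> c \<odot> A x"
      using A by (intro ip_left_eqI) (simp_all add: op_closed op_scale algebra_simps)
  qed (use A in \<open>auto simp: op_closed\<close>)
qed

lemma bounded_op_sub:
  assumes A: "bounded_op S A" and B: "bounded_op S B"
  shows "bounded_op S (\<lambda>x. A x \<ominus> B x)"
proof -
  obtain C where C: "C > 0" "\<And>x. x \<in> V \<Longrightarrow> nrm (A x) \<le> C * nrm x" using op_bound[OF A] by blast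
  obtain D where D: "D > 0" "\<And>x. x \<in> V \<Longrightarrow> nrm (B x) \<le> D * nrm x" using op_bound[OF B] by blast
  show ?thesis
  proof (rule bounded_opI)
    fix x assume x: "x \<in> V"
    have "nrm (A x \<ominus> B x) \<le> nrm (A x) + nrm (B x)" using A B x by (intro nrm_sub_le) (auto simp: op_closed)
    also have "\<dots> \<le> (C + D) * nrm x" using C(2)[OF x] D(2)[OF x] by (simp add: distrib_right)
    finally show "nrm (A x \<ominus> B x) \<le> (C + D) * nrm x" .
  next
    fix x y assume "x \<in> V" "y \<in> V"
    then show "A (x \<oplus> y) \<ominus> B (x \<oplus> y) = (A x \<ominus> B x) \<oplus> (A y \<ominus> B y)"
      using A B by (intro ip_left_eqI) (simp_all add: op_closed op_add)
  next
    fix c x assume "x \<in> V"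
    then show "A (c \<odot> x) \<ominus> B (c \<odot> x) = c \<odot> (A x \<ominus> B x)"
      using A B by (intro ip_left_eqI) (simp_all add: op_closed op_scale algebra_simps)
  qed (use A B in \<open>auto simp: op_closed\<close>)
qed

lemma bounded_op_ident: "bounded_op S (\<lambda>x. x)"
  by (rule bounded_opI[where C = 1]) auto

lemma vconv_op:
  assumes A: "bounded_op S A" and f: "vconv f x"
  shows "vconv (\<lambda>n. A (f n)) (A x)"
proof -
  obtain C where C: "C > 0" "\<And>x. x \<in> V \<Longrightarrow> nrm (A x) \<le> C * nrm x" using op_bound[OF A] by blast
  have V: "\<And>n. f n \<in> V" "x \<in> V" and lim: "(\<lambda>n. nrm (f n \<ominus> x)) \<longlonglongrightarrow> 0" using f by (auto simp: vconv_def)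
  have "(\<lambda>n. nrm (A (f n) \<ominus> A x)) \<longlonglongrightarrow> 0"
  proof (rule Lim_null_comparison)
    show "(\<lambda>n. C * nrm (f n \<ominus> x)) \<longlonglongrightarrow> 0" using tendsto_mult[OF tendsto_const lim] by simp
    show "\<forall>\<^sub>F n in sequentially. norm (nrm (A (f n) \<ominus> A x)) \<le> C * nrm (f n \<ominus> x)"
      using C(2)[of "f _ \<ominus> x"] V A by (simp add: op_sub op_closed)
  qed
  then show ?thesis using V A by (simp add: vconv_def op_closed)
qed

lemma vconv_unique:
  assumes "vconv f x" "vconv f y" shows "x = y"
proof (rule ip_left_eqI)
  fix z assume "z \<in> V"
  then show "ip x z = ip y z"
    using LIMSEQ_unique[OF tendsto_ip[OF assms(1) vconv_const] tendsto_ip[OF assms(2) vconv_const]] by simp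
qed (use assms in \<open>auto simp: vconv_def\<close>)

section \<open>Almost unitary operators and their Newton--Schulz iteration\<close>

lemma adjoint_sym:
  assumes "bounded_op S A" "bounded_op S B" "\<And>x y. x \<in> V \<Longrightarrow> y \<in> V \<Longrightarrow> ip (A x) y = ip x (B y)"
    and "x \<in> V" "y \<in> V"
  shows "ip (B x) y = ip x (A y)"
  using assms(3)[of y x] ip_commute[of "A y" x] ip_commute[of y "B x"] assms by (simp add: op_closed)

text \<open>B is the adjoint of A, carried along explicitly, so the last two conditions say that 1 -
  B A and 1 - A B have norm at most e. Both are kept because the first alone only leads to an
  isometry; the second gives surjectivity in the limit.\<close>

definition almost_unitary :: "real \<Rightarrow> ('u \<Rightarrow> 'u) \<Rightarrow> ('u \<Rightarrow> 'u) \<Rightarrow> bool" where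
  "almost_unitary e A B \<longleftrightarrow> bounded_op S A \<and> bounded_op S B \<and>
     (\<forall>x\<in>V. \<forall>y\<in>V. ip (A x) y = ip x (B y)) \<and>
     (\<forall>x\<in>V. nrm (x \<ominus> B (A x)) \<le> e * nrm x) \<and> (\<forall>x\<in>V. nrm (x \<ominus> A (B x)) \<le> e * nrm x)"

lemma almost_unitary_swap: "almost_unitary e A B \<Longrightarrow> almost_unitary e B A"
  unfolding almost_unitary_def using adjoint_sym by blast

text \<open>One step of the Newton--Schulz iteration for the unitary factor of the polar decomposition.
  With \<open>E = 1 - B A\<close>, the new error is \<open>(3 E\<^sup>2 + E\<^sup>3) / 4\<close>.\<close>
definition newton :: "('u \<Rightarrow> 'u) \<Rightarrow> ('u \<Rightarrow> 'u) \<Rightarrow> 'u \<Rightarrow> 'u" where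
  "newton A B x = (3/2) \<odot> A x \<ominus> (1/2) \<odot> A (B (A x))"

lemma bounded_op_newton: "\<lbrakk>bounded_op S A; bounded_op S B\<rbrakk> \<Longrightarrow> bounded_op S (newton A B)"
  unfolding newton_def[abs_def]
  by (rule bounded_op_sub[OF bounded_op_scale bounded_op_scale[OF bounded_op_compose[OF _ bounded_op_compose]]])

text \<open>The error formula is an identity of polynomials in E, so A and B may be exchanged. For e
  <= 1/2 the new error is at most (3/4 + e/4) e^2 <= e^2 <= e/2: convergence is in fact quadratic,
  but halving is all that a geometric series of steps requires.\<close>

lemma newton_error:
  assumes A: "bounded_op S A" and B: "bounded_op S B" and e: "0 \<le> e" "e \<le> 1/2"
    and err: "\<And>x. x \<in> V \<Longrightarrow> nrm (x \<ominus> B (A x)) \<le> e * nrm x" and x: "x \<in> V"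
  shows "nrm (x \<ominus> newton B A (newton A B x)) \<le> e / 2 * nrm x"
proof -
  define E where "E x = x \<ominus> B (A x)" for x
  have E: "E x \<in> V" if "x \<in> V" for x using that A B by (simp add: E_def op_closed)
  have Ee: "nrm (E x) \<le> e * nrm x" if "x \<in> V" for x using err[OF that] by (simp add: E_def)
  have "x \<ominus> newton B A (newton A B x) = (3/4) \<odot> E (E x) \<oplus> (1/4) \<odot> E (E (E x))"
    using x A B by (intro ip_left_eqI)
      (simp_all add: E_def newton_def op_closed op_sub op_scale field_simps)
  also have "nrm \<dots> \<le> 3/4 * nrm (E (E x)) + 1/4 * nrm (E (E (E x)))"
    using nrm_triangle[of "(3/4) \<odot> E (E x)" "(1/4) \<odot> E (E (E x))"] x E by simp
  also have "\<dots> \<le> 3/4 * nrm (E (E x)) + 1/4 * (e * nrm (E (E x)))"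
    using Ee[of "E (E x)"] E x by simp
  also have "\<dots> = (3/4 + e/4) * nrm (E (E x))" by (simp add: algebra_simps)
  also have "\<dots> \<le> 1 * nrm (E (E x))"
    using e E x by (intro mult_right_mono) auto
  also have "\<dots> \<le> e * nrm (E x)" using Ee[of "E x"] E x by simp
  also have "\<dots> \<le> e * (e * nrm x)" using Ee[of x] e x by (intro mult_left_mono) auto
  also have "\<dots> \<le> e * (1/2 * nrm x)" using e x by (intro mult_left_mono mult_right_mono) auto
  finally show ?thesis by simp
qed

lemma newton_almost_unitary:
  assumes AB: "almost_unitary e A B" and e: "0 \<le> e" "e \<le> 1/2"
  shows "almost_unitary (e/2) (newton A B) (newton B A)"
proof -
  have A: "bounded_op S A" and B: "bounded_op S B"
    and adj: "\<And>x y. x \<in> V \<Longrightarrow> y \<in> V \<Longrightarrow> ip (A x) y = ip x (B y)"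
    using AB by (auto simp: almost_unitary_def)
  have "ip (newton A B x) y = ip x (newton B A y)" if "x \<in> V" "y \<in> V" for x y
    using that A B adjoint_sym[OF A B adj] by (simp add: newton_def op_closed adj)
  then show ?thesis
    using AB newton_error[OF A B e] newton_error[OF B A e] bounded_op_newton
    by (simp add: almost_unitary_def)
qed

text \<open>The increment is (1/2) A (1 - B A). The crude bound |A| <= 2, which follows from |A y|^2
  = <y, B A y>, is absorbed by the factor 1/2.\<close>

lemma newton_step:
  assumes AB: "almost_unitary e A B" and e: "0 \<le> e" "e \<le> 1/2" and x: "x \<in> V"
  shows "nrm (newton A B x \<ominus> A x) \<le> e * nrm x"
proof -
  have A: "bounded_op S A" and B: "bounded_op S B"
    and adj: "\<And>x y. x \<in> V \<Longrightarrow> y \<in> V \<Longrightarrow> ip (A x) y = ip x (B y)"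
    and err: "\<And>x. x \<in> V \<Longrightarrow> nrm (x \<ominus> B (A x)) \<le> e * nrm x"
    using AB by (auto simp: almost_unitary_def)
  have A2: "nrm (A y) \<le> 2 * nrm y" if y: "y \<in> V" for y
  proof (rule power2_le_imp_le)
    have "nrm (B (A y)) \<le> nrm (y \<ominus> B (A y)) + nrm y"
      using nrm_le_sub[of "B (A y)" y] nrm_sub_commute[of "B (A y)" y] A B y by (simp add: op_closed)
    also have "\<dots> \<le> 2 * nrm y" using err[OF y] mult_right_mono[OF e(2), of "nrm y"] nrm_nonneg[OF y] by linarith
    finally have b: "nrm (B (A y)) \<le> 2 * nrm y" .
    have "(nrm (A y))\<^sup>2 = Re (ip y (B (A y)))" using adj[of y "A y"] A y by (simp add: op_closed nrm_sq)
    also have "\<dots> \<le> nrm y * nrm (B (A y))"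
      using Cauchy_Schwarz[of y "B (A y)"] complex_Re_le_cmod A B y op_closed order_trans by meson
    also have "\<dots> \<le> nrm y * (2 * nrm y)" using b y by (intro mult_left_mono) auto
    also have "\<dots> \<le> (2 * nrm y)\<^sup>2" by (simp add: power2_eq_square)
    finally show "(nrm (A y))\<^sup>2 \<le> (2 * nrm y)\<^sup>2" .
  qed (use y in simp)
  have "newton A B x \<ominus> A x = (1/2) \<odot> A (x \<ominus> B (A x))"
    using x A B by (intro ip_left_eqI) (simp_all add: newton_def op_closed op_sub field_simps)
  then have "nrm (newton A B x \<ominus> A x) = 1/2 * nrm (A (x \<ominus> B (A x)))"
    using x A B by (simp add: op_closed)
  also have "\<dots> \<le> nrm (x \<ominus> B (A x))" using A2[of "x \<ominus> B (A x)"] x A B by (simp add: op_closed)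
  finally show ?thesis using err[OF x] by simp
qed

lemma unitary_closed: "unitary_op S U \<Longrightarrow> x \<in> V \<Longrightarrow> U x \<in> V"
  and unitary_bounded: "unitary_op S U \<Longrightarrow> bounded_op S U"
  and unitary_ip: "\<lbrakk>unitary_op S U; x \<in> V; y \<in> V\<rbrakk> \<Longrightarrow> ip (U x) (U y) = ip x y"
  unfolding unitary_op_def bounded_op_def by auto

lemma unitary_surj: "unitary_op S U \<Longrightarrow> y \<in> V \<Longrightarrow> \<exists>x\<in>V. U x = y"
  unfolding unitary_op_def by (metis imageE)

lemma unitary_nrm: "\<lbrakk>unitary_op S U; x \<in> V\<rbrakk> \<Longrightarrow> nrm (U x) = nrm x"
  by (simp add: hnorm_def unitary_ip)

text \<open>Taking adjoints in P A = A Q gives B P^-1 = Q^-1 B, which unitarity turns into Q B = B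
  P. The iteration mixes A and B, so both relations have to be propagated together.\<close>

lemma adjoint_intertwines:
  assumes A: "bounded_op S A" and B: "bounded_op S B"
    and adj: "\<And>x y. x \<in> V \<Longrightarrow> y \<in> V \<Longrightarrow> ip (A x) y = ip x (B y)"
    and P: "unitary_op S P" and Q: "unitary_op S Q"
    and PA: "\<And>x. x \<in> V \<Longrightarrow> P (A x) = A (Q x)" and x: "x \<in> V"
  shows "Q (B x) = B (P x)"
proof (rule ip_left_eqI)
  fix z assume "z \<in> V"
  then obtain w where w: "w \<in> V" "z = Q w" using unitary_surj[OF Q] by metis
  have "ip (Q (B x)) z = ip (B x) w" using w x B Q by (simp add: unitary_ip op_closed)
  also have "\<dots> = ip x (A w)" using adjoint_sym[OF A B adj] x w by simp
  also have "\<dots> = ip (P x) (P (A w))" using x w A P by (simp add: unitary_ip op_closed)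
  also have "\<dots> = ip (P x) (A (Q w))" using PA w by simp
  also have "\<dots> = ip (B (P x)) z"
    using adjoint_sym[OF A B adj] w unitary_closed P Q x by simp
  finally show "ip (Q (B x)) z = ip (B (P x)) z" .
qed (use A B P Q x in \<open>auto simp: op_closed unitary_closed\<close>)

text \<open>U is the limit of the Newton--Schulz iterates of A. The steps are at most e / 2^n,
  whence the total 2 e. Every iterate is built from A and B alone, so any relation P A = A Q
  survives to the limit. All P and Q are quantified after U because one U has to serve all group
  elements.\<close>

lemma unitary_near_almost_unitary:
  assumes AB: "almost_unitary e A B" and e: "0 \<le> e" "e \<le> 1/2"
  shows "\<exists>U. unitary_op S U \<and> (\<forall>x\<in>V. nrm (U x \<ominus> A x) \<le> 2 * e * nrm x) \<and>
    (\<forall>P Q. unitary_op S P \<longrightarrow> unitary_op S Q \<longrightarrow> (\<forall>x\<in>V. P (A x) = A (Q x)) \<longrightarrow> (\<forall>x\<in>V. P (U x) = U (Q x)))"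
proof -
  define F where "F n = ((\<lambda>(A,B). (newton A B, newton B A)) ^^ n) (A, B)" for n
  define a where "a n = fst (F n)" for n
  define b where "b n = snd (F n)" for n
  have a0: "a 0 = A" and b0: "b 0 = B" by (auto simp: a_def b_def F_def)
  have aS: "a (Suc n) = newton (a n) (b n)" and bS: "b (Suc n) = newton (b n) (a n)" for n
    by (auto simp: a_def b_def F_def split: prod.splits)
  define h where "h n = e * (1/2)^n" for n :: nat
  have h: "0 \<le> h n" "h n \<le> 1/2" for n
    using e mult_mono[of e "1/2" "(1/2)^n" 1] by (auto simp: h_def power_le_one)
  have au: "almost_unitary (h n) (a n) (b n)" for n
  proof (induction n)
    case (Suc n)
    then show ?case using newton_almost_unitary[OF Suc h] by (simp add: aS bS h_def)
  qed (use AB in \<open>simp add: a0 b0 h_def\<close>)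
  have bd: "bounded_op S (a n)" "bounded_op S (b n)" for n
    using au by (auto simp: almost_unitary_def)
  have adj: "ip (a n x) y = ip x (b n y)" if "x \<in> V" "y \<in> V" for n x y
    using au that by (auto simp: almost_unitary_def)
  have "\<exists>u. vconv (\<lambda>n. a n x) u \<and> nrm (u \<ominus> a 0 x) \<le> 2 * (e * nrm x)" if x: "x \<in> V" for x
    using newton_step[OF au h x] bd x
    by (intro geometric_limit) (auto simp: op_closed aS h_def ac_simps)
  then obtain U where U: "\<And>x. x \<in> V \<Longrightarrow> vconv (\<lambda>n. a n x) (U x)"
    and UA: "\<And>x. x \<in> V \<Longrightarrow> nrm (U x \<ominus> A x) \<le> 2 * (e * nrm x)" unfolding a0 by metis
  have "\<exists>u. vconv (\<lambda>n. b n x) u \<and> nrm (u \<ominus> b 0 x) \<le> 2 * (e * nrm x)" if x: "x \<in> V" for x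
    using newton_step[OF almost_unitary_swap[OF au] h x] bd x
    by (intro geometric_limit) (auto simp: op_closed bS h_def ac_simps)
  then obtain W where W: "\<And>x. x \<in> V \<Longrightarrow> vconv (\<lambda>n. b n x) (W x)" by metis
  have UV: "U x \<in> V" and WV: "W x \<in> V" if "x \<in> V" for x using U[OF that] W[OF that] by (auto simp: vconv_def)
  have h0: "(\<lambda>n. h n * c) \<longlonglongrightarrow> 0" for c
  proof -
    have "(\<lambda>n. e * (1/2)^n * c) \<longlonglongrightarrow> e * 0 * c" by (intro tendsto_intros) auto
    then show ?thesis by (simp add: h_def)
  qed
  \<comment> \<open><f_n x, f_n y> = <x, g_n f_n y>, and g_n f_n y tends to y because the errors
    \<open>h n\<close> tend to 0. The statement is general so that it also applies to the adjoint
    iterates.\<close>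
  have iso: "ip (p x) (p y) = ip x y"
    if p: "\<And>x. x \<in> V \<Longrightarrow> vconv (\<lambda>n. f n x) (p x)" and fg: "\<And>n. almost_unitary (h n) (f n) (g n)"
      and x: "x \<in> V" and y: "y \<in> V" for f g p x y
  proof -
    have bd': "bounded_op S (f n)" "bounded_op S (g n)" for n
      using fg by (auto simp: almost_unitary_def)
    have "vconv (\<lambda>n. g n (f n y)) y"
      unfolding vconv_def
    proof (intro conjI allI)
      show "(\<lambda>n. nrm (g n (f n y) \<ominus> y)) \<longlonglongrightarrow> 0"
      proof (rule Lim_null_comparison[OF _ h0[of "nrm y"]])
        have "nrm (g n (f n y) \<ominus> y) \<le> h n * nrm y" for n
          using fg[of n] nrm_sub_commute[of "g n (f n y)" y] y bd' by (auto simp: almost_unitary_def op_closed)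
        then show "\<forall>\<^sub>F n in sequentially. norm (nrm (g n (f n y) \<ominus> y)) \<le> h n * nrm y"
          using bd' y by (simp add: op_closed)
      qed
    qed (use bd' y in \<open>auto simp: op_closed\<close>)
    then have "(\<lambda>n. ip x (g n (f n y))) \<longlonglongrightarrow> ip x y"
      using x by (intro tendsto_ip vconv_const)
    moreover have "ip x (g n (f n y)) = ip (f n x) (f n y)" for n
      using fg[of n] x y bd' by (simp add: almost_unitary_def op_closed)
    ultimately show ?thesis
      using LIMSEQ_unique[OF tendsto_ip[OF p[OF x] p[OF y]]] by simp
  qed
  have isoU: "ip (U x) (U y) = ip x y" and isoW: "ip (W x) (W y) = ip x y" if "x \<in> V" "y \<in> V" for x y
    using iso[OF U au that] iso[OF W almost_unitary_swap[OF au] that] by auto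
  \<comment> \<open>The limits U and W are adjoint to each other; linearity of U then follows by
    moving U to the other side of the inner product.\<close>
  have UW: "ip (U x) y = ip x (W y)" if "x \<in> V" "y \<in> V" for x y
    using tendsto_ip[OF U[OF that(1)] vconv_const[OF that(2)]] that
      tendsto_ip[OF vconv_const[OF that(1)] W[OF that(2)]] by (simp add: adj LIMSEQ_unique)
  have "bounded_op S U"
  proof (rule bounded_opI)
    show "nrm (U x) \<le> 1 * nrm x" if "x \<in> V" for x using isoU[OF that that] by (simp add: hnorm_def)
    show "U (x \<oplus> y) = U x \<oplus> U y" if "x \<in> V" "y \<in> V" for x y
      using that WV UV by (intro ip_left_eqI) (auto simp: UW)
    show "U (c \<odot> x) = c \<odot> U x" if "x \<in> V" for c x
      using that WV UV by (intro ip_left_eqI) (auto simp: UW)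
  qed (rule UV)
  moreover have "U ` V = V"
  proof -
    \<comment> \<open>U W = 1 because W, as the limit of the swapped iteration, is isometric
      too.\<close>
    have "y = U (W y)" if "y \<in> V" for y
      using that UV WV by (intro ip_left_eqI) (auto simp: UW isoW)
    then show ?thesis using UV WV by blast
  qed
  ultimately have "unitary_op S U" using isoU by (simp add: unitary_op_def)
  moreover have "P (U x) = U (Q x)"
    if P: "unitary_op S P" and Q: "unitary_op S Q" and PA: "\<forall>x\<in>V. P (A x) = A (Q x)" and x: "x \<in> V" for P Q x
  proof -
    have "\<forall>x\<in>V. P (a n x) = a n (Q x) \<and> Q (b n x) = b n (P x)" for n
    proof (induction n)
      case 0
      have "Q (B x) = B (P x)" if "x \<in> V" for x
        using adjoint_intertwines[OF _ _ _ P Q, of A B] PA AB that by (simp add: almost_unitary_def)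
      then show ?case using PA by (simp add: a0 b0)
    next
      case (Suc n)
      then show ?case using bd P Q
        by (simp add: aS bS newton_def op_closed op_sub[OF unitary_bounded] op_scale[OF unitary_bounded] unitary_closed)
    qed
    then have "vconv (\<lambda>n. a n (Q x)) (P (U x))"
      using vconv_op[OF unitary_bounded[OF P] U[OF x]] x by simp
    then show ?thesis using vconv_unique U[OF unitary_closed[OF Q x]] by blast
  qed
  ultimately show ?thesis using UA by (intro exI[of _ U]) (simp add: mult.assoc)
qed

end

section \<open>Products and square-summable sequences\<close>

lemma hilbert_spaceI:
  assumes "hzero S \<in> hcarrier S"
    and "\<And>x y. \<lbrakk>x \<in> hcarrier S; y \<in> hcarrier S\<rbrakk> \<Longrightarrow> hadd S x y \<in> hcarrier S"
    and "\<And>c x. x \<in> hcarrier S \<Longrightarrow> hscale S c x \<in> hcarrier S"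
    and "\<And>x y z. \<lbrakk>x \<in> hcarrier S; y \<in> hcarrier S; z \<in> hcarrier S\<rbrakk>
      \<Longrightarrow> hadd S (hadd S x y) z = hadd S x (hadd S y z)"
    and "\<And>x y. \<lbrakk>x \<in> hcarrier S; y \<in> hcarrier S\<rbrakk> \<Longrightarrow> hadd S x y = hadd S y x"
    and "\<And>x. x \<in> hcarrier S \<Longrightarrow> hadd S x (hzero S) = x"
    and "\<And>x. x \<in> hcarrier S \<Longrightarrow> hadd S x (hscale S (-1) x) = hzero S"
    and "\<And>c x y. \<lbrakk>x \<in> hcarrier S; y \<in> hcarrier S\<rbrakk>
      \<Longrightarrow> hscale S c (hadd S x y) = hadd S (hscale S c x) (hscale S c y)"
    and "\<And>c d x. x \<in> hcarrier S \<Longrightarrow> hscale S (c + d) x = hadd S (hscale S c x) (hscale S d x)"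
    and "\<And>c d x. x \<in> hcarrier S \<Longrightarrow> hscale S c (hscale S d x) = hscale S (c * d) x"
    and "\<And>x. x \<in> hcarrier S \<Longrightarrow> hscale S 1 x = x"
    and "\<And>x y z. \<lbrakk>x \<in> hcarrier S; y \<in> hcarrier S; z \<in> hcarrier S\<rbrakk>
      \<Longrightarrow> hinner S (hadd S x y) z = hinner S x z + hinner S y z"
    and "\<And>c x y. \<lbrakk>x \<in> hcarrier S; y \<in> hcarrier S\<rbrakk> \<Longrightarrow> hinner S (hscale S c x) y = c * hinner S x y"
    and "\<And>x y. \<lbrakk>x \<in> hcarrier S; y \<in> hcarrier S\<rbrakk> \<Longrightarrow> hinner S y x = cnj (hinner S x y)"
    and "\<And>x. x \<in> hcarrier S \<Longrightarrow> 0 \<le> Re (hinner S x x)"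
    and "\<And>x. \<lbrakk>x \<in> hcarrier S; hinner S x x = 0\<rbrakk> \<Longrightarrow> x = hzero S"
    and "\<And>f. \<lbrakk>\<And>n. f n \<in> hcarrier S;
        \<And>e. e > 0 \<Longrightarrow> \<exists>N::nat. \<forall>m\<ge>N. \<forall>n\<ge>N. hnorm S (hsub S (f m) (f n)) < e\<rbrakk>
      \<Longrightarrow> \<exists>x\<in>hcarrier S. (\<lambda>n. hnorm S (hsub S (f n) x)) \<longlonglongrightarrow> 0"
  shows "hilbert_space S"
  unfolding hilbert_space_def Let_def
proof (intro conjI)
  show "\<forall>x\<in>hcarrier S. \<exists>y\<in>hcarrier S. hadd S x y = hzero S"
    using assms(3,7) by blast
  show "\<forall>f. (\<forall>n. f n \<in> hcarrier S) \<and>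
          (\<forall>e>0. \<exists>N. \<forall>m\<ge>N. \<forall>n\<ge>N. hnorm S (hsub S (f m) (f n)) < e)
        \<longrightarrow> (\<exists>x\<in>hcarrier S. (\<lambda>n. hnorm S (hsub S (f n) x)) \<longlonglongrightarrow> 0)"
    using assms(17) by blast
qed ((intro ballI allI impI)?, (rule assms; assumption))+

context hilbert
begin

lemma add_minus: "x \<in> V \<Longrightarrow> x \<oplus> (-1) \<odot> x = hzero S"
  by (rule ip_left_eqI) auto

lemma scale_add_right: "\<lbrakk>x \<in> V; y \<in> V\<rbrakk> \<Longrightarrow> c \<odot> (x \<oplus> y) = c \<odot> x \<oplus> c \<odot> y"
  by (rule ip_left_eqI) (auto simp: algebra_simps)

lemma scale_zero: "c \<odot> hzero S = hzero S"
  by (rule ip_left_eqI) auto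

text \<open>The two bounds make the new norm equivalent to the old one, so Cauchy sequences and
  limits are the same. It serves for inner products pulled back along an invertible bounded
  operator, and for their restrictions to a factor.\<close>

lemma hilbert_space_equivalent_inner:
  assumes add: "\<And>x y z. \<lbrakk>x \<in> V; y \<in> V; z \<in> V\<rbrakk> \<Longrightarrow> b (x \<oplus> y) z = b x z + b y z"
    and scale: "\<And>c x y. \<lbrakk>x \<in> V; y \<in> V\<rbrakk> \<Longrightarrow> b (c \<odot> x) y = c * b x y"
    and herm: "\<And>x y. \<lbrakk>x \<in> V; y \<in> V\<rbrakk> \<Longrightarrow> b y x = cnj (b x y)"
    and c: "c > 0" and low: "\<And>x. x \<in> V \<Longrightarrow> c * (nrm x)\<^sup>2 \<le> Re (b x x)"
    and up: "\<And>x. x \<in> V \<Longrightarrow> Re (b x x) \<le> C * (nrm x)\<^sup>2"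
  shows "hilbert_space (S\<lparr>hinner := b\<rparr>)" (is "hilbert_space ?S")
proof -
  have sub: "hsub ?S x y = x \<ominus> y" for x y by (simp add: hsub_def)
  have nrm: "hnorm ?S x = sqrt (Re (b x x))" for x by (simp add: hnorm_def)
  have pos: "0 \<le> Re (b x x)" if "x \<in> V" for x
    using low[OF that] c by (smt (verit) mult_nonneg_nonneg zero_le_power2)
  have low': "sqrt c * nrm x \<le> hnorm ?S x" if "x \<in> V" for x
    using real_sqrt_le_mono[OF low[OF that]] that by (simp add: nrm real_sqrt_mult)
  have up': "hnorm ?S x \<le> sqrt C * nrm x" if "x \<in> V" for x
    using real_sqrt_le_mono[OF up[OF that]] that by (simp add: nrm real_sqrt_mult)
  show ?thesis
  proof (rule hilbert_spaceI, unfold sub)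
    fix x assume "x \<in> hcarrier ?S" "hinner ?S x x = 0"
    then have "x \<in> V" "c * (nrm x)\<^sup>2 \<le> 0" using low[of x] by auto
    then show "x = hzero ?S" using c nrm_eq_0 by (simp add: mult_le_0_iff)
  next
    fix x y assume "x \<in> hcarrier ?S" "y \<in> hcarrier ?S"
    then show "hinner ?S y x = cnj (hinner ?S x y)" using herm[of x y] by simp
  next
    fix f assume f: "\<And>n. f n \<in> hcarrier ?S"
      and cau: "\<And>e. e > 0 \<Longrightarrow> \<exists>N::nat. \<forall>m\<ge>N. \<forall>n\<ge>N. hnorm ?S (f m \<ominus> f n) < e"
    have f: "f n \<in> V" for n using f by simp
    have "\<exists>x\<in>V. (\<lambda>n. nrm (f n \<ominus> x)) \<longlonglongrightarrow> 0"
    proof (rule complete[OF f])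
      fix e :: real assume "e > 0"
      then obtain N where N: "\<forall>m\<ge>N. \<forall>n\<ge>N. hnorm ?S (f m \<ominus> f n) < sqrt c * e"
        using cau[of "sqrt c * e"] c by auto
      have "nrm (f m \<ominus> f n) < e" if "m \<ge> N" "n \<ge> N" for m n
      proof -
        have "sqrt c * nrm (f m \<ominus> f n) < sqrt c * e"
          using le_less_trans[OF low'] N that f by simp
        then show ?thesis using c by simp
      qed
      then show "\<exists>N. \<forall>m\<ge>N. \<forall>n\<ge>N. nrm (f m \<ominus> f n) < e" by blast
    qed
    then obtain x where x: "x \<in> V" "(\<lambda>n. nrm (f n \<ominus> x)) \<longlonglongrightarrow> 0" by blast
    have "(\<lambda>n. hnorm ?S (f n \<ominus> x)) \<longlonglongrightarrow> 0"
    proof (rule Lim_null_comparison)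
      show "(\<lambda>n. sqrt C * nrm (f n \<ominus> x)) \<longlonglongrightarrow> 0" using tendsto_mult[OF tendsto_const x(2)] by simp
      show "\<forall>\<^sub>F n in sequentially. norm (hnorm ?S (f n \<ominus> x)) \<le> sqrt C * nrm (f n \<ominus> x)"
        using up'[of "f _ \<ominus> x"] pos[of "f _ \<ominus> x"] f x by (simp add: nrm)
    qed
    then show "\<exists>x\<in>hcarrier ?S. (\<lambda>n. hnorm ?S (f n \<ominus> x)) \<longlonglongrightarrow> 0" using x by auto
  qed (simp_all add: add_zero add_assoc scale_add_left scale_scale scale_one add_minus scale_add_right
      add scale pos, simp_all add: add_commute)
qed

end

section \<open>The orthogonal sum of two copies\<close>

definition hprod :: "'u chspace \<Rightarrow> ('u \<times> 'u) chspace" where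
  "hprod S = \<lparr>hcarrier = hcarrier S \<times> hcarrier S, hzero = (hzero S, hzero S),
     hadd = (\<lambda>p q. (hadd S (fst p) (fst q), hadd S (snd p) (snd q))),
     hscale = (\<lambda>c p. (hscale S c (fst p), hscale S c (snd p))),
     hinner = (\<lambda>p q. hinner S (fst p) (fst q) + hinner S (snd p) (snd q))\<rparr>"

lemma hprod_simps [simp]:
  "hcarrier (hprod S) = hcarrier S \<times> hcarrier S"
  "hzero (hprod S) = (hzero S, hzero S)"
  "hadd (hprod S) p q = (hadd S (fst p) (fst q), hadd S (snd p) (snd q))"
  "hscale (hprod S) c p = (hscale S c (fst p), hscale S c (snd p))"
  "hinner (hprod S) p q = hinner S (fst p) (fst q) + hinner S (snd p) (snd q)"
  "hsub (hprod S) p q = (hsub S (fst p) (fst q), hsub S (snd p) (snd q))"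
  by (simp_all add: hprod_def hsub_def)

context hilbert
begin

lemma hnorm_hprod: "p \<in> V \<times> V \<Longrightarrow> (hnorm (hprod S) p)\<^sup>2 = (nrm (fst p))\<^sup>2 + (nrm (snd p))\<^sup>2"
  by (auto simp: hnorm_def ip_self_nonneg)

lemma hnorm_hprod_nonneg: "p \<in> V \<times> V \<Longrightarrow> 0 \<le> hnorm (hprod S) p"
  by (auto simp: hnorm_def ip_self_nonneg)

lemma hnorm_hprod_ge:
  assumes "p \<in> V \<times> V"
  shows "nrm (fst p) \<le> hnorm (hprod S) p" "nrm (snd p) \<le> hnorm (hprod S) p"
  by (rule power2_le_imp_le; use hnorm_hprod[OF assms] hnorm_hprod_nonneg[OF assms] in simp)+

lemma hnorm_hprod_le:
  assumes "p \<in> V \<times> V"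
  shows "hnorm (hprod S) p \<le> nrm (fst p) + nrm (snd p)"
  by (rule power2_le_imp_le) (use assms in \<open>auto simp: hnorm_hprod power2_sum\<close>)

lemma hilbert_space_hprod: "hilbert_space (hprod S)"
proof (rule hilbert_spaceI)
  fix p assume p: "p \<in> hcarrier (hprod S)" "hinner (hprod S) p p = 0"
  then have "hnorm (hprod S) p = 0" by (simp add: hnorm_def)
  then have "(nrm (fst p))\<^sup>2 + (nrm (snd p))\<^sup>2 = 0"
    using hnorm_hprod[of p] p(1) by simp
  then have "nrm (fst p) = 0" "nrm (snd p) = 0" by (auto simp: sum_power2_eq_zero_iff)
  then have "fst p = hzero S" "snd p = hzero S"
    using p(1) nrm_eq_0[of "fst p"] nrm_eq_0[of "snd p"] by auto
  then show "p = hzero (hprod S)" by (simp add: prod_eq_iff)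
next
  fix f assume f: "\<And>n. f n \<in> hcarrier (hprod S)"
    and cau: "\<And>e. e > 0 \<Longrightarrow> \<exists>N::nat. \<forall>m\<ge>N. \<forall>n\<ge>N. hnorm (hprod S) (hsub (hprod S) (f m) (f n)) < e"
  have fV: "fst (f n) \<in> V" "snd (f n) \<in> V" for n using f[of n] by auto
  have "nrm (fst (f m) \<ominus> fst (f n)) \<le> hnorm (hprod S) (hsub (hprod S) (f m) (f n))"
    "nrm (snd (f m) \<ominus> snd (f n)) \<le> hnorm (hprod S) (hsub (hprod S) (f m) (f n))" for m n
    using hnorm_hprod_ge[of "hsub (hprod S) (f m) (f n)"] fV by auto
  then have "\<exists>x\<in>V. (\<lambda>n. nrm (fst (f n) \<ominus> x)) \<longlonglongrightarrow> 0" "\<exists>x\<in>V. (\<lambda>n. nrm (snd (f n) \<ominus> x)) \<longlonglongrightarrow> 0"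
    using cau by (intro complete fV; meson le_less_trans)+
  then obtain x y where xy: "x \<in> V" "y \<in> V" and
    lim: "(\<lambda>n. nrm (fst (f n) \<ominus> x)) \<longlonglongrightarrow> 0" "(\<lambda>n. nrm (snd (f n) \<ominus> y)) \<longlonglongrightarrow> 0" by blast
  have "(\<lambda>n. hnorm (hprod S) (hsub (hprod S) (f n) (x, y))) \<longlonglongrightarrow> 0"
  proof (rule Lim_null_comparison)
    show "(\<lambda>n. nrm (fst (f n) \<ominus> x) + nrm (snd (f n) \<ominus> y)) \<longlonglongrightarrow> 0" using tendsto_add[OF lim] by simp
    show "\<forall>\<^sub>F n in sequentially. norm (hnorm (hprod S) (hsub (hprod S) (f n) (x, y)))
      \<le> nrm (fst (f n) \<ominus> x) + nrm (snd (f n) \<ominus> y)"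
      using hnorm_hprod_le[of "hsub (hprod S) (f _) (x, y)"] hnorm_hprod_nonneg[of "hsub (hprod S) (f _) (x, y)"] fV xy by simp
  qed
  then show "\<exists>x\<in>hcarrier (hprod S). (\<lambda>n. hnorm (hprod S) (hsub (hprod S) (f n) x)) \<longlonglongrightarrow> 0"
    using xy by (intro bexI[of _ "(x, y)"]) auto
next
  fix p q assume "p \<in> hcarrier (hprod S)" "q \<in> hcarrier (hprod S)"
  then show "hinner (hprod S) q p = cnj (hinner (hprod S) p q)" "hadd (hprod S) p q = hadd (hprod S) q p"
    using add_commute[of "fst p" "fst q"] add_commute[of "snd p" "snd q"] ip_commute[of "fst p" "fst q"] ip_commute[of "snd p" "snd q"] by auto
qed (auto simp: add_zero add_assoc scale_add_left scale_scale scale_one add_minus scale_add_right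
      algebra_simps ip_self_nonneg)

end

section \<open>The Hilbert space of square-summable sequences\<close>

definition ell2 :: "'u chspace \<Rightarrow> (nat \<Rightarrow> 'u) chspace" where
  "ell2 S = \<lparr>hcarrier = {f. (\<forall>n. f n \<in> hcarrier S) \<and> summable (\<lambda>n. (hnorm S (f n))\<^sup>2)},
     hzero = (\<lambda>n. hzero S),
     hadd = (\<lambda>f g n. hadd S (f n) (g n)),
     hscale = (\<lambda>c f n. hscale S c (f n)),
     hinner = (\<lambda>f g. \<Sum>n. hinner S (f n) (g n))\<rparr>"

lemma ell2_simps [simp]:
  "f \<in> hcarrier (ell2 S) \<longleftrightarrow> (\<forall>n. f n \<in> hcarrier S) \<and> summable (\<lambda>n. (hnorm S (f n))\<^sup>2)"
  "hzero (ell2 S) = (\<lambda>n. hzero S)"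
  "hadd (ell2 S) f g = (\<lambda>n. hadd S (f n) (g n))"
  "hscale (ell2 S) c f = (\<lambda>n. hscale S c (f n))"
  "hinner (ell2 S) f g = (\<Sum>n. hinner S (f n) (g n))"
  "hsub (ell2 S) f g = (\<lambda>n. hsub S (f n) (g n))"
  by (simp_all add: ell2_def hsub_def)

context hilbert
begin

lemma summable_ip:
  assumes "f \<in> hcarrier (ell2 S)" "g \<in> hcarrier (ell2 S)"
  shows "summable (\<lambda>n. ip (f n) (g n))"
proof (rule summable_comparison_test')
  show "summable (\<lambda>n. (nrm (f n))\<^sup>2 + (nrm (g n))\<^sup>2)" using assms by (simp add: summable_add)
  fix n
  have "cmod (ip (f n) (g n)) \<le> nrm (f n) * nrm (g n)" using assms by (intro Cauchy_Schwarz) auto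
  also have "\<dots> \<le> (nrm (f n))\<^sup>2 + (nrm (g n))\<^sup>2"
  proof -
    have "0 \<le> nrm (f n) * nrm (g n)" using assms by simp
    then show ?thesis using sum_squares_bound[of "nrm (f n)" "nrm (g n)"] by linarith
  qed
  finally show "norm (ip (f n) (g n)) \<le> (nrm (f n))\<^sup>2 + (nrm (g n))\<^sup>2" .
qed

lemma ell2_add_closed:
  assumes "f \<in> hcarrier (ell2 S)" "g \<in> hcarrier (ell2 S)"
  shows "hadd (ell2 S) f g \<in> hcarrier (ell2 S)"
proof -
  have "summable (\<lambda>n. (nrm (f n \<oplus> g n))\<^sup>2)"
  proof (rule summable_comparison_test')
    show "summable (\<lambda>n. 2 * ((nrm (f n))\<^sup>2 + (nrm (g n))\<^sup>2))"
      using assms by (intro summable_mult summable_add) auto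
    fix n
    have "(nrm (f n \<oplus> g n))\<^sup>2 \<le> (nrm (f n) + nrm (g n))\<^sup>2"
      using assms by (intro power_mono nrm_triangle) auto
    also have "\<dots> \<le> 2 * ((nrm (f n))\<^sup>2 + (nrm (g n))\<^sup>2)"
      using sum_squares_bound[of "nrm (f n)" "nrm (g n)"] by (simp add: power2_sum)
    finally show "norm ((nrm (f n \<oplus> g n))\<^sup>2) \<le> 2 * ((nrm (f n))\<^sup>2 + (nrm (g n))\<^sup>2)" by simp
  qed
  then show ?thesis using assms by simp
qed

lemma ell2_scale_closed: "f \<in> hcarrier (ell2 S) \<Longrightarrow> hscale (ell2 S) c f \<in> hcarrier (ell2 S)"
  by (simp add: power_mult_distrib summable_mult)

lemma ell2_sub_closed:
  "\<lbrakk>f \<in> hcarrier (ell2 S); g \<in> hcarrier (ell2 S)\<rbrakk> \<Longrightarrow> hsub (ell2 S) f g \<in> hcarrier (ell2 S)"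
  unfolding hsub_def by (intro ell2_add_closed ell2_scale_closed)

lemma Re_suminf_ip_self:
  assumes "f \<in> hcarrier (ell2 S)"
  shows "Re (\<Sum>n. ip (f n) (f n)) = (\<Sum>n. (nrm (f n))\<^sup>2)" and "0 \<le> (\<Sum>n. (nrm (f n))\<^sup>2)"
proof -
  show "Re (\<Sum>n. ip (f n) (f n)) = (\<Sum>n. (nrm (f n))\<^sup>2)"
    using Re_suminf[OF summable_ip[OF assms assms]] assms by (simp add: nrm_sq)
  show "0 \<le> (\<Sum>n. (nrm (f n))\<^sup>2)" using assms by (intro suminf_nonneg) auto
qed

lemma hnorm_ell2:
  assumes "f \<in> hcarrier (ell2 S)"
  shows "(hnorm (ell2 S) f)\<^sup>2 = (\<Sum>n. (nrm (f n))\<^sup>2)"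
  using Re_suminf_ip_self[OF assms] by (simp add: hnorm_def)

lemma hnorm_ell2_nonneg:
  assumes "f \<in> hcarrier (ell2 S)"
  shows "0 \<le> hnorm (ell2 S) f"
  using Re_suminf_ip_self[OF assms] by (simp add: hnorm_def)

lemma sum_nrm_le_hnorm_ell2:
  assumes "f \<in> hcarrier (ell2 S)"
  shows "(\<Sum>n<N. (nrm (f n))\<^sup>2) \<le> (hnorm (ell2 S) f)\<^sup>2"
  unfolding hnorm_ell2[OF assms] using assms by (intro sum_le_suminf) auto

lemma nrm_le_hnorm_ell2:
  assumes "f \<in> hcarrier (ell2 S)"
  shows "nrm (f n) \<le> hnorm (ell2 S) f"
proof (rule power2_le_imp_le)
  have "(nrm (f n))\<^sup>2 \<le> (\<Sum>n<Suc n. (nrm (f n))\<^sup>2)" by (simp add: sum_nonneg)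
  also have "\<dots> \<le> (hnorm (ell2 S) f)\<^sup>2" by (rule sum_nrm_le_hnorm_ell2[OF assms])
  finally show "(nrm (f n))\<^sup>2 \<le> (hnorm (ell2 S) f)\<^sup>2" .
qed (rule hnorm_ell2_nonneg[OF assms])

text \<open>The limit x is taken coordinatewise. Its distance to \<open>f m\<close> is controlled on
  finitely many coordinates, where the limit in k is harmless, with a bound that does not depend on
  their number.\<close>

lemma ell2_complete:
  assumes f: "\<And>k. f k \<in> hcarrier (ell2 S)"
    and cau: "\<And>e. e > 0 \<Longrightarrow> \<exists>N::nat. \<forall>m\<ge>N. \<forall>k\<ge>N. hnorm (ell2 S) (hsub (ell2 S) (f m) (f k)) < e"
  shows "\<exists>x\<in>hcarrier (ell2 S). (\<lambda>k. hnorm (ell2 S) (hsub (ell2 S) (f k) x)) \<longlonglongrightarrow> 0"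
proof -
  have fV: "f k n \<in> V" for k n using f by simp
  have D: "hsub (ell2 S) (f m) (f k) \<in> hcarrier (ell2 S)" for m k by (rule ell2_sub_closed[OF f f])
  have "\<exists>y\<in>V. (\<lambda>k. nrm (f k n \<ominus> y)) \<longlonglongrightarrow> 0" for n
  proof (rule complete[OF fV])
    fix e :: real assume "e > 0"
    then show "\<exists>N. \<forall>m\<ge>N. \<forall>k\<ge>N. nrm (f m n \<ominus> f k n) < e"
      using cau[of e] nrm_le_hnorm_ell2[OF D, of _ _ n] by (metis (no_types, lifting) ell2_simps(6) le_less_trans)
  qed
  then obtain x where xV: "\<And>n. x n \<in> V" and lim: "\<And>n. (\<lambda>k. nrm (f k n \<ominus> x n)) \<longlonglongrightarrow> 0" by metis
  have part: "\<exists>N. \<forall>m\<ge>N. \<forall>M. (\<Sum>n<M. (nrm (f m n \<ominus> x n))\<^sup>2) \<le> e\<^sup>2" if e: "e > 0" for e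
  proof -
    obtain N where N: "\<forall>m\<ge>N. \<forall>k\<ge>N. hnorm (ell2 S) (hsub (ell2 S) (f m) (f k)) < e" using cau[OF e] by blast
    have "(\<Sum>n<M. (nrm (f m n \<ominus> x n))\<^sup>2) \<le> e\<^sup>2" if m: "m \<ge> N" for m M
    proof (rule LIMSEQ_le_const2)
      show "(\<lambda>k. \<Sum>n<M. (nrm (f m n \<ominus> f k n))\<^sup>2) \<longlonglongrightarrow> (\<Sum>n<M. (nrm (f m n \<ominus> x n))\<^sup>2)"
      proof (intro tendsto_sum tendsto_power tendsto_nrm)
        fix n
        have "nrm ((f m n \<ominus> f k n) \<ominus> (f m n \<ominus> x n)) = nrm (f k n \<ominus> x n)" for k
        proof -
          have "(f m n \<ominus> f k n) \<ominus> (f m n \<ominus> x n) = x n \<ominus> f k n"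
            using fV xV by (intro ip_left_eqI) auto
          then show ?thesis using nrm_sub_commute fV xV by simp
        qed
        then show "vconv (\<lambda>k. f m n \<ominus> f k n) (f m n \<ominus> x n)"
          unfolding vconv_def using lim fV xV by simp
      qed
      have "(\<Sum>n<M. (nrm (f m n \<ominus> f k n))\<^sup>2) \<le> e\<^sup>2" if k: "k \<ge> N" for k
      proof -
        have "(\<Sum>n<M. (nrm (f m n \<ominus> f k n))\<^sup>2) \<le> (hnorm (ell2 S) (hsub (ell2 S) (f m) (f k)))\<^sup>2"
          using sum_nrm_le_hnorm_ell2[OF D[of m k]] by simp
        also have "\<dots> \<le> e\<^sup>2" using N m k hnorm_ell2_nonneg[OF D[of m k]] by (intro power_mono) (auto intro: less_imp_le)
        finally show ?thesis .
      qed
      then show "\<exists>N. \<forall>k\<ge>N. (\<Sum>n<M. (nrm (f m n \<ominus> f k n))\<^sup>2) \<le> e\<^sup>2" by blast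
    qed
    then show ?thesis by blast
  qed
  have E: "\<exists>N. \<forall>m\<ge>N. hsub (ell2 S) (f m) x \<in> hcarrier (ell2 S) \<and> hnorm (ell2 S) (hsub (ell2 S) (f m) x) \<le> e"
    if e: "e > 0" for e
  proof -
    obtain N where N: "\<forall>m\<ge>N. \<forall>M. (\<Sum>n<M. (nrm (f m n \<ominus> x n))\<^sup>2) \<le> e\<^sup>2" using part[OF e] by blast
    have "hsub (ell2 S) (f m) x \<in> hcarrier (ell2 S) \<and> hnorm (ell2 S) (hsub (ell2 S) (f m) x) \<le> e" if m: "m \<ge> N" for m
    proof -
      have "summable (\<lambda>n. (nrm (f m n \<ominus> x n))\<^sup>2)"
        using N m by (intro summableI_nonneg_bounded[of _ "e\<^sup>2"]) auto
      then have mem: "hsub (ell2 S) (f m) x \<in> hcarrier (ell2 S)" and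
        "(\<Sum>n. (nrm (f m n \<ominus> x n))\<^sup>2) \<le> e\<^sup>2"
        using fV xV N m by (auto intro!: suminf_le_const)
      then have "(hnorm (ell2 S) (hsub (ell2 S) (f m) x))\<^sup>2 \<le> e\<^sup>2" using hnorm_ell2[OF mem] by simp
      then show ?thesis using mem e by (simp add: power2_le_iff_abs_le)
    qed
    then show ?thesis by blast
  qed
  obtain m where m: "hsub (ell2 S) (f m) x \<in> hcarrier (ell2 S)" using E[of 1] by auto
  \<comment> \<open>So far only f m - x is known to be square-summable; x inherits this as f m - (f
    m - x).\<close>
  have "x = hsub (ell2 S) (f m) (hsub (ell2 S) (f m) x)"
  proof
    fix n show "x n = hsub (ell2 S) (f m) (hsub (ell2 S) (f m) x) n"
      using fV xV by (intro ip_left_eqI) auto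
  qed
  then have x: "x \<in> hcarrier (ell2 S)" using ell2_sub_closed[OF f[of m] m] by metis
  have "(\<lambda>k. hnorm (ell2 S) (hsub (ell2 S) (f k) x)) \<longlonglongrightarrow> 0"
  proof (rule LIMSEQ_I)
    fix r :: real assume "r > 0"
    then obtain N where N: "\<forall>m\<ge>N. hnorm (ell2 S) (hsub (ell2 S) (f m) x) \<le> r/2" using E[of "r/2"] by auto
    have "norm (hnorm (ell2 S) (hsub (ell2 S) (f m) x) - 0) < r" if "m \<ge> N" for m
      using N that hnorm_ell2_nonneg[OF ell2_sub_closed[OF f x], of m] \<open>r > 0\<close> by fastforce
    then show "\<exists>no. \<forall>n\<ge>no. norm (hnorm (ell2 S) (hsub (ell2 S) (f n) x) - 0) < r" by blast
  qed
  then show ?thesis using x by blast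
qed

lemma hilbert_space_ell2: "hilbert_space (ell2 S)"
proof (rule hilbert_spaceI)
  show "hzero (ell2 S) \<in> hcarrier (ell2 S)" by simp
  fix f g h :: "nat \<Rightarrow> 'u" and c d
  assume f: "f \<in> hcarrier (ell2 S)"
  then have fV: "\<And>n. f n \<in> V" by simp
  show "hscale (ell2 S) c f \<in> hcarrier (ell2 S)" by (rule ell2_scale_closed[OF f])
  show "hadd (ell2 S) f (hzero (ell2 S)) = f" using fV by (simp add: add_zero)
  show "hadd (ell2 S) f (hscale (ell2 S) (-1) f) = hzero (ell2 S)" using fV by (simp add: add_minus)
  show "hscale (ell2 S) (c + d) f = hadd (ell2 S) (hscale (ell2 S) c f) (hscale (ell2 S) d f)"
    using fV by (simp add: scale_add_left)
  show "hscale (ell2 S) c (hscale (ell2 S) d f) = hscale (ell2 S) (c * d) f" using fV by (simp add: scale_scale)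
  show "hscale (ell2 S) 1 f = f" using fV by (simp add: scale_one)
  have sq: "Re (hinner (ell2 S) f f) = (\<Sum>n. (nrm (f n))\<^sup>2)"
    using Re_suminf_ip_self(1)[OF f] by simp
  show "0 \<le> Re (hinner (ell2 S) f f)" unfolding sq by (rule Re_suminf_ip_self(2)[OF f])
  show "f = hzero (ell2 S)" if "hinner (ell2 S) f f = 0"
  proof -
    have "(\<Sum>n. (nrm (f n))\<^sup>2) = 0" using sq that by simp
    then have "\<And>n. (nrm (f n))\<^sup>2 = 0" using suminf_eq_zero_iff[of "\<lambda>n. (nrm (f n))\<^sup>2"] f by simp
    then show ?thesis using nrm_eq_0[OF fV] by auto
  qed
  assume g: "g \<in> hcarrier (ell2 S)"
  then have gV: "\<And>n. g n \<in> V" by simp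
  show "hadd (ell2 S) f g \<in> hcarrier (ell2 S)" by (rule ell2_add_closed[OF f g])
  show "hadd (ell2 S) f g = hadd (ell2 S) g f" unfolding ell2_simps by (rule ext) (rule add_commute[OF fV gV])
  show "hscale (ell2 S) c (hadd (ell2 S) f g) = hadd (ell2 S) (hscale (ell2 S) c f) (hscale (ell2 S) c g)"
    using fV gV by (simp add: scale_add_right)
  show "hinner (ell2 S) (hscale (ell2 S) c f) g = c * hinner (ell2 S) f g"
    using fV gV summable_ip[OF f g] by (simp add: suminf_mult)
  have "hinner (ell2 S) g f = (\<Sum>n. cnj (ip (f n) (g n)))"
    unfolding ell2_simps by (intro suminf_cong ip_commute fV gV)
  also have "\<dots> = cnj (hinner (ell2 S) f g)"
    using bounded_linear.suminf[OF bounded_linear_cnj summable_ip[OF f g]] by simp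
  finally show "hinner (ell2 S) g f = cnj (hinner (ell2 S) f g)" .
  assume h: "h \<in> hcarrier (ell2 S)"
  then have hV: "\<And>n. h n \<in> V" by simp
  show "hadd (ell2 S) (hadd (ell2 S) f g) h = hadd (ell2 S) f (hadd (ell2 S) g h)"
    using fV gV hV by (simp add: add_assoc)
  show "hinner (ell2 S) (hadd (ell2 S) f g) h = hinner (ell2 S) f h + hinner (ell2 S) g h"
    using fV gV hV suminf_add[OF summable_ip[OF f h] summable_ip[OF g h]] by simp
qed (rule ell2_complete)

end

section \<open>Transport to another type\<close>

text \<open>The structure of S carried along an injection j into another type. Unitarisability
  speaks about Hilbert spaces over one fixed type, and the sequence space has to be given a copy
  there.\<close>

definition himage :: "('a \<Rightarrow> 'b) \<Rightarrow> 'a chspace \<Rightarrow> 'b chspace" where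
  "himage j S = (let i = inv_into (hcarrier S) j in
    \<lparr>hcarrier = j ` hcarrier S, hzero = j (hzero S),
     hadd = (\<lambda>x y. j (hadd S (i x) (i y))),
     hscale = (\<lambda>c x. j (hscale S c (i x))),
     hinner = (\<lambda>x y. hinner S (i x) (i y))\<rparr>)"

locale hilbert_embedding = hilbert S for S :: "'a chspace" +
  fixes j :: "'a \<Rightarrow> 'b"
  assumes inj: "inj_on j (hcarrier S)"
begin

abbreviation i where "i \<equiv> inv_into V j"
abbreviation S' where "S' \<equiv> himage j S"

lemma i_j [simp]: "x \<in> V \<Longrightarrow> i (j x) = x"
  using inj by simp

lemma himage_simps [simp]:
  "hcarrier S' = j ` V" "hzero S' = j (hzero S)"
  "hadd S' x y = j (i x \<oplus> i y)" "hscale S' c x = j (c \<odot> i x)" "hinner S' x y = ip (i x) (i y)"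
  by (simp_all add: himage_def Let_def)

lemma hnorm_himage [simp]: "hnorm S' x = nrm (i x)"
  by (simp add: hnorm_def)

lemma hsub_himage: "\<lbrakk>x \<in> V; y \<in> V\<rbrakk> \<Longrightarrow> hsub S' (j x) (j y) = j (x \<ominus> y)"
  by (simp add: hsub_def)

lemma hilbert_space_himage: "hilbert_space S'"
proof (rule hilbert_spaceI)
  fix x assume "x \<in> hcarrier S'" "hinner S' x x = 0"
  then show "x = hzero S'" by (auto dest: ip_self_eq_0)
next
  fix x y assume "x \<in> hcarrier S'" "y \<in> hcarrier S'"
  then obtain a b where "x = j a" "y = j b" "a \<in> V" "b \<in> V" by auto
  then show "hinner S' y x = cnj (hinner S' x y)" "hadd S' x y = hadd S' y x"
    using ip_commute[of a b] add_commute[of a b] by auto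
next
  fix f assume f: "\<And>n. f n \<in> hcarrier S'"
    and cau: "\<And>e. e > 0 \<Longrightarrow> \<exists>N::nat. \<forall>m\<ge>N. \<forall>n\<ge>N. hnorm S' (hsub S' (f m) (f n)) < e"
  obtain g where g: "\<And>n. g n \<in> V" and fg: "\<And>n. f n = j (g n)"
    using f unfolding himage_simps image_iff by metis
  have "\<exists>x\<in>V. (\<lambda>n. nrm (g n \<ominus> x)) \<longlonglongrightarrow> 0"
    by (rule complete[OF g]) (use cau g in \<open>simp add: fg hsub_himage\<close>)
  then show "\<exists>x\<in>hcarrier S'. (\<lambda>n. hnorm S' (hsub S' (f n) x)) \<longlonglongrightarrow> 0"
    using g by (auto simp: fg hsub_himage)
qed (auto simp: add_zero add_assoc scale_add_left scale_scale scale_one add_minus scale_add_right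
      ip_self_nonneg)

lemma bounded_op_himage:
  assumes "bounded_op S A" shows "bounded_op S' (\<lambda>x. j (A (i x)))"
  using assms unfolding bounded_op_def by auto

lemma bounded_op_himageD:
  assumes A: "bounded_op S' A" shows "bounded_op S (\<lambda>x. i (A (j x)))"
proof -
  have cl: "A (j x) \<in> j ` V" if "x \<in> V" for x using A that by (auto simp: bounded_op_def)
  have ji: "j (i y) = y" if "y \<in> j ` V" for y using that by (simp add: f_inv_into_f)
  obtain C where C: "\<forall>x\<in>V. nrm (i (A (j x))) \<le> C * nrm x" using A by (auto simp: bounded_op_def)
  show ?thesis
  proof (rule bounded_opI)
    show "i (A (j x)) \<in> V" if "x \<in> V" for x using cl[OF that] by (auto simp: inv_into_into)
    show "i (A (j (x \<oplus> y))) = i (A (j x)) \<oplus> i (A (j y))" if "x \<in> V" "y \<in> V" for x y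
    proof -
      have "A (hadd S' (j x) (j y)) = hadd S' (A (j x)) (A (j y))" using A that by (simp add: bounded_op_def)
      then show ?thesis using that cl by (simp add: inv_into_into)
    qed
    show "i (A (j (c \<odot> x))) = c \<odot> i (A (j x))" if "x \<in> V" for c x
    proof -
      have "A (hscale S' c (j x)) = hscale S' c (A (j x))" using A that by (simp add: bounded_op_def)
      then show ?thesis using that cl by (simp add: inv_into_into)
    qed
    show "nrm (i (A (j x))) \<le> C * nrm x" if "x \<in> V" for x using C that by simp
  qed
qed

lemma unitary_op_himageD:
  assumes A: "unitary_op S' A" shows "unitary_op S (\<lambda>x. i (A (j x)))"
proof -
  have b: "bounded_op S' A" and im: "A ` j ` V = j ` V"
    and ip: "\<And>x y. x \<in> V \<Longrightarrow> y \<in> V \<Longrightarrow> ip (i (A (j x))) (i (A (j y))) = ip x y"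
    using A by (auto simp: unitary_op_def)
  have "(\<lambda>x. i (A (j x))) ` V = i ` (A ` j ` V)" by (simp add: image_image)
  also have "\<dots> = V" unfolding im by (auto simp: image_image)
  finally show ?thesis using bounded_op_himageD[OF b] ip by (simp add: unitary_op_def)
qed

lemma opnorm_himage: "opnorm S' (\<lambda>x. j (A (i x))) = opnorm S A" if "\<And>x. x \<in> V \<Longrightarrow> A x \<in> V"
proof -
  have "{x \<in> hcarrier S'. hnorm S' x \<le> 1} = j ` {x \<in> V. nrm x \<le> 1}" by auto
  then have "(\<lambda>x. hnorm S' (j (A (i x)))) ` {x \<in> hcarrier S'. hnorm S' x \<le> 1}
    = (\<lambda>x. nrm (A x)) ` {x \<in> V. nrm x \<le> 1}"
    using that by (simp add: image_image)
  then show ?thesis unfolding opnorm_def by metis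
qed

text \<open>The representation is conjugated by j, unitarised on the copy, and the similarity is
  pulled back; j is isometric onto the copy, so bounds and unitarity are unchanged.\<close>

lemma similar_to_unitary_of_unitarisable:
  assumes "unitarisable_on G TYPE('b)" and \<rho>: "ub_rep G S \<rho>"
  shows "similar_to_unitary G S \<rho>"
proof -
  define \<rho>' where "\<rho>' g x = j (\<rho> g (i x))" for g x
  have cl: "\<rho> g x \<in> V" if "g \<in> carrier G" "x \<in> V" for g x
    using \<rho> that by (auto simp: ub_rep_def bounded_op_def)
  obtain C where C: "\<forall>g\<in>carrier G. opnorm S (\<rho> g) \<le> C" using \<rho> by (auto simp: ub_rep_def)
  have "ub_rep G S' \<rho>'"
    unfolding ub_rep_def
  proof (intro conjI ballI)
    show "bounded_op S' (\<rho>' g)" if "g \<in> carrier G" for g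
      using \<rho> that unfolding \<rho>'_def[abs_def] by (intro bounded_op_himage) (simp add: ub_rep_def)
    show "\<exists>C. \<forall>g\<in>carrier G. opnorm S' (\<rho>' g) \<le> C"
      using C cl by (intro exI[of _ C]) (simp add: \<rho>'_def[abs_def] opnorm_himage)
  qed (use \<rho> cl in \<open>auto simp: ub_rep_def \<rho>'_def\<close>)
  then have "similar_to_unitary G S' \<rho>'"
    using assms(1) hilbert_space_himage by (simp add: unitarisable_on_def)
  then obtain T U where T: "bounded_op S' T" and U: "bounded_op S' U"
    and TU: "\<forall>x\<in>hcarrier S'. T (U x) = x \<and> U (T x) = x"
    and un: "\<forall>g\<in>carrier G. unitary_op S' (\<lambda>x. T (\<rho>' g (U x)))"
    unfolding similar_to_unitary_def by blast
  have ji: "j (i y) = y" if "y \<in> j ` V" for y using that by (simp add: f_inv_into_f)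
  have TV: "T (j x) \<in> j ` V" "U (j x) \<in> j ` V" if "x \<in> V" for x
    using T U that by (auto simp: bounded_op_def)
  show ?thesis
    unfolding similar_to_unitary_def
  proof (intro exI conjI ballI)
    show "bounded_op S (\<lambda>x. i (T (j x)))" "bounded_op S (\<lambda>x. i (U (j x)))"
      using T U by (auto intro: bounded_op_himageD)
    show "i (T (j (i (U (j x))))) = x" "i (U (j (i (T (j x))))) = x" if "x \<in> V" for x
      using TV[OF that] TU that by (auto simp: ji)
    show "unitary_op S (\<lambda>x. i (T (j (\<rho> g (i (U (j x)))))))" if "g \<in> carrier G" for g
      using unitary_op_himageD[of "\<lambda>x. T (\<rho>' g (U x))"] un that by (simp add: \<rho>'_def)
  qed
qed

end

section \<open>Cardinality of the space of sequences of pairs\<close>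

lemma (in hilbert) infinite_carrier:
  assumes "x \<in> V" "x \<noteq> hzero S" shows "infinite V"
proof
  assume "finite V"
  have "inj (\<lambda>c. c \<odot> x)"
  proof (rule injI)
    fix c d assume eq: "c \<odot> x = d \<odot> x"
    have "c * ip x x = d * ip x x" using arg_cong[OF eq, of "\<lambda>y. ip y x"] assms by simp
    then show "c = d" using ip_self_eq_0 assms by auto
  qed
  moreover have "range (\<lambda>c. c \<odot> x) \<subseteq> V" using assms by auto
  ultimately show False using \<open>finite V\<close> infinite_UNIV_char_0[where 'a = complex]
    by (meson finite_imageD finite_subset)
qed

text \<open>For infinite A, an index together with a pair of elements of A can be coded by a single
  element of A. A sequence becomes the set of codes of its graph, hence a subset of A, with a
  constant first component to land in the required type. Sets thus have room for the whole sequence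
  space.\<close>

lemma sequence_of_pairs_embedding:
  fixes A :: "'a set"
  assumes "infinite A"
  shows "\<exists>j :: (nat \<Rightarrow> 'a \<times> 'a) \<Rightarrow> ('g \<times> 'a) set. inj_on j {f. \<forall>n. f n \<in> A \<times> A}"
proof -
  obtain p where p: "inj_on p (A \<times> A)" "p ` (A \<times> A) = A"
    using card_of_Times_same_infinite[OF assms] by (auto simp: card_of_ordIso[symmetric] bij_betw_def)
  obtain e :: "nat \<Rightarrow> 'a" where e: "inj e" "range e \<subseteq> A" using infinite_countable_subset[OF assms] by blast
  \<comment> \<open>\<open>q n v\<close> codes the index n together with the pair v. Equal codes
    force equal indices, so the n-th term can be recovered from the range.\<close>
  define q where "q n v = p (e n, p v)" for n v
  have q: "n = m \<and> v = w" if "q n v = q m w" "v \<in> A \<times> A" "w \<in> A \<times> A" for n m v w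
  proof -
    have "p v \<in> A" "p w \<in> A" "e n \<in> A" "e m \<in> A" using that p e by auto
    then have "e n = e m" "p v = p w" using inj_onD[OF p(1), of "(e n, p v)" "(e m, p w)"] that by (auto simp: q_def)
    then show ?thesis using e(1) p(1) that by (auto simp: inj_eq dest: inj_onD)
  qed
  define j where "j f = {undefined :: 'g} \<times> range (\<lambda>n. q n (f n))" for f
  have "inj_on j {f. \<forall>n. f n \<in> A \<times> A}"
  proof (rule inj_onI, rule ext)
    fix f g n assume f: "f \<in> {f. \<forall>n. f n \<in> A \<times> A}" and g: "g \<in> {f. \<forall>n. f n \<in> A \<times> A}" and jfg: "j f = j g"
    have "range (\<lambda>n. q n (f n)) = range (\<lambda>n. q n (g n))"
      using arg_cong[OF jfg, of "image snd"] by (simp add: j_def)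
    then obtain m where m: "q n (f n) = q m (g m)" by blast
    have "f n \<in> A \<times> A" "g m \<in> A \<times> A" using f g by blast+
    then show "f n = g n" using q[OF m] by metis
  qed
  then show ?thesis by blast
qed

section \<open>Invariant complements and direct sums of operators\<close>

context hilbert
begin

lemma opnorm_le:
  assumes "\<And>x. x \<in> V \<Longrightarrow> nrm (A x) \<le> C * nrm x" and "0 \<le> C"
  shows "opnorm S A \<le> C"
  unfolding opnorm_def
proof (rule cSup_least)
  show "(\<lambda>x. nrm (A x)) ` {x \<in> V. nrm x \<le> 1} \<noteq> {}"
    using zero_closed nrm_zero by (auto intro!: exI[of _ "hzero S"])
  fix y assume "y \<in> (\<lambda>x. nrm (A x)) ` {x \<in> V. nrm x \<le> 1}"
  then obtain x where x: "x \<in> V" "nrm x \<le> 1" "y = nrm (A x)" by auto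
  then show "y \<le> C" using assms(1)[OF x(1)] mult_left_mono[OF x(2) assms(2)] by simp
qed

lemma nrm_le_opnorm:
  assumes A: "bounded_op S A" and x: "x \<in> V"
  shows "nrm (A x) \<le> opnorm S A * nrm x"
proof (cases "nrm x = 0")
  case True
  obtain C where C: "\<And>x. x \<in> V \<Longrightarrow> nrm (A x) \<le> C * nrm x" using op_bound[OF A] by blast
  then show ?thesis using C[OF x] True by simp
next
  case False
  then have pos: "nrm x > 0" using nrm_nonneg[OF x] by linarith
  obtain C where C: "C > 0" "\<And>x. x \<in> V \<Longrightarrow> nrm (A x) \<le> C * nrm x" using op_bound[OF A] by blast
  have "bdd_above ((\<lambda>x. nrm (A x)) ` {x \<in> V. nrm x \<le> 1})"
  proof (rule bdd_aboveI2)
    fix y assume y: "y \<in> {x \<in> V. nrm x \<le> 1}"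
    show "nrm (A y) \<le> C"
      using order_trans[OF C(2)[of y] mult_left_mono[of "nrm y" 1 C]] y C(1) by simp
  qed
  then have "nrm (A (complex_of_real (1 / nrm x) \<odot> x)) \<le> opnorm S A"
    unfolding opnorm_def using x pos by (intro cSup_upper imageI) (auto simp: norm_divide)
  moreover have "nrm (A (complex_of_real (1 / nrm x) \<odot> x)) = nrm (A x) / nrm x"
    using A x pos by (simp add: op_scale op_closed norm_divide)
  ultimately show ?thesis using pos pos_divide_le_eq by metis
qed

text \<open>The B-orthogonal complement of H + 0 is the graph of all (T x, x): for each x, Riesz for
  the restriction b of B to the first factor solves B ((a, 0), (v, x)) = 0 for all a. As (- T x, 0)
  is the B-orthogonal projection of (0, x) to H + 0, its B-norm is at most that of (0, x), which
  gives the bound sqrt (C / c). The equivalence in the conclusion is what later turns invariance of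
  B into an intertwining relation for T.\<close>

lemma invariant_complement:
  assumes add: "\<And>p q r. \<lbrakk>p \<in> V \<times> V; q \<in> V \<times> V; r \<in> V \<times> V\<rbrakk> \<Longrightarrow> B (hadd (hprod S) p q) r = B p r + B q r"
    and scale: "\<And>c p q. \<lbrakk>p \<in> V \<times> V; q \<in> V \<times> V\<rbrakk> \<Longrightarrow> B (hscale (hprod S) c p) q = c * B p q"
    and herm: "\<And>p q. \<lbrakk>p \<in> V \<times> V; q \<in> V \<times> V\<rbrakk> \<Longrightarrow> B q p = cnj (B p q)"
    and c: "c > 0" and low: "\<And>p. p \<in> V \<times> V \<Longrightarrow> c * (hnorm (hprod S) p)\<^sup>2 \<le> Re (B p p)"
    and up: "\<And>p. p \<in> V \<times> V \<Longrightarrow> Re (B p p) \<le> C * (hnorm (hprod S) p)\<^sup>2"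
  shows "\<exists>T. bounded_op S T \<and> (\<forall>x\<in>V. nrm (T x) \<le> sqrt (C / c) * nrm x) \<and>
     (\<forall>x\<in>V. \<forall>v\<in>V. (\<forall>a\<in>V. B (a, hzero S) (v, x) = 0) \<longleftrightarrow> v = T x)"
proof -
  let ?z = "hzero S"
  interpret P: hilbert "hprod S" by unfold_locales (rule hilbert_space_hprod)
  have BP: "hilbert_space ((hprod S)\<lparr>hinner := B\<rparr>)"
    by (rule P.hilbert_space_equivalent_inner[where c = c and C = C], unfold hprod_simps(1))
      (rule add scale herm c low up; assumption)+
  interpret B: hilbert "(hprod S)\<lparr>hinner := B\<rparr>" by unfold_locales (rule BP)
  have n0: "(hnorm (hprod S) (a, ?z))\<^sup>2 = (nrm a)\<^sup>2" "(hnorm (hprod S) (?z, a))\<^sup>2 = (nrm a)\<^sup>2" if "a \<in> V" for a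
    using that hnorm_hprod[of "(a, ?z)"] hnorm_hprod[of "(?z, a)"] by auto
  have zz: "?z \<oplus> ?z = ?z" by (simp add: add_zero)
  define b where "b x y = B (x, ?z) (y, ?z)" for x y
  have b_add: "b (x \<oplus> y) w = b x w + b y w" if "x \<in> V" "y \<in> V" "w \<in> V" for x y w
    using add[of "(x, ?z)" "(y, ?z)" "(w, ?z)"] that by (simp add: b_def zz)
  have b_scale: "b (k \<odot> x) y = k * b x y" if "x \<in> V" "y \<in> V" for k x y
    using scale[of "(x, ?z)" "(y, ?z)" k] that by (simp add: b_def scale_zero)
  have "hilbert_space (S\<lparr>hinner := b\<rparr>)"
  proof (rule hilbert_space_equivalent_inner[OF b_add b_scale _ c])
    show "b y x = cnj (b x y)" if "x \<in> V" "y \<in> V" for x y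
      using herm[of "(x, ?z)" "(y, ?z)"] that by (simp add: b_def)
    show "c * (nrm x)\<^sup>2 \<le> Re (b x x)" "Re (b x x) \<le> C * (nrm x)\<^sup>2" if "x \<in> V" for x
      using low[of "(x, ?z)"] up[of "(x, ?z)"] n0(1)[OF that] that by (auto simp: b_def)
  qed auto
  then interpret b: hilbert "S\<lparr>hinner := b\<rparr>" by unfold_locales
  have nb: "hnorm (S\<lparr>hinner := b\<rparr>) x = hnorm ((hprod S)\<lparr>hinner := B\<rparr>) (x, ?z)" for x
    by (simp add: hnorm_def b_def)
  have CS: "cmod (B p q) \<le> B.nrm p * B.nrm q" if "p \<in> V \<times> V" "q \<in> V \<times> V" for p q
    using B.Cauchy_Schwarz[of p q] that by simp
  have split: "B (a, ?z) (v, x) = b a v + B (a, ?z) (?z, x)" if "a \<in> V" "v \<in> V" "x \<in> V" for a v x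
  proof -
    have "(v, x) = hadd (hprod S) (v, ?z) (?z, x)" using that add_commute[of ?z x] by (simp add: add_zero)
    then show ?thesis using B.ip_add_right[of "(v, ?z)" "(?z, x)" "(a, ?z)"] that by (simp add: b_def)
  qed
  have "\<exists>v\<in>V. \<forall>a\<in>V. B (a, ?z) (v, x) = 0" if x: "x \<in> V" for x
  proof -
    have "\<exists>v\<in>b.vcarrier. \<forall>a\<in>b.vcarrier. - B (a, ?z) (?z, x) = b.ip a v"
    proof (rule b.riesz)
      fix a a' k assume "a \<in> b.vcarrier"
      then have a: "a \<in> V" by simp
      show "- B (b.vscale k a, ?z) (?z, x) = k * - B (a, ?z) (?z, x)"
        using scale[of "(a, ?z)" "(?z, x)" k] a x by (simp add: scale_zero)
      show "cmod (- B (a, ?z) (?z, x)) \<le> B.nrm (?z, x) * b.nrm a"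
        using CS[of "(a, ?z)" "(?z, x)"] a x by (simp add: nb mult.commute)
      assume "a' \<in> b.vcarrier"
      then have a': "a' \<in> V" by simp
      show "- B (b.vadd a a', ?z) (?z, x) = - B (a, ?z) (?z, x) + - B (a', ?z) (?z, x)"
        using add[of "(a, ?z)" "(a', ?z)" "(?z, x)"] a a' x by (simp add: zz)
    qed
    then obtain v where v: "v \<in> V" and av: "\<And>a. a \<in> V \<Longrightarrow> - B (a, ?z) (?z, x) = b a v" by auto
    have "B (a, ?z) (v, x) = 0" if "a \<in> V" for a
      unfolding split[OF that v x] av[OF that, symmetric] by simp
    then show ?thesis using v by blast
  qed
  then obtain T where TV: "\<And>x. x \<in> V \<Longrightarrow> T x \<in> V"
    and T: "\<And>x a. \<lbrakk>x \<in> V; a \<in> V\<rbrakk> \<Longrightarrow> B (a, ?z) (T x, x) = 0" by metis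
  have uniq: "v = T x" if v: "v \<in> V" and x: "x \<in> V" and 0: "\<And>a. a \<in> V \<Longrightarrow> B (a, ?z) (v, x) = 0" for v x
  proof -
    have "b a v = b a (T x)" if "a \<in> V" for a
      using 0[OF that] T[OF x that] split[OF that v x] split[OF that TV[OF x] x] by (simp add: add_eq_0_iff)
    then show ?thesis using b.ip_right_eqI[of v "T x"] v TV[OF x] by simp
  qed
  have Tn: "nrm (T x) \<le> sqrt (C / c) * nrm x" if x: "x \<in> V" for x
  proof -
    have "(B.nrm (T x, ?z))\<^sup>2 = Re (b (T x) (T x))" using B.nrm_sq[of "(T x, ?z)"] TV[OF x] by (simp add: b_def)
    also have "\<dots> = - Re (B (T x, ?z) (?z, x))"
      using split[OF TV[OF x] TV[OF x] x] T[OF x TV[OF x]] by (simp add: add_eq_0_iff complex_eq_iff)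
    also have "\<dots> \<le> cmod (B (T x, ?z) (?z, x))" by (metis abs_Re_le_cmod abs_le_D2)
    also have "\<dots> \<le> B.nrm (T x, ?z) * B.nrm (?z, x)" using CS TV x by simp
    finally have *: "B.nrm (T x, ?z) * B.nrm (T x, ?z) \<le> B.nrm (T x, ?z) * B.nrm (?z, x)" by (simp add: power2_eq_square)
    have nn: "0 \<le> B.nrm (T x, ?z)" "0 \<le> B.nrm (?z, x)" using TV[OF x] x by auto
    have "B.nrm (T x, ?z) \<le> B.nrm (?z, x)"
      using * nn by (cases "B.nrm (T x, ?z) = 0") auto
    then have "(B.nrm (T x, ?z))\<^sup>2 \<le> (B.nrm (?z, x))\<^sup>2" using nn by (intro power_mono) auto
    then have "c * (nrm (T x))\<^sup>2 \<le> C * (nrm x)\<^sup>2"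
      using low[of "(T x, ?z)"] up[of "(?z, x)"] B.nrm_sq[of "(T x, ?z)"] B.nrm_sq[of "(?z, x)"] TV[OF x] x
        n0(1)[OF TV[OF x]] n0(2)[OF x] by simp
    then have "(nrm (T x))\<^sup>2 \<le> C / c * (nrm x)\<^sup>2" using c by (simp add: field_simps)
    then have "sqrt ((nrm (T x))\<^sup>2) \<le> sqrt (C / c * (nrm x)\<^sup>2)" by (rule real_sqrt_le_mono)
    moreover have "sqrt (C / c * (nrm x)\<^sup>2) = sqrt (C / c) * nrm x" unfolding real_sqrt_mult using x by simp
    ultimately show ?thesis using TV[OF x] by simp
  qed
  have "bounded_op S T"
  proof (rule bounded_opI)
    show "T (x \<oplus> y) = T x \<oplus> T y" if "x \<in> V" "y \<in> V" for x y
    proof (rule uniq[symmetric])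
      fix a assume a: "a \<in> V"
      show "B (a, ?z) (T x \<oplus> T y, x \<oplus> y) = 0"
        using B.ip_add_right[of "(T x, x)" "(T y, y)" "(a, ?z)"] T[OF that(1) a] T[OF that(2) a] that a TV by simp
    qed (use that TV in auto)
    show "T (k \<odot> x) = k \<odot> T x" if "x \<in> V" for k x
    proof (rule uniq[symmetric])
      fix a assume a: "a \<in> V"
      show "B (a, ?z) (k \<odot> T x, k \<odot> x) = 0"
        using B.ip_scale_right[of "(T x, x)" "(a, ?z)" k] T[OF that a] that a TV by simp
    qed (use that TV in auto)
    show "nrm (T x) \<le> sqrt (C / c) * nrm x" if "x \<in> V" for x by (rule Tn[OF that])
  qed (rule TV)
  then show ?thesis using Tn T uniq by blast
qed

section \<open>Operators acting block by block, and single blocks\<close>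

lemma direct_sum_op:
  assumes R: "\<And>n. bounded_op S (R n)" and C: "0 \<le> C" "\<And>n x. x \<in> V \<Longrightarrow> nrm (R n x) \<le> C * nrm x"
  shows "bounded_op (ell2 S) (\<lambda>f n. R n (f n))"
    and "f \<in> hcarrier (ell2 S) \<Longrightarrow> hnorm (ell2 S) (\<lambda>n. R n (f n)) \<le> C * hnorm (ell2 S) f"
proof -
  interpret E: hilbert "ell2 S" by unfold_locales (rule hilbert_space_ell2)
  have le: "(nrm (R n (f n)))\<^sup>2 \<le> C\<^sup>2 * (nrm (f n))\<^sup>2" if "f \<in> hcarrier (ell2 S)" for f n
    using power_mono[OF C(2)[of "f n" n], of 2] that R by (simp add: op_closed power_mult_distrib)
  have sm: "summable (\<lambda>n. (nrm (R n (f n)))\<^sup>2)" if f: "f \<in> hcarrier (ell2 S)" for f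
  proof (rule summable_comparison_test')
    show "summable (\<lambda>n. C\<^sup>2 * (nrm (f n))\<^sup>2)" using f by (intro summable_mult) simp
    show "norm ((nrm (R n (f n)))\<^sup>2) \<le> C\<^sup>2 * (nrm (f n))\<^sup>2" for n using le[OF f] by simp
  qed
  have cl: "(\<lambda>n. R n (f n)) \<in> hcarrier (ell2 S)" if "f \<in> hcarrier (ell2 S)" for f
    using sm[OF that] that R by (simp add: op_closed)
  show bd: "hnorm (ell2 S) (\<lambda>n. R n (f n)) \<le> C * hnorm (ell2 S) f" if f: "f \<in> hcarrier (ell2 S)" for f
  proof (rule power2_le_imp_le)
    have "(\<Sum>n. (nrm (R n (f n)))\<^sup>2) \<le> (\<Sum>n. C\<^sup>2 * (nrm (f n))\<^sup>2)"
      using le[OF f] sm[OF f] f by (intro suminf_le summable_mult) auto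
    also have "\<dots> = C\<^sup>2 * (\<Sum>n. (nrm (f n))\<^sup>2)" using f by (intro suminf_mult) simp
    finally show "(hnorm (ell2 S) (\<lambda>n. R n (f n)))\<^sup>2 \<le> (C * hnorm (ell2 S) f)\<^sup>2"
      using hnorm_ell2[OF f] hnorm_ell2[OF cl[OF f]] by (simp add: power_mult_distrib)
    show "0 \<le> C * hnorm (ell2 S) f" using C hnorm_ell2_nonneg[OF f] by simp
  qed
  show "bounded_op (ell2 S) (\<lambda>f n. R n (f n))"
    by (rule E.bounded_opI[OF cl _ _ bd]) (use R in \<open>auto simp: op_add op_scale\<close>)
qed

text \<open>The isometric embedding of the n-th summand, used to restrict the invariant inner
  product of the whole sum to one block.\<close>

definition single :: "nat \<Rightarrow> 'u \<Rightarrow> nat \<Rightarrow> 'u" where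
  "single n x = (\<lambda>m. if m = n then x else hzero S)"

lemma single_closed: "x \<in> V \<Longrightarrow> single n x \<in> hcarrier (ell2 S)"
  unfolding single_def by (auto intro!: summable_finite[of "{n}"] split: if_splits)

lemma single_add: "\<lbrakk>x \<in> V; y \<in> V\<rbrakk> \<Longrightarrow> single n (x \<oplus> y) = hadd (ell2 S) (single n x) (single n y)"
  by (auto simp: single_def add_zero)

lemma single_scale: "x \<in> V \<Longrightarrow> single n (c \<odot> x) = hscale (ell2 S) c (single n x)"
  by (auto simp: single_def scale_zero)

lemma hnorm_single: "x \<in> V \<Longrightarrow> hnorm (ell2 S) (single n x) = nrm x"
proof -
  have "(\<Sum>m. ip (single n x m) (single n x m)) = (\<Sum>m\<in>{n}. ip (single n x m) (single n x m))"
    by (intro suminf_finite) (auto simp: single_def)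
  then show ?thesis by (simp add: hnorm_def single_def)
qed

end

section \<open>Intertwiners between nearby representations\<close>

lemma unitary_rep_unitary: "unitary_rep G S \<pi> \<Longrightarrow> g \<in> carrier G \<Longrightarrow> unitary_op S (\<pi> g)"
  and unitary_rep_mult: "\<lbrakk>unitary_rep G S \<pi>; g \<in> carrier G; h \<in> carrier G; x \<in> hcarrier S\<rbrakk>
    \<Longrightarrow> \<pi> (g \<otimes>\<^bsub>G\<^esub> h) x = \<pi> g (\<pi> h x)"
  and unitary_rep_one: "\<lbrakk>unitary_rep G S \<pi>; x \<in> hcarrier S\<rbrakk> \<Longrightarrow> \<pi> \<one>\<^bsub>G\<^esub> x = x"
  by (simp_all add: unitary_rep_def)

context hilbert
begin

declare ell2_simps [simp del]

lemma op_zero: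
  assumes "bounded_op S A" shows "A (hzero S) = hzero S"
proof -
  have "A (0 \<odot> hzero S) = 0 \<odot> A (hzero S)" using op_scale[OF assms] by simp
  moreover have "0 \<odot> A (hzero S) = hzero S" using op_closed[OF assms] by (intro ip_left_eqI) auto
  ultimately show ?thesis by (simp add: scale_zero)
qed

text \<open>The point is that M is chosen before n. One similarity T of the whole sum, with inverse
  U, has norm constants C1 and C2; restricting the form <T f, T h> to the n-th block gives an inner
  product equivalent to the given one, with constants free of n.\<close>

lemma uniform_intertwiners:
  fixes G :: "('g, 'b) monoid_scheme" and c :: "nat \<Rightarrow> real"
  assumes G: "group G" and \<pi>: "unitary_rep G S \<pi>" and \<omega>: "\<And>n. unitary_rep G S (\<omega> n)"
    and close: "\<And>n g x. \<lbrakk>g \<in> carrier G; x \<in> V\<rbrakk>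
      \<Longrightarrow> nrm (complex_of_real (c n) \<odot> (\<pi> g x \<ominus> \<omega> n g x)) \<le> nrm x"
    and sim: "\<And>\<rho>. ub_rep G (ell2 (hprod S)) \<rho> \<Longrightarrow> similar_to_unitary G (ell2 (hprod S)) \<rho>"
  shows "\<exists>M. \<forall>n. \<exists>T. bounded_op S T \<and> (\<forall>x\<in>V. nrm (T x) \<le> M * nrm x) \<and>
    (\<forall>g\<in>carrier G. \<forall>x\<in>V. T (\<omega> n g x) = \<pi> g (T x) \<oplus> complex_of_real (c n) \<odot> (\<pi> g x \<ominus> \<omega> n g x))"
proof -
  let ?z = "hzero S" and ?P = "hprod S" and ?E = "ell2 (hprod S)"
  interpret G: group G by (rule G)
  interpret P: hilbert ?P by unfold_locales (rule hilbert_space_hprod)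
  interpret E: hilbert ?E by unfold_locales (rule P.hilbert_space_ell2)
  have \<pi>u: "unitary_op S (\<pi> g)" and \<omega>u: "unitary_op S (\<omega> n g)" if "g \<in> carrier G" for n g
    using unitary_rep_unitary[OF \<pi> that] unitary_rep_unitary[OF \<omega> that] by auto
  note \<pi>b = unitary_bounded[OF \<pi>u] and \<omega>b = unitary_bounded[OF \<omega>u]
  have \<pi>V [simp]: "\<pi> g x \<in> V" and \<omega>V [simp]: "\<omega> n g x \<in> V" if "g \<in> carrier G" "x \<in> V" for n g x
    using unitary_closed[OF \<pi>u] unitary_closed[OF \<omega>u] that by auto
  define d where "d n g x = complex_of_real (c n) \<odot> (\<pi> g x \<ominus> \<omega> n g x)" for n g x
  have db: "bounded_op S (d n g)" if "g \<in> carrier G" for n g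
    unfolding d_def[abs_def] by (rule bounded_op_scale[OF bounded_op_sub[OF \<pi>b[OF that] \<omega>b[OF that]]])
  have dV [simp]: "d n g x \<in> V" if "g \<in> carrier G" "x \<in> V" for n g x
    using op_closed[OF db] that by auto
  have dn: "nrm (d n g x) \<le> nrm x" if "g \<in> carrier G" "x \<in> V" for n g x
    using close that by (simp add: d_def)
  define R where "R n g p = (\<pi> g (fst p) \<oplus> d n g (snd p), \<omega> n g (snd p))" for n g p
  \<comment> \<open>The bound 2 comes from |\<pi>(g) u + d v| <= |u| + |v| and (a + b)^2 + b^2 <= 4
    (a^2 + b^2). It is the same for all n and g, as the sum over the blocks and uniform boundedness
    require.\<close>
  have Rn: "P.nrm (R n g p) \<le> 2 * P.nrm p" if g: "g \<in> carrier G" and p: "p \<in> V \<times> V" for n g p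
  proof (rule power2_le_imp_le)
    have x: "fst p \<in> V" and y: "snd p \<in> V" using p by auto
    have "(P.nrm (R n g p))\<^sup>2 = (nrm (\<pi> g (fst p) \<oplus> d n g (snd p)))\<^sup>2 + (nrm (\<omega> n g (snd p)))\<^sup>2"
      using hnorm_hprod[of "R n g p"] g x y by (simp add: R_def)
    also have "\<dots> \<le> (nrm (fst p) + nrm (snd p))\<^sup>2 + (nrm (snd p))\<^sup>2"
    proof (intro add_mono power_mono)
      show "nrm (\<pi> g (fst p) \<oplus> d n g (snd p)) \<le> nrm (fst p) + nrm (snd p)"
        using nrm_triangle[of "\<pi> g (fst p)" "d n g (snd p)"] dn[OF g y] unitary_nrm[OF \<pi>u[OF g] x] g x y
        by (smt (verit) \<pi>V dV)
      show "nrm (\<omega> n g (snd p)) \<le> nrm (snd p)" using unitary_nrm[OF \<omega>u[OF g] y] by simp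
    qed (use g x y in auto)
    also have "\<dots> \<le> 4 * ((nrm (fst p))\<^sup>2 + (nrm (snd p))\<^sup>2)"
    proof -
      have eq: "4 * (a\<^sup>2 + b\<^sup>2) - ((a + b)\<^sup>2 + b\<^sup>2) = (a - b)\<^sup>2 + 2 * a\<^sup>2 + b\<^sup>2" for a b :: real
        by (simp add: power2_eq_square algebra_simps)
      have "0 \<le> 4 * (a\<^sup>2 + b\<^sup>2) - ((a + b)\<^sup>2 + b\<^sup>2)" for a b :: real
        unfolding eq by (intro add_nonneg_nonneg) auto
      then show ?thesis by (simp only: diff_ge_0_iff_ge)
    qed
    also have "\<dots> = (2 * P.nrm p)\<^sup>2" using hnorm_hprod[OF p] by (simp add: power_mult_distrib)
    finally show "(P.nrm (R n g p))\<^sup>2 \<le> (2 * P.nrm p)\<^sup>2" .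
    show "0 \<le> 2 * P.nrm p" using hnorm_hprod_nonneg[OF p] by simp
  qed
  have Rb: "bounded_op ?P (R n g)" if g: "g \<in> carrier G" for n g
  proof (rule P.bounded_opI)
    show "P.nrm (R n g p) \<le> 2 * P.nrm p" if "p \<in> P.vcarrier" for p using Rn[OF g, of p n] that by simp
    show "R n g p \<in> P.vcarrier" if "p \<in> P.vcarrier" for p using that g by (auto simp: R_def)
    show "R n g (P.vadd p q) = P.vadd (R n g p) (R n g q)" if "p \<in> P.vcarrier" "q \<in> P.vcarrier" for p q
    proof -
      have V: "fst p \<in> V" "snd p \<in> V" "fst q \<in> V" "snd q \<in> V" using that by auto
      have "\<pi> g (fst p \<oplus> fst q) \<oplus> d n g (snd p \<oplus> snd q)
         = (\<pi> g (fst p) \<oplus> d n g (snd p)) \<oplus> (\<pi> g (fst q) \<oplus> d n g (snd q))"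
        using V g by (intro ip_left_eqI) (simp_all add: op_add[OF \<pi>b] op_add[OF db])
      then show ?thesis using V g by (simp add: R_def op_add[OF \<omega>b])
    qed
    show "R n g (P.vscale k p) = P.vscale k (R n g p)" if "p \<in> P.vcarrier" for k p
    proof -
      have V: "fst p \<in> V" "snd p \<in> V" using that by auto
      have "\<pi> g (k \<odot> fst p) \<oplus> d n g (k \<odot> snd p) = k \<odot> (\<pi> g (fst p) \<oplus> d n g (snd p))"
        using V g by (intro ip_left_eqI) (simp_all add: op_scale[OF \<pi>b] op_scale[OF db] algebra_simps)
      then show ?thesis using V g by (simp add: R_def op_scale[OF \<omega>b])
    qed
  qed
  have Rm: "R n (g \<otimes>\<^bsub>G\<^esub> h) p = R n g (R n h p)" if g: "g \<in> carrier G" and h: "h \<in> carrier G" and p: "p \<in> V \<times> V" for n g h p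
  proof -
    have V: "fst p \<in> V" "snd p \<in> V" using p by auto
    have gh: "g \<otimes>\<^bsub>G\<^esub> h \<in> carrier G" using g h by simp
    \<comment> \<open>The cocycle identity d(gh) = \<pi>(g) d(h) + d(g) \<omega>(h): the two mixed
      terms c \<pi>(g) \<omega>(h) on the right cancel.\<close>
    have "\<pi> (g \<otimes>\<^bsub>G\<^esub> h) (fst p) \<oplus> d n (g \<otimes>\<^bsub>G\<^esub> h) (snd p)
       = \<pi> g (\<pi> h (fst p) \<oplus> d n h (snd p)) \<oplus> d n g (\<omega> n h (snd p))"
      using V g h by (intro ip_left_eqI)
        (simp_all add: gh op_add[OF \<pi>b] unitary_rep_mult[OF \<pi>], simp add: d_def op_scale[OF \<pi>b] op_sub[OF \<pi>b]
          unitary_rep_mult[OF \<pi>] unitary_rep_mult[OF \<omega>] algebra_simps)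
    then show ?thesis using V g h by (simp add: R_def unitary_rep_mult[OF \<omega>])
  qed
  define \<rho> where "\<rho> g f = (\<lambda>n. R n g (f n))" for g f
  have fV: "f n \<in> V \<times> V" if "f \<in> hcarrier ?E" for f n using that by (simp add: ell2_simps)
  have \<rho>b: "bounded_op ?E (\<rho> g)" if g: "g \<in> carrier G" for g
    unfolding \<rho>_def[abs_def]
    by (rule P.direct_sum_op(1)[where C = 2]) (use Rb[OF g] Rn[OF g] in auto)
  have \<rho>n: "E.nrm (\<rho> g f) \<le> 2 * E.nrm f" if g: "g \<in> carrier G" and f: "f \<in> hcarrier ?E" for g f
    unfolding \<rho>_def[abs_def]
    by (rule P.direct_sum_op(2)[where C = 2]) (use Rb[OF g] Rn[OF g] f in auto)
  have "ub_rep G ?E \<rho>"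
    unfolding ub_rep_def
  proof (intro conjI ballI)
    show "bounded_op ?E (\<rho> g)" if "g \<in> carrier G" for g by (rule \<rho>b[OF that])
    show "\<rho> (g \<otimes>\<^bsub>G\<^esub> h) f = \<rho> g (\<rho> h f)" if "g \<in> carrier G" "h \<in> carrier G" "f \<in> hcarrier ?E" for g h f
      unfolding \<rho>_def using Rm[OF that(1,2) fV[OF that(3)]] by auto
    show "\<rho> \<one>\<^bsub>G\<^esub> f = f" if f: "f \<in> hcarrier ?E" for f
    proof
      fix n
      have V: "fst (f n) \<in> V" "snd (f n) \<in> V" using fV[OF f, of n] by auto
      have "d n \<one>\<^bsub>G\<^esub> (snd (f n)) = ?z"
        using V by (intro ip_left_eqI) (simp_all, simp add: d_def unitary_rep_one[OF \<pi>] unitary_rep_one[OF \<omega>])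
      then show "\<rho> \<one>\<^bsub>G\<^esub> f n = f n"
        using V by (simp add: \<rho>_def R_def unitary_rep_one[OF \<pi>] unitary_rep_one[OF \<omega>] add_zero)
    qed
    show "\<exists>C. \<forall>g\<in>carrier G. opnorm ?E (\<rho> g) \<le> C"
      using E.opnorm_le[OF \<rho>n] by (intro exI[of _ 2]) auto
  qed
  from sim[OF this] obtain T U where T: "bounded_op ?E T" and U: "bounded_op ?E U"
    and TU: "\<And>f. f \<in> hcarrier ?E \<Longrightarrow> T (U f) = f \<and> U (T f) = f"
    and un: "\<And>g. g \<in> carrier G \<Longrightarrow> unitary_op ?E (\<lambda>f. T (\<rho> g (U f)))"
    unfolding similar_to_unitary_def by blast
  \<comment> \<open>Unitarity of T \<rho>(g) U says that the inner product pulled back along T is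
    \<rho>-invariant.\<close>
  have inv: "E.ip (T (\<rho> g f)) (T (\<rho> g h)) = E.ip (T f) (T h)"
    if g: "g \<in> carrier G" and f: "f \<in> hcarrier ?E" and h: "h \<in> hcarrier ?E" for g f h
    using E.unitary_ip[OF un[OF g] E.op_closed[OF T f] E.op_closed[OF T h]] TU f h by simp
  obtain C1 where C1: "C1 > 0" "\<And>f. f \<in> hcarrier ?E \<Longrightarrow> E.nrm (T f) \<le> C1 * E.nrm f"
    using E.op_bound[OF T] by blast
  obtain C2 where C2: "C2 > 0" "\<And>f. f \<in> hcarrier ?E \<Longrightarrow> E.nrm (U f) \<le> C2 * E.nrm f"
    using E.op_bound[OF U] by blast
  \<comment> \<open>The constant is C1 C2, in the shape sqrt (C / c) that results from C = C1^2 and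
    c = 1 / C2^2.\<close>
  have "\<exists>X. bounded_op S X \<and> (\<forall>x\<in>V. nrm (X x) \<le> sqrt (C1\<^sup>2 / (1 / C2\<^sup>2)) * nrm x) \<and>
    (\<forall>g\<in>carrier G. \<forall>x\<in>V. X (\<omega> n g x) = \<pi> g (X x) \<oplus> complex_of_real (c n) \<odot> (\<pi> g x \<ominus> \<omega> n g x))" for n
  proof -
    define s where "s = P.single n"
    have sV: "s p \<in> hcarrier ?E" if "p \<in> V \<times> V" for p
      unfolding s_def using P.single_closed[of p n] that by simp
    have TsV: "T (s p) \<in> hcarrier ?E" if "p \<in> V \<times> V" for p using E.op_closed[OF T sV[OF that]] .
    have sn: "E.nrm (s p) = P.nrm p" if "p \<in> V \<times> V" for p
      unfolding s_def using P.hnorm_single[of p n] that by simp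
    define B where "B p q = E.ip (T (s p)) (T (s q))" for p q
    \<comment> \<open>Off the n-th block both sides vanish by linearity, so the n-th summand is
      invariant under \<rho>.\<close>
    have sR: "s (R n g p) = \<rho> g (s p)" if "g \<in> carrier G" for g p
      using P.op_zero[OF Rb[OF that]] by (auto simp: s_def P.single_def \<rho>_def)
    have Binv: "B (R n g p) (R n g q) = B p q" if "g \<in> carrier G" "p \<in> V \<times> V" "q \<in> V \<times> V" for g p q
      unfolding B_def sR[OF that(1)] using inv sV that by blast
    have "\<exists>X. bounded_op S X \<and> (\<forall>x\<in>V. nrm (X x) \<le> sqrt (C1\<^sup>2 / (1 / C2\<^sup>2)) * nrm x) \<and>
     (\<forall>x\<in>V. \<forall>v\<in>V. (\<forall>a\<in>V. B (a, ?z) (v, x) = 0) \<longleftrightarrow> v = X x)"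
    proof (rule invariant_complement)
      fix p assume p: "p \<in> V \<times> V"
      have Bp: "Re (B p p) = (E.nrm (T (s p)))\<^sup>2" using E.nrm_sq[OF TsV[OF p]] by (simp add: B_def)
      have le2: "P.nrm p \<le> C2 * E.nrm (T (s p))"
        using C2(2)[OF TsV[OF p]] TU[OF sV[OF p]] sn[OF p] by simp
      have "(P.nrm p)\<^sup>2 \<le> C2\<^sup>2 * (E.nrm (T (s p)))\<^sup>2"
        using power_mono[OF le2 hnorm_hprod_nonneg[OF p], of 2] by (simp add: power_mult_distrib)
      then show "1 / C2\<^sup>2 * (P.nrm p)\<^sup>2 \<le> Re (B p p)"
        using C2(1) unfolding Bp by (simp add: divide_le_eq mult.commute)
      have le1: "E.nrm (T (s p)) \<le> C1 * P.nrm p" using C1(2)[OF sV[OF p]] sn[OF p] by simp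
      show "Re (B p p) \<le> C1\<^sup>2 * (P.nrm p)\<^sup>2"
        unfolding Bp using power_mono[OF le1 E.nrm_nonneg[OF TsV[OF p]], of 2]
        by (simp add: power_mult_distrib)
      fix q assume q: "q \<in> V \<times> V"
      show "B q p = cnj (B p q)" unfolding B_def by (rule E.ip_commute[OF TsV[OF p] TsV[OF q]])
      show "B (P.vscale k p) q = k * B p q" for k
        unfolding B_def s_def using P.single_scale[of p n k] p E.op_scale[OF T sV[OF p]]
          E.ip_scale_left[OF TsV[OF p] TsV[OF q]] by (simp add: s_def)
      fix r assume r: "r \<in> V \<times> V"
      show "B (P.vadd p q) r = B p r + B q r"
        unfolding B_def s_def using P.single_add[of p q n] p q E.op_add[OF T sV[OF p] sV[OF q]]
          E.ip_add_left[OF TsV[OF p] TsV[OF q] TsV[OF r]] by (simp add: s_def)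
    qed (use C2 in simp)
    then obtain X where X: "bounded_op S X" and Xn: "\<forall>x\<in>V. nrm (X x) \<le> sqrt (C1\<^sup>2 / (1 / C2\<^sup>2)) * nrm x"
      and XB: "\<And>x v. \<lbrakk>x \<in> V; v \<in> V\<rbrakk> \<Longrightarrow> (\<forall>a\<in>V. B (a, ?z) (v, x) = 0) \<longleftrightarrow> v = X x" by blast
    have XV: "X x \<in> V" if "x \<in> V" for x using op_closed[OF X that] .
    have "\<pi> g (X x) \<oplus> d n g x = X (\<omega> n g x)" if g: "g \<in> carrier G" and x: "x \<in> V" for g x
    proof -
      \<comment> \<open>As \<pi>(g) is onto, a may be written as \<pi>(g) a'. Then both arguments
        are images under \<open>R n g\<close>, and invariance reduces the claim to (a', 0) being
        orthogonal to (X x, x).\<close>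
      have "B (a, ?z) (\<pi> g (X x) \<oplus> d n g x, \<omega> n g x) = 0" if a: "a \<in> V" for a
      proof -
        obtain a' where a': "a' \<in> V" "a = \<pi> g a'" using unitary_surj[OF \<pi>u[OF g] a] by metis
        have "R n g (a', ?z) = (a, ?z)"
          using a' a by (simp add: R_def op_zero[OF db[OF g]] op_zero[OF \<omega>b[OF g]] add_zero)
        moreover have "R n g (X x, x) = (\<pi> g (X x) \<oplus> d n g x, \<omega> n g x)" by (simp add: R_def)
        ultimately have "B (a, ?z) (\<pi> g (X x) \<oplus> d n g x, \<omega> n g x) = B (a', ?z) (X x, x)"
          using Binv[OF g, of "(a', ?z)" "(X x, x)"] a' x XV by simp
        also have "\<dots> = 0" using XB[OF x XV[OF x]] a' by simp
        finally show ?thesis .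
      qed
      then show ?thesis using XB[of "\<omega> n g x" "\<pi> g (X x) \<oplus> d n g x"] g x XV by simp
    qed
    then show ?thesis using X Xn unfolding d_def by (intro exI[of _ X]) simp
  qed
  then show ?thesis by blast
qed

text \<open>From |A - 1| <= s follows |B - 1| <= s for the adjoint B, and with |A|, |B| <= 2 the
  products A B and B A are within s + 2 s of 1. The iteration asks for 3 s <= 1/2, which is the
  origin of 1/6; U is within 6 s of A and hence within 7 s of 1.\<close>

lemma unitary_near_identity:
  assumes A: "bounded_op S A" and s: "0 \<le> s" "s \<le> 1/6" and As: "\<And>x. x \<in> V \<Longrightarrow> nrm (A x \<ominus> x) \<le> s * nrm x"
  shows "\<exists>U. unitary_op S U \<and> (\<forall>x\<in>V. nrm (U x \<ominus> x) \<le> 7 * s * nrm x) \<and>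
    (\<forall>P Q. unitary_op S P \<longrightarrow> unitary_op S Q \<longrightarrow> (\<forall>x\<in>V. P (A x) = A (Q x)) \<longrightarrow> (\<forall>x\<in>V. P (U x) = U (Q x)))"
proof -
  obtain B where B: "bounded_op S B" and adj: "\<And>x y. x \<in> V \<Longrightarrow> y \<in> V \<Longrightarrow> ip (A x) y = ip x (B y)"
    using adjoint_exists[OF A] by blast
  note AV [simp] = op_closed[OF A] and BV [simp] = op_closed[OF B]
  have Bs: "nrm (B x \<ominus> x) \<le> s * nrm x" if x: "x \<in> V" for x
  proof -
    define y where "y = B x \<ominus> x"
    have y: "y \<in> V" using x by (simp add: y_def)
    have "ip y y = ip x (A y \<ominus> y)"
      using x y adjoint_sym[OF A B adj x y] by (simp add: y_def)
    then have "(nrm y)\<^sup>2 = Re (ip x (A y \<ominus> y))" using y by (simp add: nrm_sq)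
    also have "\<dots> \<le> nrm x * nrm (A y \<ominus> y)"
      using Cauchy_Schwarz[of x "A y \<ominus> y"] complex_Re_le_cmod[of "ip x (A y \<ominus> y)"] x y by simp
    also have "\<dots> \<le> nrm x * (s * nrm y)" using As[OF y] x by (intro mult_left_mono) auto
    finally have "nrm y * nrm y \<le> nrm y * (s * nrm x)" by (simp add: power2_eq_square ac_simps)
    then show ?thesis unfolding y_def[symmetric] using nrm_nonneg[OF y] s x
      by (cases "nrm y = 0") auto
  qed
  have err: "nrm (x \<ominus> f (g x)) \<le> 3 * s * nrm x"
    if V: "\<And>x. x \<in> V \<Longrightarrow> f x \<in> V" "\<And>x. x \<in> V \<Longrightarrow> g x \<in> V"
      and f: "\<And>x. x \<in> V \<Longrightarrow> nrm (f x \<ominus> x) \<le> s * nrm x" and g: "\<And>x. x \<in> V \<Longrightarrow> nrm (g x \<ominus> x) \<le> s * nrm x"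
      and x: "x \<in> V" for f g x
  proof -
    have "nrm (x \<ominus> f (g x)) \<le> nrm (x \<ominus> g x) + nrm (g x \<ominus> f (g x))"
      using V x by (intro nrm_sub_triangle) auto
    also have "\<dots> = nrm (g x \<ominus> x) + nrm (f (g x) \<ominus> g x)" using V x nrm_sub_commute by metis
    also have "\<dots> \<le> s * nrm x + s * nrm (g x)" using f[OF V(2)[OF x]] g[OF x] by simp
    also have "\<dots> \<le> s * nrm x + s * (2 * nrm x)"
    proof (intro add_left_mono mult_left_mono)
      have "nrm (g x) \<le> s * nrm x + nrm x" using nrm_le_sub[of "g x" x] V(2)[OF x] x g[OF x] by simp
      also have "\<dots> \<le> 1 * nrm x + nrm x" using s x by (intro add_right_mono mult_right_mono) auto
      finally show "nrm (g x) \<le> 2 * nrm x" by simp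
    qed (use s in simp)
    finally show ?thesis by simp
  qed
  have "almost_unitary (3 * s) A B"
    unfolding almost_unitary_def using A B adj err[of A B] err[of B A] As Bs by auto
  then obtain U where U: "unitary_op S U" and UA: "\<forall>x\<in>V. nrm (U x \<ominus> A x) \<le> 2 * (3 * s) * nrm x"
    and UPQ: "\<forall>P Q. unitary_op S P \<longrightarrow> unitary_op S Q \<longrightarrow> (\<forall>x\<in>V. P (A x) = A (Q x)) \<longrightarrow> (\<forall>x\<in>V. P (U x) = U (Q x))"
    using unitary_near_almost_unitary[of "3 * s" A B] s by auto
  have "nrm (U x \<ominus> x) \<le> 7 * s * nrm x" if x: "x \<in> V" for x
    using nrm_sub_triangle[of "U x" "A x" x] UA As[OF x] x unitary_closed[OF U x] by fastforce
  then show ?thesis using U UPQ by blast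
qed

text \<open>No explicit \<delta> is produced. If none worked, each 1 / (n + 1) would admit a
  counterexample \<open>\<omega> n\<close>; the bound M common to all of them refutes the one with n
  large.\<close>

lemma near_representation_conjugate:
  fixes G :: "('g, 'b) monoid_scheme"
  assumes G: "group G" and \<pi>: "unitary_rep G S \<pi>" and \<epsilon>: "\<epsilon> > 0"
    and sim: "\<And>\<rho>. ub_rep G (ell2 (hprod S)) \<rho> \<Longrightarrow> similar_to_unitary G (ell2 (hprod S)) \<rho>"
  shows "\<exists>\<delta>>0. \<forall>\<omega>. unitary_rep G S \<omega> \<longrightarrow> (\<forall>g\<in>carrier G. \<forall>x\<in>V. nrm (\<pi> g x \<ominus> \<omega> g x) \<le> \<delta> * nrm x) \<longrightarrow>
    (\<exists>U. unitary_op S U \<and> (\<forall>x\<in>V. nrm (U x \<ominus> x) \<le> \<epsilon> * nrm x) \<and>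
       (\<forall>g\<in>carrier G. \<forall>x\<in>V. \<pi> g (U x) = U (\<omega> g x)))" (is "\<exists>\<delta>>0. \<forall>\<omega>. ?P \<delta> \<omega>")
proof (rule ccontr)
  assume "\<not> ?thesis"
  then have "\<exists>\<omega>. \<not> ?P (1 / Suc n) \<omega>" for n by (metis zero_less_divide_1_iff of_nat_0_less_iff zero_less_Suc)
  then obtain \<omega> where \<omega>P: "\<And>n. \<not> ?P (1 / Suc n) (\<omega> n)" by metis
  then have \<omega>: "\<And>n. unitary_rep G S (\<omega> n)"
    and close: "\<And>n g x. \<lbrakk>g \<in> carrier G; x \<in> V\<rbrakk> \<Longrightarrow> nrm (\<pi> g x \<ominus> \<omega> n g x) \<le> 1 / Suc n * nrm x"
    by blast+
  have no: "\<not> (unitary_op S U \<and> (\<forall>x\<in>V. nrm (U x \<ominus> x) \<le> \<epsilon> * nrm x) \<and>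
       (\<forall>g\<in>carrier G. \<forall>x\<in>V. \<pi> g (U x) = U (\<omega> n g x)))" for n U using \<omega>P[of n] by blast
  have V: "\<pi> g x \<in> V" "\<omega> n g x \<in> V" if "g \<in> carrier G" "x \<in> V" for n g x
    using unitary_closed[OF unitary_rep_unitary[OF \<pi>]] unitary_closed[OF unitary_rep_unitary[OF \<omega>]] that by auto
  have close': "nrm (complex_of_real (real (Suc n)) \<odot> (\<pi> g x \<ominus> \<omega> n g x)) \<le> nrm x" if "g \<in> carrier G" "x \<in> V" for n g x
  proof -
    have "nrm (complex_of_real (real (Suc n)) \<odot> (\<pi> g x \<ominus> \<omega> n g x)) = real (Suc n) * nrm (\<pi> g x \<ominus> \<omega> n g x)"
      using V that by (simp only: nrm_scale sub_closed norm_of_real abs_of_nat)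
    also have "\<dots> \<le> real (Suc n) * (1 / Suc n * nrm x)" using close[OF that] by (intro mult_left_mono) auto
    finally show ?thesis by simp
  qed
  obtain M where M: "\<And>n. \<exists>T. bounded_op S T \<and> (\<forall>x\<in>V. nrm (T x) \<le> M * nrm x) \<and>
    (\<forall>g\<in>carrier G. \<forall>x\<in>V. T (\<omega> n g x) = \<pi> g (T x) \<oplus> complex_of_real (real (Suc n)) \<odot> (\<pi> g x \<ominus> \<omega> n g x))"
    using uniform_intertwiners[of G \<pi> \<omega> "\<lambda>n. real (Suc n)", OF G \<pi> \<omega> close' sim] by blast
  \<comment> \<open>The cap 1/6 is the range in which the nearby unitary is available, and
    \<epsilon> / 7 compensates its constant 7.\<close>
  define s where "s = min (1/6) (\<epsilon> / 7)"
  have s: "0 < s" "s \<le> 1/6" "7 * s \<le> \<epsilon>" using \<epsilon> by (auto simp: s_def)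
  obtain n where "\<bar>M\<bar> / s < real n" using reals_Archimedean2 by blast
  then have "\<bar>M\<bar> < real n * s" using s by (simp add: divide_less_eq)
  then have n: "M \<le> s * real (Suc n)" using s by (simp add: algebra_simps)
  define k where "k = complex_of_real (1 / real (Suc n))"
  have k: "k * complex_of_real (real (Suc n)) = 1" "cmod k = 1 / real (Suc n)" by (auto simp: k_def norm_divide simp del: of_nat_Suc)
  obtain T where T: "bounded_op S T" and TM: "\<And>x. x \<in> V \<Longrightarrow> nrm (T x) \<le> M * nrm x"
    and Tint: "\<And>g x. \<lbrakk>g \<in> carrier G; x \<in> V\<rbrakk> \<Longrightarrow>
      T (\<omega> n g x) = \<pi> g (T x) \<oplus> complex_of_real (real (Suc n)) \<odot> (\<pi> g x \<ominus> \<omega> n g x)"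
    using M[of n] by blast
  have TV: "T x \<in> V" if "x \<in> V" for x using op_closed[OF T that] .
  \<comment> \<open>A = 1 + k T with k = 1 / (n + 1), written as a difference.\<close>
  define A where "A x = x \<ominus> (- k) \<odot> T x" for x
  have A: "bounded_op S A"
    unfolding A_def[abs_def] by (rule bounded_op_sub[OF bounded_op_ident bounded_op_scale[OF T]])
  have As: "nrm (A x \<ominus> x) \<le> s * nrm x" if x: "x \<in> V" for x
  proof -
    have "A x \<ominus> x = k \<odot> T x" using x TV[OF x] by (intro ip_left_eqI) (auto simp: A_def)
    then have "nrm (A x \<ominus> x) = 1 / real (Suc n) * nrm (T x)" using x TV[OF x] k by simp
    also have "\<dots> \<le> 1 / real (Suc n) * (s * real (Suc n) * nrm x)"
      using order_trans[OF TM[OF x] mult_right_mono[OF n nrm_nonneg[OF x]]] by (intro mult_left_mono) auto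
    finally show ?thesis by simp
  qed
  obtain U where U: "unitary_op S U" "\<forall>x\<in>V. nrm (U x \<ominus> x) \<le> 7 * s * nrm x"
    and UPQ: "\<And>P Q. \<lbrakk>unitary_op S P; unitary_op S Q; \<forall>x\<in>V. P (A x) = A (Q x)\<rbrakk> \<Longrightarrow> \<forall>x\<in>V. P (U x) = U (Q x)"
    using unitary_near_identity[OF A _ s(2) As] s by auto
  have "\<forall>x\<in>V. \<pi> g (U x) = U (\<omega> n g x)" if g: "g \<in> carrier G" for g
  proof (rule UPQ)
    show \<pi>u: "unitary_op S (\<pi> g)" and "unitary_op S (\<omega> n g)"
      using unitary_rep_unitary[OF \<pi> g] unitary_rep_unitary[OF \<omega> g] by auto
    \<comment> \<open>Multiplying the relation for T by k cancels the factor n + 1: \<pi> A = \<pi>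
      + k T \<omega> - (\<pi> - \<omega>) = \<omega> + k T \<omega> = A \<omega>.\<close>
    show "\<forall>x\<in>V. \<pi> g (A x) = A (\<omega> n g x)"
    proof
      fix x assume x: "x \<in> V"
      have k': "k * (complex_of_nat (Suc n) * z) = z" for z
        using k(1) by (simp add: mult.assoc[symmetric] del: of_nat_Suc)
      show "\<pi> g (A x) = A (\<omega> n g x)"
        using x g V TV op_sub[OF unitary_bounded[OF \<pi>u]] op_scale[OF unitary_bounded[OF \<pi>u]]
        by (intro ip_left_eqI) (simp_all add: A_def Tint distrib_left k' del: of_nat_Suc)
    qed
  qed
  moreover have "\<forall>x\<in>V. nrm (U x \<ominus> x) \<le> \<epsilon> * nrm x"
    using U(2) mult_right_mono[OF s(3) nrm_nonneg] by (meson order_trans)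
  ultimately show False using no[of U n] U(1) by blast
qed

end

section \<open>The orbit map\<close>

context hilbert
begin

lemma nrm_sub_self: "x \<in> V \<Longrightarrow> nrm (x \<ominus> x) = 0"
  by (simp add: hnorm_def)

text \<open>Being unitary depends only on the values on the carrier; this permits passing to the
  extensional functions that make up \<open>uset S\<close>.\<close>

lemma unitary_op_cong:
  assumes "unitary_op S A" "\<And>x. x \<in> V \<Longrightarrow> A x = B x"
  shows "unitary_op S B"
proof -
  have A: "bounded_op S A" using assms(1) by (rule unitary_bounded)
  obtain C where C: "\<And>x. x \<in> V \<Longrightarrow> nrm (A x) \<le> C * nrm x" using op_bound[OF A] by blast
  have "bounded_op S B"
    by (rule bounded_opI[where C = C])
      (use op_closed[OF A] op_add[OF A] op_scale[OF A] C in \<open>simp_all flip: assms(2)\<close>)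
  moreover have "B ` V = V" using assms by (auto simp: unitary_op_def cong: image_cong_simp)
  moreover have "ip (B x) (B y) = ip x y" if "x \<in> V" "y \<in> V" for x y
    using unitary_ip[OF assms(1) that] assms(2) that by simp
  ultimately show ?thesis by (simp add: unitary_op_def)
qed

lemma unitary_op_compose:
  assumes A: "unitary_op S A" and B: "unitary_op S B"
  shows "unitary_op S (\<lambda>x. A (B x))"
proof -
  have "(\<lambda>x. A (B x)) ` V = A ` B ` V" by (simp add: image_image)
  also have "\<dots> = V" using A B by (simp add: unitary_op_def)
  finally show ?thesis
    using bounded_op_compose[OF unitary_bounded[OF A] unitary_bounded[OF B]] unitary_ip[OF A] unitary_ip[OF B]
      unitary_closed[OF B] by (simp add: unitary_op_def)
qed

lemma unitary_inj:
  assumes U: "unitary_op S U" and "x \<in> V" "y \<in> V" "U x = U y" shows "x = y"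
proof (rule ip_left_eqI)
  fix z assume "z \<in> V"
  then show "ip x z = ip y z" using unitary_ip[OF U, of x z] unitary_ip[OF U, of y z] assms by simp
qed fact+

lemma unitary_inv_apply:
  assumes U: "unitary_op S U" and x: "x \<in> V" shows "inv_into V U (U x) = x"
  using unitary_inj[OF U] x by (intro inv_into_f_f inj_onI) auto

lemma unitary_op_inv:
  assumes U: "unitary_op S U" shows "unitary_op S (inv_into V U)"
proof -
  define W where "W = inv_into V U"
  have WU: "W (U x) = x" if "x \<in> V" for x using unitary_inv_apply[OF U that] by (simp add: W_def)
  have W: "W y \<in> V \<and> U (W y) = y" if "y \<in> V" for y
    using unitary_surj[OF U that] WU by metis
  have ipW: "ip (W x) z = ip x (U z)" if "x \<in> V" "z \<in> V" for x z
    using unitary_ip[OF U, of "W x" z] W that by simp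
  have UV: "U z \<in> V" if "z \<in> V" for z using unitary_closed[OF U that] .
  have "bounded_op S W"
  proof (rule bounded_opI)
    show "nrm (W x) \<le> 1 * nrm x" if "x \<in> V" for x
      using unitary_nrm[OF U, of "W x"] W[OF that] by simp
    show "W (x \<oplus> y) = W x \<oplus> W y" if "x \<in> V" "y \<in> V" for x y
      using that W UV by (intro ip_left_eqI) (simp_all add: ipW)
    show "W (c \<odot> x) = c \<odot> W x" if "x \<in> V" for c x
      using that W UV by (intro ip_left_eqI) (simp_all add: ipW)
  qed (use W in blast)
  moreover have "W ` V = V" using W WU UV by (auto simp: image_iff) metis
  moreover have "ip (W x) (W y) = ip x y" if "x \<in> V" "y \<in> V" for x y
    using ipW[of x "W y"] W that by simp
  ultimately show ?thesis by (simp add: unitary_op_def W_def)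
qed

lemma usetD: "U \<in> uset S \<Longrightarrow> unitary_op S U"
  by (simp add: uset_def)

lemma restrict_mem_uset: "unitary_op S U \<Longrightarrow> restrict U V \<in> uset S"
  unfolding uset_def using unitary_op_cong[of U "restrict U V"] by auto

lemma compose_mem_uset: "\<lbrakk>unitary_op S A; unitary_op S B\<rbrakk> \<Longrightarrow> compose V A B \<in> uset S"
  unfolding compose_def using restrict_mem_uset[OF unitary_op_compose[of A B]] by simp

lemma conj_op_apply:
  assumes "unitary_op S U" "x \<in> V"
  shows "conj_op S U A (U x) = U (A x)"
  using assms by (simp add: conj_op_def unitary_closed unitary_inv_apply)

text \<open>On vectors U x the inverse in the definition of the conjugate disappears, and every
  vector has this form. Most later arguments about orbits use the conjugate only through this
  relation.\<close>

lemma orbit_map_apply: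
  "\<lbrakk>unitary_op S U; g \<in> carrier G; x \<in> V\<rbrakk> \<Longrightarrow> orbit_map G S \<pi> U g (U x) = U (\<pi> g x)"
  by (simp add: orbit_map_def conj_op_apply)

lemma orbit_map_mem_homset:
  assumes G: "group G" and \<pi>: "unitary_rep G S \<pi>" and U: "unitary_op S U"
  shows "orbit_map G S \<pi> U \<in> homset G S"
proof -
  interpret G: group G by (rule G)
  have "unitary_op S (orbit_map G S \<pi> U g)" if g: "g \<in> carrier G" for g
    using unitary_op_compose[OF U unitary_op_compose[OF unitary_rep_unitary[OF \<pi> g] unitary_op_inv[OF U]]]
    by (rule unitary_op_cong) (simp add: orbit_map_def conj_op_def g)
  moreover have "orbit_map G S \<pi> U (g \<otimes>\<^bsub>G\<^esub> h) y = orbit_map G S \<pi> U g (orbit_map G S \<pi> U h y)"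
    if g: "g \<in> carrier G" and h: "h \<in> carrier G" and y: "y \<in> V" for g h y
  proof -
    obtain x where x: "x \<in> V" "U x = y" using unitary_surj[OF U y] by blast
    have "\<pi> h x \<in> V" using unitary_closed[OF unitary_rep_unitary[OF \<pi> h]] x by simp
    then show ?thesis unfolding x(2)[symmetric]
      using x(1) g h by (simp add: orbit_map_apply[OF U] unitary_rep_mult[OF \<pi>])
  qed
  moreover have "orbit_map G S \<pi> U \<one>\<^bsub>G\<^esub> y = y" if y: "y \<in> V" for y
  proof -
    obtain x where x: "x \<in> V" "U x = y" using unitary_surj[OF U y] by blast
    show ?thesis unfolding x(2)[symmetric]
      using x(1) by (simp add: orbit_map_apply[OF U] unitary_rep_one[OF \<pi>])
  qed
  ultimately show ?thesis
    by (simp add: homset_def unitary_rep_def) (simp add: orbit_map_def conj_op_def)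
qed

lemma orbit_map_eqI:
  assumes U: "unitary_op S U" and \<omega>: "\<omega> \<in> homset G S"
    and eq: "\<And>g x. \<lbrakk>g \<in> carrier G; x \<in> V\<rbrakk> \<Longrightarrow> \<omega> g (U x) = U (\<pi> g x)"
  shows "orbit_map G S \<pi> U = \<omega>"
proof (rule extensionalityI[of _ "carrier G"])
  fix g assume g: "g \<in> carrier G"
  show "orbit_map G S \<pi> U g = \<omega> g"
  proof (rule extensionalityI[of _ V])
    show "orbit_map G S \<pi> U g \<in> extensional V" using g by (simp add: orbit_map_def conj_op_def)
    show "\<omega> g \<in> extensional V" using \<omega> g by (simp add: homset_def)
    fix y assume "y \<in> V"
    then obtain x where x: "x \<in> V" "U x = y" using unitary_surj[OF U] by blast
    then show "orbit_map G S \<pi> U g y = \<omega> g y"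
      using orbit_map_apply[OF U g x(1)] eq[OF g x(1)] by metis
  qed
qed (use \<omega> in \<open>auto simp: homset_def orbit_map_def\<close>)

section \<open>The commutant and its cosets\<close>

lemma commutant_iff:
  assumes \<pi>: "unitary_rep G S \<pi>"
  shows "z \<in> commutant G S \<pi> \<longleftrightarrow> z \<in> uset S \<and> (\<forall>g\<in>carrier G. \<forall>x\<in>V. z (\<pi> g x) = \<pi> g (z x))"
proof -
  have "(\<forall>x\<in>V. conj_op S z (\<pi> g) x = \<pi> g x) \<longleftrightarrow> (\<forall>x\<in>V. z (\<pi> g x) = \<pi> g (z x))"
    if z: "unitary_op S z" for g
    using conj_op_apply[OF z] unitary_surj[OF z] unitary_closed[OF z] by metis
  then show ?thesis by (auto simp: commutant_def dest: usetD)
qed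

text \<open>Constancy on cosets of the commutant is what makes the orbit map well defined on the
  quotient.\<close>

lemma orbit_map_compose_commutant:
  assumes G: "group G" and \<pi>: "unitary_rep G S \<pi>" and U: "U \<in> uset S" and z: "z \<in> commutant G S \<pi>"
  shows "orbit_map G S \<pi> (compose V U z) = orbit_map G S \<pi> U"
proof (rule orbit_map_eqI)
  have zu: "unitary_op S z" and zc: "\<And>g x. \<lbrakk>g \<in> carrier G; x \<in> V\<rbrakk> \<Longrightarrow> z (\<pi> g x) = \<pi> g (z x)"
    using z unfolding commutant_iff[OF \<pi>] by (auto dest: usetD)
  have Uu: "unitary_op S U" using U by (rule usetD)
  show "unitary_op S (compose V U z)" using compose_mem_uset[OF Uu zu] by (rule usetD)
  show "orbit_map G S \<pi> U \<in> homset G S" by (rule orbit_map_mem_homset[OF G \<pi> Uu])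
  fix g x assume g: "g \<in> carrier G" and x: "x \<in> V"
  then show "orbit_map G S \<pi> U g (compose V U z x) = compose V U z (\<pi> g x)"
    using orbit_map_apply[OF Uu g unitary_closed[OF zu x]] zc[OF g x]
      unitary_closed[OF unitary_rep_unitary[OF \<pi> g] x] by (simp add: compose_def)
qed

lemma self_mem_zcoset:
  assumes \<pi>: "unitary_rep G S \<pi>" and U: "U \<in> uset S"
  shows "U \<in> zcoset G S \<pi> U"
proof -
  have "unitary_op S (\<lambda>x. x)" using bounded_op_ident by (simp add: unitary_op_def)
  then have "restrict (\<lambda>x. x) V \<in> commutant G S \<pi>"
    unfolding commutant_iff[OF \<pi>] using restrict_mem_uset unitary_closed[OF unitary_rep_unitary[OF \<pi>]] by auto
  moreover have "U = compose V U (restrict (\<lambda>x. x) V)"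
    using U by (intro extensionalityI[of _ V]) (auto simp: uset_def compose_def)
  ultimately show ?thesis unfolding zcoset_def by blast
qed

text \<open>For an element U z of the first coset, w = U'^-1 U z satisfies U' w = U z by
  construction. It commutes with \<pi> because U and U' conjugate \<pi> to the same
  representation.\<close>

lemma zcoset_subset:
  assumes \<pi>: "unitary_rep G S \<pi>" and U: "U \<in> uset S" and U': "U' \<in> uset S"
    and eq: "orbit_map G S \<pi> U = orbit_map G S \<pi> U'"
  shows "zcoset G S \<pi> U \<subseteq> zcoset G S \<pi> U'"
proof
  fix W assume "W \<in> zcoset G S \<pi> U"
  then obtain z where z: "z \<in> commutant G S \<pi>" and W: "W = compose V U z" by (auto simp: zcoset_def)
  have zu: "unitary_op S z" and zc: "\<And>g x. \<lbrakk>g \<in> carrier G; x \<in> V\<rbrakk> \<Longrightarrow> z (\<pi> g x) = \<pi> g (z x)"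
    using z unfolding commutant_iff[OF \<pi>] by (auto dest: usetD)
  note Uu = usetD[OF U] and U'u = usetD[OF U']
  define w where "w = restrict (\<lambda>x. inv_into V U' (U (z x))) V"
  have w: "w \<in> uset S" unfolding w_def
    by (rule restrict_mem_uset[OF unitary_op_compose[OF unitary_op_inv[OF U'u] unitary_op_compose[OF Uu zu]]])
  have wV: "w x \<in> V" if "x \<in> V" for x using unitary_closed[OF usetD[OF w] that] .
  have U'w: "U' (w x) = U (z x)" if "x \<in> V" for x
  proof -
    have "U (z x) \<in> V" using unitary_closed Uu zu that by simp
    then have "U (z x) \<in> U' ` V" using U'u by (simp add: unitary_op_def)
    then show ?thesis using that by (simp add: w_def f_inv_into_f)
  qed
  have "w (\<pi> g x) = \<pi> g (w x)" if g: "g \<in> carrier G" and x: "x \<in> V" for g x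
  proof (rule unitary_inj[OF U'u])
    have \<pi>V: "\<pi> g y \<in> V" if "y \<in> V" for y using unitary_closed[OF unitary_rep_unitary[OF \<pi> g] that] .
    show "w (\<pi> g x) \<in> V" "\<pi> g (w x) \<in> V" using \<pi>V wV x by auto
    have "U' (w (\<pi> g x)) = U (\<pi> g (z x))" using U'w[OF \<pi>V[OF x]] zc[OF g x] by simp
    also have "\<dots> = orbit_map G S \<pi> U g (U (z x))" using orbit_map_apply[OF Uu g unitary_closed[OF zu x], of \<pi>] by simp
    also have "\<dots> = orbit_map G S \<pi> U' g (U' (w x))" using eq U'w[OF x] by simp
    also have "\<dots> = U' (\<pi> g (w x))" using orbit_map_apply[OF U'u g wV[OF x]] .
    finally show "U' (w (\<pi> g x)) = U' (\<pi> g (w x))" .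
  qed
  then have "w \<in> commutant G S \<pi>" unfolding commutant_iff[OF \<pi>] using w by blast
  moreover have "W = compose V U' w"
    unfolding W using U'w by (intro extensionalityI[of _ V]) (auto simp: compose_def)
  ultimately show "W \<in> zcoset G S \<pi> U'" unfolding zcoset_def by blast
qed

text \<open>One direction says that the map induced on cosets is well defined, the other that it is
  injective.\<close>

lemma zcoset_eq_iff:
  assumes G: "group G" and \<pi>: "unitary_rep G S \<pi>" and U: "U \<in> uset S" and U': "U' \<in> uset S"
  shows "zcoset G S \<pi> U = zcoset G S \<pi> U' \<longleftrightarrow> orbit_map G S \<pi> U = orbit_map G S \<pi> U'"
proof
  assume "zcoset G S \<pi> U = zcoset G S \<pi> U'"
  then have "U \<in> zcoset G S \<pi> U'" using self_mem_zcoset[OF \<pi> U] by simp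
  then show "orbit_map G S \<pi> U = orbit_map G S \<pi> U'"
    using orbit_map_compose_commutant[OF G \<pi> U'] by (auto simp: zcoset_def)
next
  assume "orbit_map G S \<pi> U = orbit_map G S \<pi> U'"
  then show "zcoset G S \<pi> U = zcoset G S \<pi> U'"
    using zcoset_subset[OF \<pi> U U'] zcoset_subset[OF \<pi> U' U] by simp
qed

text \<open>The induced map evaluates a chosen representative of the coset; constancy on cosets
  makes the choice immaterial.\<close>

lemma orbit_map_zcoset:
  assumes G: "group G" and \<pi>: "unitary_rep G S \<pi>" and U: "U \<in> uset S"
  shows "orbit_map G S \<pi> (SOME W. W \<in> zcoset G S \<pi> U) = orbit_map G S \<pi> U"
proof -
  have "(SOME W. W \<in> zcoset G S \<pi> U) \<in> zcoset G S \<pi> U"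
    using self_mem_zcoset[OF \<pi> U] by (rule someI[where P = "\<lambda>W. W \<in> zcoset G S \<pi> U"])
  then show ?thesis using orbit_map_compose_commutant[OF G \<pi> U] by (auto simp: zcoset_def)
qed

section \<open>Estimates for the uniform distances\<close>

lemma op_dist_le:
  assumes "\<And>x. x \<in> V \<Longrightarrow> nrm (A x \<ominus> B x) \<le> c * nrm x" "0 \<le> c"
  shows "op_dist S A B \<le> c"
  unfolding op_dist_def using assms by (rule opnorm_le)

lemma nrm_sub_le_op_dist:
  assumes "unitary_op S A" "unitary_op S B" "x \<in> V"
  shows "nrm (A x \<ominus> B x) \<le> op_dist S A B * nrm x"
  unfolding op_dist_def
  using nrm_le_opnorm[OF bounded_op_sub[OF unitary_bounded[OF assms(1)] unitary_bounded[OF assms(2)]] assms(3)] .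

text \<open>This a priori bound is what makes the supremum in \<open>rep_dist\<close> dominate each
  of its members.\<close>

lemma op_dist_le_2:
  assumes A: "unitary_op S A" and B: "unitary_op S B"
  shows "op_dist S A B \<le> 2"
proof (rule op_dist_le)
  fix x assume x: "x \<in> V"
  show "nrm (A x \<ominus> B x) \<le> 2 * nrm x"
    using nrm_sub_le[of "A x" "B x"] unitary_closed[OF A x] unitary_closed[OF B x]
      unitary_nrm[OF A x] unitary_nrm[OF B x] by simp
qed simp

lemma op_dist_le_rep_dist:
  assumes \<pi>: "unitary_rep G S \<pi>" and \<omega>: "unitary_rep G S \<omega>" and g: "g \<in> carrier G"
  shows "op_dist S (\<pi> g) (\<omega> g) \<le> rep_dist G S \<pi> \<omega>"
  unfolding rep_dist_def
proof (rule cSup_upper)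
  show "bdd_above ((\<lambda>g. op_dist S (\<pi> g) (\<omega> g)) ` carrier G)"
    using op_dist_le_2 unitary_rep_unitary[OF \<pi>] unitary_rep_unitary[OF \<omega>] by (intro bdd_aboveI2[of _ _ 2]) auto
qed (use g in auto)

lemma rep_dist_le:
  assumes "group G" and "\<And>g. g \<in> carrier G \<Longrightarrow> op_dist S (\<pi> g) (\<omega> g) \<le> c"
  shows "rep_dist G S \<pi> \<omega> \<le> c"
  unfolding rep_dist_def using assms group.is_monoid monoid.one_closed by (intro cSup_least) fastforce+

text \<open>With y = U a = W b, the difference splits into (U - W) at \<pi>(g) a and W \<pi>(g) (a -
  b). The latter has norm |a - b| = |W a - U a|, another value of U - W. This gives the factor 2 and
  hence continuity of the orbit map.\<close>

lemma rep_dist_orbit_map_le: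
  assumes G: "group G" and \<pi>: "unitary_rep G S \<pi>" and U: "unitary_op S U" and W: "unitary_op S W"
    and c: "0 \<le> c" "op_dist S U W \<le> c"
  shows "rep_dist G S (orbit_map G S \<pi> U) (orbit_map G S \<pi> W) \<le> 2 * c"
proof (rule rep_dist_le[OF G], rule op_dist_le)
  fix g y assume g: "g \<in> carrier G" and y: "y \<in> V"
  have close: "nrm (U x \<ominus> W x) \<le> c * nrm x" if "x \<in> V" for x
    using nrm_sub_le_op_dist[OF U W that] mult_right_mono[OF c(2) nrm_nonneg[OF that]] by linarith
  obtain a where a: "a \<in> V" "U a = y" using unitary_surj[OF U y] by blast
  obtain b where b: "b \<in> V" "W b = y" using unitary_surj[OF W y] by blast
  note P = unitary_rep_unitary[OF \<pi> g]
  have V: "\<pi> g a \<in> V" "\<pi> g b \<in> V" using unitary_closed[OF P] a b by auto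
  have V': "U x \<in> V" "W x \<in> V" if "x \<in> V" for x using unitary_closed U W that by auto
  have na: "nrm a = nrm y" using unitary_nrm[OF U a(1)] a(2) by simp
  have "nrm (orbit_map G S \<pi> U g y \<ominus> orbit_map G S \<pi> W g y) = nrm (U (\<pi> g a) \<ominus> W (\<pi> g b))"
    using orbit_map_apply[OF U g a(1)] orbit_map_apply[OF W g b(1)] a b by metis
  also have "\<dots> \<le> nrm (U (\<pi> g a) \<ominus> W (\<pi> g a)) + nrm (W (\<pi> g a) \<ominus> W (\<pi> g b))"
    using V V' by (intro nrm_sub_triangle) auto
  also have "nrm (W (\<pi> g a) \<ominus> W (\<pi> g b)) = nrm (\<pi> g a \<ominus> \<pi> g b)"
    using unitary_nrm[OF W, of "\<pi> g a \<ominus> \<pi> g b"] V op_sub[OF unitary_bounded[OF W]] by simp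
  also have "\<dots> = nrm (a \<ominus> b)"
    using unitary_nrm[OF P, of "a \<ominus> b"] a b op_sub[OF unitary_bounded[OF P]] by simp
  also have "\<dots> = nrm (W a \<ominus> U a)"
    using unitary_nrm[OF W, of "a \<ominus> b"] a b op_sub[OF unitary_bounded[OF W]] by simp
  also have "\<dots> = nrm (U a \<ominus> W a)" using a V' by (intro nrm_sub_commute) auto
  finally show "nrm (orbit_map G S \<pi> U g y \<ominus> orbit_map G S \<pi> W g y) \<le> 2 * c * nrm y"
    using close[OF V(1)] close[OF a(1)] unitary_nrm[OF P a(1)] na by simp
qed (use c in simp)

text \<open>The version in terms of \<open>rep_dist\<close> and \<open>uset\<close>, with the
  conjugating unitary inverted so that it carries \<pi> to \<omega>. It holds at every unitary
  representation, so it can be used at each point of an orbit.\<close>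

lemma near_homomorphism_conjugate:
  fixes G :: "('g, 'b) monoid_scheme"
  assumes G: "group G" and uni: "unitarisable_on G TYPE(('g \<times> 'u) set)"
    and \<pi>: "unitary_rep G S \<pi>" and \<epsilon>: "\<epsilon> > 0"
  shows "\<exists>\<delta>>0. \<forall>\<omega>\<in>homset G S. rep_dist G S \<pi> \<omega> \<le> \<delta> \<longrightarrow>
    (\<exists>U\<in>uset S. (\<forall>x\<in>V. nrm (x \<ominus> U x) \<le> \<epsilon> * nrm x) \<and> (\<forall>g\<in>carrier G. \<forall>x\<in>V. \<omega> g (U x) = U (\<pi> g x)))"
proof -
  have "\<exists>\<delta>>0. \<forall>\<omega>. unitary_rep G S \<omega> \<longrightarrow> (\<forall>g\<in>carrier G. \<forall>x\<in>V. nrm (\<pi> g x \<ominus> \<omega> g x) \<le> \<delta> * nrm x) \<longrightarrow>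
    (\<exists>U. unitary_op S U \<and> (\<forall>x\<in>V. nrm (U x \<ominus> x) \<le> \<epsilon> * nrm x) \<and>
       (\<forall>g\<in>carrier G. \<forall>x\<in>V. \<pi> g (U x) = U (\<omega> g x)))"
  \<comment> \<open>On the zero space all maps agree, so the identity conjugates. Otherwise the
    carrier is infinite, as the coding of sequences by sets requires.\<close>
  proof (cases "V = {hzero S}")
    case True
    have id: "unitary_op S (\<lambda>x. x)" using bounded_op_ident by (simp add: unitary_op_def)
    have "\<pi> g x = \<omega> g x" if "unitary_rep G S \<omega>" "g \<in> carrier G" "x \<in> V" for \<omega> g x
      using unitary_closed[OF unitary_rep_unitary[OF \<pi>], of g x]
        unitary_closed[OF unitary_rep_unitary[OF that(1)], of g x] that True by simp
    moreover have "nrm (x \<ominus> x) \<le> \<epsilon> * nrm x" if "x \<in> V" for x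
      using nrm_sub_self[OF that] nrm_nonneg[OF that] \<epsilon> by simp
    ultimately show ?thesis using id zero_less_one by blast
  next
    case False
    then obtain x where "x \<in> V" "x \<noteq> hzero S" using zero_closed by blast
    then have inf: "infinite V" by (rule infinite_carrier)
    obtain j :: "(nat \<Rightarrow> 'u \<times> 'u) \<Rightarrow> ('g \<times> 'u) set" where j: "inj_on j {f. \<forall>n. f n \<in> V \<times> V}"
      using sequence_of_pairs_embedding[OF inf] by blast
    interpret P: hilbert "hprod S" by unfold_locales (rule hilbert_space_hprod)
    have "hcarrier (ell2 (hprod S)) \<subseteq> {f. \<forall>n. f n \<in> V \<times> V}" by (auto simp: ell2_simps)
    then have "inj_on j (hcarrier (ell2 (hprod S)))" using j inj_on_subset by blast
    then interpret E: hilbert_embedding "ell2 (hprod S)" j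
      by unfold_locales (auto intro: P.hilbert_space_ell2)
    show ?thesis
      by (rule near_representation_conjugate[OF G \<pi> \<epsilon> E.similar_to_unitary_of_unitarisable[OF uni]])
  qed
  then obtain \<delta> where \<delta>: "\<delta> > 0" and key: "\<And>\<omega>. \<lbrakk>unitary_rep G S \<omega>;
      \<forall>g\<in>carrier G. \<forall>x\<in>V. nrm (\<pi> g x \<ominus> \<omega> g x) \<le> \<delta> * nrm x\<rbrakk> \<Longrightarrow>
    \<exists>U. unitary_op S U \<and> (\<forall>x\<in>V. nrm (U x \<ominus> x) \<le> \<epsilon> * nrm x) \<and>
       (\<forall>g\<in>carrier G. \<forall>x\<in>V. \<pi> g (U x) = U (\<omega> g x))" by blast
  have "\<exists>U\<in>uset S. (\<forall>x\<in>V. nrm (x \<ominus> U x) \<le> \<epsilon> * nrm x) \<and> (\<forall>g\<in>carrier G. \<forall>x\<in>V. \<omega> g (U x) = U (\<pi> g x))"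
    if "\<omega> \<in> homset G S" and d: "rep_dist G S \<pi> \<omega> \<le> \<delta>" for \<omega>
  proof -
    have \<omega>: "unitary_rep G S \<omega>" using that by (simp add: homset_def)
    have "nrm (\<pi> g x \<ominus> \<omega> g x) \<le> \<delta> * nrm x" if g: "g \<in> carrier G" and x: "x \<in> V" for g x
    proof -
      have "op_dist S (\<pi> g) (\<omega> g) \<le> \<delta>" using op_dist_le_rep_dist[OF \<pi> \<omega> g] d by simp
      then show ?thesis
        using nrm_sub_le_op_dist[OF unitary_rep_unitary[OF \<pi> g] unitary_rep_unitary[OF \<omega> g] x]
          mult_right_mono[OF _ nrm_nonneg[OF x]] order_trans by blast
    qed
    then obtain W where W: "unitary_op S W" and Wn: "\<And>x. x \<in> V \<Longrightarrow> nrm (W x \<ominus> x) \<le> \<epsilon> * nrm x"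
      and Wi: "\<And>g x. \<lbrakk>g \<in> carrier G; x \<in> V\<rbrakk> \<Longrightarrow> \<pi> g (W x) = W (\<omega> g x)"
      using key[OF \<omega>] by blast
    \<comment> \<open>Inverting W turns \<pi> W = W \<omega> into \<omega> U = U \<pi>; isometry of
      W preserves the distance from 1.\<close>
    define U where "U = restrict (inv_into V W) V"
    have UW: "U (W x) = x" if "x \<in> V" for x
      using unitary_inv_apply[OF W that] unitary_closed[OF W that] by (simp add: U_def)
    have "nrm (y \<ominus> U y) \<le> \<epsilon> * nrm y" if y: "y \<in> V" for y
    proof -
      obtain x where "x \<in> V" "y = W x" using unitary_surj[OF W y] by metis
      then show ?thesis using Wn unitary_nrm[OF W] UW by simp
    qed
    moreover have "\<omega> g (U y) = U (\<pi> g y)" if g: "g \<in> carrier G" and y: "y \<in> V" for g y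
    proof -
      obtain x where x: "x \<in> V" "y = W x" using unitary_surj[OF W y] by metis
      then show ?thesis using Wi[OF g x(1)] UW[OF x(1)] UW[OF unitary_closed[OF unitary_rep_unitary[OF \<omega> g] x(1)]] by simp
    qed
    moreover have "U \<in> uset S" unfolding U_def by (rule restrict_mem_uset[OF unitary_op_inv[OF W]])
    ultimately show ?thesis by blast
  qed
  then show ?thesis using \<delta> by blast
qed

end

section \<open>Open sets for a distance and for a quotient\<close>

lemma openin_dist_topology:
  "openin (dist_topology A d) W \<longleftrightarrow> W \<subseteq> A \<and> (\<forall>x\<in>W. \<exists>e>0. \<forall>y\<in>A. d x y < e \<longrightarrow> y \<in> W)"
proof -
  \<comment> \<open>Openness only asks for some ball around each point, so taking the minimum of two
    radii handles intersections for any function d.\<close>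
  have "istopology (\<lambda>W. W \<subseteq> A \<and> (\<forall>x\<in>W. \<exists>e>0. \<forall>y\<in>A. d x y < e \<longrightarrow> y \<in> W))"
    unfolding istopology_def
  proof (intro conjI allI impI)
    fix W1 W2
    assume 1: "W1 \<subseteq> A \<and> (\<forall>x\<in>W1. \<exists>e>0. \<forall>y\<in>A. d x y < e \<longrightarrow> y \<in> W1)"
      and 2: "W2 \<subseteq> A \<and> (\<forall>x\<in>W2. \<exists>e>0. \<forall>y\<in>A. d x y < e \<longrightarrow> y \<in> W2)"
    show "W1 \<inter> W2 \<subseteq> A" using 1 by blast
    show "\<forall>x\<in>W1 \<inter> W2. \<exists>e>0. \<forall>y\<in>A. d x y < e \<longrightarrow> y \<in> W1 \<inter> W2"
    proof
      fix x assume x: "x \<in> W1 \<inter> W2"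
      obtain e1 where "e1 > 0" "\<forall>y\<in>A. d x y < e1 \<longrightarrow> y \<in> W1" using 1 x by blast
      moreover obtain e2 where "e2 > 0" "\<forall>y\<in>A. d x y < e2 \<longrightarrow> y \<in> W2" using 2 x by blast
      ultimately show "\<exists>e>0. \<forall>y\<in>A. d x y < e \<longrightarrow> y \<in> W1 \<inter> W2"
        by (intro exI[of _ "min e1 e2"]) auto
    qed
  next
    fix K assume K: "\<forall>W\<in>K. W \<subseteq> A \<and> (\<forall>x\<in>W. \<exists>e>0. \<forall>y\<in>A. d x y < e \<longrightarrow> y \<in> W)"
    show "\<Union>K \<subseteq> A" using K by blast
    show "\<forall>x\<in>\<Union>K. \<exists>e>0. \<forall>y\<in>A. d x y < e \<longrightarrow> y \<in> \<Union>K"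
    proof
      fix x assume "x \<in> \<Union>K"
      then obtain W where W: "W \<in> K" "x \<in> W" by blast
      then obtain e where "e > 0" "\<forall>y\<in>A. d x y < e \<longrightarrow> y \<in> W" using K by blast
      then show "\<exists>e>0. \<forall>y\<in>A. d x y < e \<longrightarrow> y \<in> \<Union>K" using W by blast
    qed
  qed
  then show ?thesis by (simp add: dist_topology_def)
qed

lemma topspace_dist_topology: "topspace (dist_topology A d) = A"
proof
  show "topspace (dist_topology A d) \<subseteq> A"
    using openin_topspace[of "dist_topology A d"] unfolding openin_dist_topology by blast
  have "openin (dist_topology A d) A" unfolding openin_dist_topology using zero_less_one by blast
  then show "A \<subseteq> topspace (dist_topology A d)" by (rule openin_subset)
qed

lemma openin_quotient_topology:
  "openin (quotient_topology X f) W \<longleftrightarrow> W \<subseteq> f ` topspace X \<and> openin X {x \<in> topspace X. f x \<in> W}"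
proof -
  have "istopology (\<lambda>W. W \<subseteq> f ` topspace X \<and> openin X {x \<in> topspace X. f x \<in> W})"
    unfolding istopology_def
  proof (intro conjI allI impI)
    fix W1 W2
    assume 1: "W1 \<subseteq> f ` topspace X \<and> openin X {x \<in> topspace X. f x \<in> W1}"
      and 2: "W2 \<subseteq> f ` topspace X \<and> openin X {x \<in> topspace X. f x \<in> W2}"
    show "W1 \<inter> W2 \<subseteq> f ` topspace X" using 1 by blast
    have "{x \<in> topspace X. f x \<in> W1 \<inter> W2} = {x \<in> topspace X. f x \<in> W1} \<inter> {x \<in> topspace X. f x \<in> W2}" by blast
    then show "openin X {x \<in> topspace X. f x \<in> W1 \<inter> W2}" using 1 2 by (simp add: openin_Int)
  next
    fix K assume K: "\<forall>W\<in>K. W \<subseteq> f ` topspace X \<and> openin X {x \<in> topspace X. f x \<in> W}"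
    show "\<Union>K \<subseteq> f ` topspace X" using K by blast
    have "{x \<in> topspace X. f x \<in> \<Union>K} = (\<Union>W\<in>K. {x \<in> topspace X. f x \<in> W})" by blast
    then show "openin X {x \<in> topspace X. f x \<in> \<Union>K}" using K by auto
  qed
  then show ?thesis by (simp add: quotient_topology_def)
qed

lemma topspace_quotient_topology: "topspace (quotient_topology X f) = f ` topspace X"
proof
  show "topspace (quotient_topology X f) \<subseteq> f ` topspace X"
    using openin_topspace[of "quotient_topology X f"] unfolding openin_quotient_topology by blast
  have "{x \<in> topspace X. f x \<in> f ` topspace X} = topspace X" by blast
  then have "openin (quotient_topology X f) (f ` topspace X)" unfolding openin_quotient_topology by simp
  then show "f ` topspace X \<subseteq> topspace (quotient_topology X f)" by (rule openin_subset)
qed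

text \<open>Continuity of the induced map is the estimate for conjugation by two close unitaries.
  Openness is the conjugacy of nearby representations, applied at an arbitrary point \<omega>0 of
  the orbit instead of \<pi> alone.\<close>

theorem theorem3p3:
  fixes G :: "('g, 'b) monoid_scheme"
    and S :: "'h chspace"
    and \<pi> :: "'g \<Rightarrow> 'h \<Rightarrow> 'h"
  assumes "group G"
    and "unitarisable_on G TYPE(('g \<times> 'h) set)"
    and "hilbert_space S"
    and "unitary_rep G S \<pi>"
  shows "strongly_rigid G S \<pi>"
proof -
  interpret hilbert S by unfold_locales (rule assms)
  note G = assms(1) and uni = assms(2) and \<pi> = assms(4)
  let ?O = "orbit_map G S \<pi>" and ?q = "zcoset G S \<pi>"
  let ?h = "\<lambda>C. ?O (SOME U. U \<in> C)"
  let ?X = "dist_topology (uset S) (op_dist S)" and ?Y = "dist_topology (homset G S) (rep_dist G S)"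
  let ?Q = "quotient_topology ?X ?q" and ?Z = "subtopology ?Y (?O ` uset S)"
  have h: "?h (?q U) = ?O U" if "U \<in> uset S" for U by (rule orbit_map_zcoset[OF G \<pi> that])
  have O_hom: "?O U \<in> homset G S" if "U \<in> uset S" for U by (rule orbit_map_mem_homset[OF G \<pi> usetD[OF that]])
  have topQ: "topspace ?Q = ?q ` uset S" by (simp add: topspace_quotient_topology topspace_dist_topology)
  have topZ: "topspace ?Z = ?O ` uset S" using O_hom by (auto simp: topspace_subtopology topspace_dist_topology)
  have "rigid G S \<pi>"
  proof -
    \<comment> \<open>For rigidity only the existence of a conjugating unitary counts, so any
      \<epsilon> will do, here 1.\<close>
    obtain \<delta> where \<delta>: "\<delta> > 0" and key: "\<And>\<omega>. \<lbrakk>\<omega> \<in> homset G S; rep_dist G S \<pi> \<omega> \<le> \<delta>\<rbrakk> \<Longrightarrow>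
      \<exists>U\<in>uset S. \<forall>g\<in>carrier G. \<forall>x\<in>V. \<omega> g (U x) = U (\<pi> g x)"
      using near_homomorphism_conjugate[OF G uni \<pi> zero_less_one] by blast
    have "unitarily_equiv G S \<pi> \<omega>" if \<omega>: "\<omega> \<in> homset G S" "rep_dist G S \<pi> \<omega> \<le> \<delta>" for \<omega>
    proof -
      obtain U where U: "U \<in> uset S" and "\<And>g x. \<lbrakk>g \<in> carrier G; x \<in> V\<rbrakk> \<Longrightarrow> \<omega> g (U x) = U (\<pi> g x)"
        using key[OF \<omega>] by blast
      then have "?O U = \<omega>" using orbit_map_eqI[OF usetD[OF U] \<omega>(1)] by blast
      then show ?thesis using U by (auto simp: unitarily_equiv_def orbit_map_def)
    qed
    then show ?thesis using \<delta> by (auto simp: rigid_def)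
  qed
  moreover have "homeomorphic_map ?Q ?Z ?h"
  proof (rule bijective_open_imp_homeomorphic_map)
    show "?h ` topspace ?Q = topspace ?Z" unfolding topQ topZ image_image using h by (simp cong: image_cong_simp)
    show "inj_on ?h (topspace ?Q)"
      unfolding topQ
    proof (rule inj_onI)
      fix C D assume "C \<in> ?q ` uset S" "D \<in> ?q ` uset S" and eq: "?h C = ?h D"
      then obtain U W where "U \<in> uset S" "C = ?q U" "W \<in> uset S" "D = ?q W" by blast
      then show "C = D" using eq h zcoset_eq_iff[OF G \<pi>, of U W] by simp
    qed
    show "continuous_map ?Q ?Z ?h"
      unfolding continuous_map_in_subtopology
    proof
      show "?h \<in> topspace ?Q \<rightarrow> ?O ` uset S" unfolding topQ using h by auto
      show "continuous_map ?Q ?Y ?h"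
        unfolding continuous_map_def
      proof (intro conjI allI impI)
        show "?h \<in> topspace ?Q \<rightarrow> topspace ?Y" unfolding topQ topspace_dist_topology using h O_hom by auto
        fix W assume "openin ?Y W"
        then have W: "\<forall>\<omega>\<in>W. \<exists>e>0. \<forall>\<omega>'\<in>homset G S. rep_dist G S \<omega> \<omega>' < e \<longrightarrow> \<omega>' \<in> W"
          by (simp add: openin_dist_topology)
        have "{U \<in> uset S. ?q U \<in> {C \<in> ?q ` uset S. ?h C \<in> W}} = {U \<in> uset S. ?O U \<in> W}"
          using h by auto
        moreover have "openin ?X {U \<in> uset S. ?O U \<in> W}"
          unfolding openin_dist_topology
        proof (intro conjI ballI)
          fix U assume "U \<in> {U \<in> uset S. ?O U \<in> W}"
          then have U: "U \<in> uset S" "?O U \<in> W" by auto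
          obtain e where e: "e > 0" "\<forall>\<omega>'\<in>homset G S. rep_dist G S (?O U) \<omega>' < e \<longrightarrow> \<omega>' \<in> W" using W U(2) by blast
          \<comment> \<open>Radius e/3: the orbit map at most doubles distances, and 2 e / 3 <
            e.\<close>
          have "?O U' \<in> W" if U': "U' \<in> uset S" "op_dist S U U' < e/3" for U'
          proof -
            have "rep_dist G S (?O U) (?O U') \<le> 2 * (e/3)"
              using e U' by (intro rep_dist_orbit_map_le[OF G \<pi> usetD[OF U(1)] usetD[OF U'(1)]]) auto
            also have "\<dots> < e" using e by simp
            finally show ?thesis using e(2) O_hom[OF U'(1)] by blast
          qed
          then show "\<exists>e>0. \<forall>U'\<in>uset S. op_dist S U U' < e \<longrightarrow> U' \<in> {U \<in> uset S. ?O U \<in> W}"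
            using e(1) by (intro exI[of _ "e/3"]) auto
        qed blast
        ultimately show "openin ?Q {C \<in> topspace ?Q. ?h C \<in> W}"
          unfolding topQ openin_quotient_topology topspace_dist_topology by auto
      qed
    qed
    show "open_map ?Q ?Z ?h"
      unfolding open_map_def
    proof (intro allI impI)
      fix W assume "openin ?Q W"
      then have Wq: "W \<subseteq> ?q ` uset S" and "openin ?X {U \<in> uset S. ?q U \<in> W}"
        by (auto simp: openin_quotient_topology topspace_dist_topology)
      then have W: "\<forall>U\<in>{U \<in> uset S. ?q U \<in> W}. \<exists>e>0. \<forall>U'\<in>uset S. op_dist S U U' < e \<longrightarrow> U' \<in> {U \<in> uset S. ?q U \<in> W}"
        by (simp add: openin_dist_topology)
      \<comment> \<open>The image is even open in the whole of Hom, so every orbit is open there;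
        openness relative to the orbit follows by intersecting.\<close>
      have "openin ?Y (?h ` W)"
        unfolding openin_dist_topology
      proof (intro conjI ballI)
        show "?h ` W \<subseteq> homset G S" using Wq h O_hom by auto
        fix \<omega>0 assume "\<omega>0 \<in> ?h ` W"
        then obtain U0 where U0: "U0 \<in> uset S" "?q U0 \<in> W" "\<omega>0 = ?O U0" using Wq h by auto
        obtain e where e: "e > 0" "\<And>U'. \<lbrakk>U' \<in> uset S; op_dist S U0 U' < e\<rbrakk> \<Longrightarrow> ?q U' \<in> W"
          using W U0 by blast
        have \<omega>0: "unitary_rep G S \<omega>0" using O_hom[OF U0(1)] U0(3) by (simp add: homset_def)
        obtain \<delta> where \<delta>: "\<delta> > 0" and key: "\<And>\<omega>. \<lbrakk>\<omega> \<in> homset G S; rep_dist G S \<omega>0 \<omega> \<le> \<delta>\<rbrakk> \<Longrightarrow>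
          \<exists>U\<in>uset S. (\<forall>x\<in>V. nrm (x \<ominus> U x) \<le> e/2 * nrm x) \<and> (\<forall>g\<in>carrier G. \<forall>x\<in>V. \<omega> g (U x) = U (\<omega>0 g x))"
          using near_homomorphism_conjugate[OF G uni \<omega>0, of "e/2"] e(1) by auto
        have "\<omega> \<in> ?h ` W" if \<omega>: "\<omega> \<in> homset G S" "rep_dist G S \<omega>0 \<omega> < \<delta>" for \<omega>
        proof -
          obtain U where U: "U \<in> uset S" and Un: "\<And>x. x \<in> V \<Longrightarrow> nrm (x \<ominus> U x) \<le> e/2 * nrm x"
            and Ui: "\<And>g x. \<lbrakk>g \<in> carrier G; x \<in> V\<rbrakk> \<Longrightarrow> \<omega> g (U x) = U (\<omega>0 g x)"
            using key[of \<omega>] \<omega> by (auto intro: less_imp_le)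
          \<comment> \<open>As \<omega> U = U \<omega>0 and \<omega>0 U0 = U0 \<pi>, the product U
            U0 conjugates \<pi> to \<omega>. It is as close to U0 as U is to 1, and e/2 leaves room
            for the strict inequality.\<close>
          let ?U = "compose V U U0"
          note Uu = usetD[OF U] and U0u = usetD[OF U0(1)]
          have UU: "?U \<in> uset S" by (rule compose_mem_uset[OF Uu U0u])
          have "op_dist S U0 ?U \<le> e/2"
            using Un[OF unitary_closed[OF U0u]] unitary_nrm[OF U0u] e(1)
            by (intro op_dist_le) (auto simp: compose_def)
          then have "?q ?U \<in> W" using e UU by simp
          moreover have "?O ?U = \<omega>"
          proof (rule orbit_map_eqI[OF usetD[OF UU] \<omega>(1)])
            fix g x assume g: "g \<in> carrier G" and x: "x \<in> V"
            show "\<omega> g (?U x) = ?U (\<pi> g x)"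
              using Ui[OF g unitary_closed[OF U0u x]] orbit_map_apply[OF U0u g x, of \<pi>] x
                unitary_closed[OF unitary_rep_unitary[OF \<pi> g] x] by (simp add: compose_def U0(3))
          qed
          ultimately show ?thesis using h[OF UU] by (metis imageI)
        qed
        then show "\<exists>e>0. \<forall>\<omega>\<in>homset G S. rep_dist G S \<omega>0 \<omega> < e \<longrightarrow> \<omega> \<in> ?h ` W"
          using \<delta> by blast
      qed
      moreover have "?h ` W \<subseteq> ?O ` uset S" using Wq h by auto
      ultimately show "openin ?Z (?h ` W)" unfolding openin_subtopology by blast
    qed
  qed
  ultimately show ?thesis by (simp add: strongly_rigid_def)
qed

end
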